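(* Let $M$ be a closed oriented connected smooth manifold of dimension $n\ge2$ with a conformal class $\mathcal{C}$ of Riemannian metrics. Let $V$ be a natural scalar invariant of weight $\ell\neq -n$. Then $V$ is conformally variational within $\mathcal{C}$ if and only if $V$ is naturally conformally variational within $\mathcal{C}$.
   Context: Everything is smooth; $dv_g$ is the Riemannian measure. A natural scalar invariant is a scalar function $V(g)$ given by a universal expression, polynomial in the finite jets of the metric and its inverse, with $\phi^*V(g)=V(\phi^*g)$ for every diffeomorphism $\phi:M\to M$. It has weight $\ell$ if $V(A^2g)=A^\ell V(g)$ for all real constants $A>0$. Let $\mathcal{M}$ be the space of Riemannian metrics on $M$ (with the $C^\infty$ topology). A Riemannian functional is a real-valued functional $\mathcal{S}$ on $\mathcal{M}$ with $\mathcal{S}(\phi^*g)=\mathcal{S}(g)$ for all $g\in\mathcal{M}$ and all diffeomorphisms $\phi$ of $M$. A differentiable Riemannian functional has gradient $B(g)$ at $g$ if $B(g)$ is a smooth symmetric 2-tensor with $\mathcal{S}'(g)(h)=\int_M (h,B(g))\,dv_g$ for all smooth symmetric 2-tensors $h$, where $(\cdot,\cdot)$ is the pointwise pairing by metric contraction. For $\mathcal{C}=\{e^{2\Upsilon}g\mid \Upsilon\in C^\infty(M)\}$, $V$ is conformally variational within $\mathcal{C}$ if there is a functional $\mathcal{S}$ on $\mathcal{C}$ such that for all $g\in\mathcal{C}$ and all $\omega\in C^\infty(M)$, $$\frac{d}{ds}\Big|_{s=0}\mathcal{S}(e^{2s\omega}g)=2\int_M\omega V(g)\,dv_g .$$ $V$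 is naturally conformally variational within $\mathcal{C}$ if there is such an $\mathcal{S}$ that is (the restriction to $\mathcal{C}$ of) a Riemannian functional admitting a gradient at every $g\in\mathcal{C}$. *)

theory Defs
  imports "HOL-Analysis.Analysis" "HOL-Library.Poly_Mapping"
begin

section \<open>Smooth functions on open subsets of Euclidean space\<close>

primrec iter_partial ::
    "'n::finite list \<Rightarrow> (real^'n \<Rightarrow> 'b::real_normed_vector) \<Rightarrow> real^'n \<Rightarrow> 'b" where
  "iter_partial [] f = f"
| "iter_partial (i # is) f =
     (\<lambda>y. frechet_derivative (iter_partial is f) (at y) (axis i 1))"

text \<open>Meant for open \<open>U\<close>. Differentiability of all iterated partial derivatives
  makes all of them continuous, so this is the class of \<open>C\<^sup>\<infinity>\<close> functions.\<close>

definition smooth_on :: "(real^'n::finite) set \<Rightarrow> (real^'n \<Rightarrow> 'b::real_normed_vector) \<Rightarrow> bool" where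
  "smooth_on U f \<longleftrightarrow> (\<forall>is. \<forall>y\<in>U. iter_partial is f differentiable (at y))"


section \<open>Smooth manifolds\<close>

text \<open>A manifold is a topological space given as a type \<open>'m\<close>, with a maximal smooth atlas; its
  dimension is \<open>CARD('n)\<close>. A chart is a pair of its domain and its coordinate map;
  only the values of the coordinate map on the domain are relevant.\<close>

type_synonym ('m, 'n) chart = "'m set \<times> ('m \<Rightarrow> real^'n)"

abbreviation dom_of :: "('m, 'n) chart \<Rightarrow> 'm set" where
  "dom_of c \<equiv> fst c"

abbreviation coord :: "('m, 'n) chart \<Rightarrow> 'm \<Rightarrow> real^'n" where
  "coord c \<equiv> snd c"

definition coord_inv :: "('m, 'n) chart \<Rightarrow> real^'n \<Rightarrow> 'm" where
  "coord_inv c = inv_into (dom_of c) (coord c)"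

definition is_chart :: "('m::topological_space, 'n::finite) chart \<Rightarrow> bool" where
  "is_chart c \<longleftrightarrow> open (dom_of c) \<and> open (coord c ` dom_of c) \<and>
     homeomorphism (dom_of c) (coord c ` dom_of c) (coord c) (coord_inv c)"

definition local_expr ::
    "('m, 'n) chart \<Rightarrow> ('m, 'n) chart \<Rightarrow> ('m \<Rightarrow> 'm) \<Rightarrow> real^'n \<Rightarrow> real^'n" where
  "local_expr c c' \<phi> = coord c' \<circ> \<phi> \<circ> coord_inv c"

definition jacobian ::
    "('m, 'n::finite) chart \<Rightarrow> ('m, 'n) chart \<Rightarrow> ('m \<Rightarrow> 'm) \<Rightarrow> 'm \<Rightarrow> real^'n^'n" where
  "jacobian c c' \<phi> x = matrix (frechet_derivative (local_expr c c' \<phi>) (at (coord c x)))"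

definition smoothly_compatible ::
    "('m::topological_space, 'n::finite) chart \<Rightarrow> ('m, 'n) chart \<Rightarrow> bool" where
  "smoothly_compatible c c' \<longleftrightarrow>
     smooth_on (coord c ` (dom_of c \<inter> dom_of c')) (local_expr c c' id) \<and>
     smooth_on (coord c' ` (dom_of c \<inter> dom_of c')) (local_expr c' c id)"

definition smooth_structure :: "('m::topological_space, 'n::finite) chart set \<Rightarrow> bool" where
  "smooth_structure A \<longleftrightarrow>
     (\<forall>c\<in>A. is_chart c) \<and>
     (\<Union>c\<in>A. dom_of c) = UNIV \<and>
     (\<forall>c\<in>A. \<forall>c'\<in>A. smoothly_compatible c c') \<and>
     (\<forall>c. is_chart c \<and> (\<forall>c'\<in>A. smoothly_compatible c c') \<longrightarrow> c \<in> A)"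

definition positively_compatible :: "('m, 'n::finite) chart \<Rightarrow> ('m, 'n) chart \<Rightarrow> bool" where
  "positively_compatible c c' \<longleftrightarrow>
     (\<forall>x \<in> dom_of c \<inter> dom_of c'. det (jacobian c c' id x) > 0)"

definition orientation :: "('m, 'n::finite) chart set \<Rightarrow> ('m, 'n) chart set \<Rightarrow> bool" where
  "orientation A Or \<longleftrightarrow>
     Or \<subseteq> A \<and>
     (\<Union>c\<in>Or. dom_of c) = UNIV \<and>
     (\<forall>c\<in>Or. \<forall>c'\<in>Or. positively_compatible c c') \<and>
     (\<forall>c\<in>A. (\<forall>c'\<in>Or. positively_compatible c c') \<longrightarrow> c \<in> Or)"

text \<open>Closed means compact without boundary; charts onto open subsets of \<open>real^'n\<close> exclude a
  boundary, and compactness makes second countability automatic.\<close>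

definition closed_oriented_connected_manifold ::
    "('m::t2_space, 'n::finite) chart set \<Rightarrow> ('m, 'n) chart set \<Rightarrow> bool" where
  "closed_oriented_connected_manifold A Or \<longleftrightarrow>
     smooth_structure A \<and> orientation A Or \<and>
     compact (UNIV :: 'm set) \<and> connected (UNIV :: 'm set)"

definition smooth_functions :: "('m, 'n::finite) chart set \<Rightarrow> ('m \<Rightarrow> real) set" where
  "smooth_functions A = {f. \<forall>c\<in>A. smooth_on (coord c ` dom_of c) (f \<circ> coord_inv c)}"

definition smooth_map :: "('m::topological_space, 'n::finite) chart set \<Rightarrow> ('m \<Rightarrow> 'm) \<Rightarrow> bool" where
  "smooth_map A \<phi> \<longleftrightarrow> continuous_on UNIV \<phi> \<and>
     (\<forall>c\<in>A. \<forall>c'\<in>A. smooth_on (coord c ` (dom_of c \<inter> \<phi> -` dom_of c')) (local_expr c c' \<phi>))"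

definition diffeomorphism ::
    "('m::topological_space, 'n::finite) chart set \<Rightarrow> ('m \<Rightarrow> 'm) \<Rightarrow> bool" where
  "diffeomorphism A \<phi> \<longleftrightarrow> bij \<phi> \<and> smooth_map A \<phi> \<and> smooth_map A (inv \<phi>)"


section \<open>Symmetric 2-tensors and Riemannian metrics\<close>

text \<open>A covariant 2-tensor is given by its components: \<open>h c x $ i $ j\<close> is the component
  \<open>h\<^sub>i\<^sub>j\<close> at \<open>x\<close> in the coordinates of the chart \<open>c\<close>, subject to the tensor transformation
  law. The value is fixed to be 0 where it has no meaning (\<open>c\<close> not in the atlas or \<open>x\<close>
  outside the domain of \<open>c\<close>), so that equality of tensors is equality of functions.\<close>

type_synonym ('m, 'n) tensor2 = "('m, 'n) chart \<Rightarrow> 'm \<Rightarrow> real^'n^'n"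

definition sym_tensors :: "('m, 'n::finite) chart set \<Rightarrow> ('m, 'n) tensor2 set" where
  "sym_tensors A = {h.
     (\<forall>c x. c \<notin> A \<or> x \<notin> dom_of c \<longrightarrow> h c x = 0) \<and>
     (\<forall>c\<in>A. \<forall>x\<in>dom_of c. transpose (h c x) = h c x) \<and>
     (\<forall>c\<in>A. \<forall>c'\<in>A. \<forall>x \<in> dom_of c \<inter> dom_of c'.
        h c x = transpose (jacobian c c' id x) ** h c' x ** jacobian c c' id x) \<and>
     (\<forall>c\<in>A. smooth_on (coord c ` dom_of c) (h c \<circ> coord_inv c))}"

definition metrics :: "('m, 'n::finite) chart set \<Rightarrow> ('m, 'n) tensor2 set" where
  "metrics A = {g \<in> sym_tensors A.
     \<forall>c\<in>A. \<forall>x\<in>dom_of c. \<forall>v. v \<noteq> 0 \<longrightarrow> v \<bullet> (g c x *v v) > 0}"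

definition tensor_add :: "('m, 'n::finite) tensor2 \<Rightarrow> ('m, 'n) tensor2 \<Rightarrow> ('m, 'n) tensor2" where
  "tensor_add h k = (\<lambda>c x. h c x + k c x)"

definition tensor_scale :: "('m \<Rightarrow> real) \<Rightarrow> ('m, 'n::finite) tensor2 \<Rightarrow> ('m, 'n) tensor2" where
  "tensor_scale f h = (\<lambda>c x. f x *\<^sub>R h c x)"

text \<open>\<open>(\<phi>\<^sup>*h)(u, v) = h(d\<phi> u, d\<phi> v)\<close>, computed with any chart \<open>c'\<close> around \<open>\<phi> x\<close>; by the
  transformation law the result does not depend on the choice of \<open>c'\<close>.\<close>

definition pullback ::
    "('m, 'n::finite) chart set \<Rightarrow> ('m \<Rightarrow> 'm) \<Rightarrow> ('m, 'n) tensor2 \<Rightarrow> ('m, 'n) tensor2" where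
  "pullback A \<phi> h = (\<lambda>c x.
     if c \<in> A \<and> x \<in> dom_of c then
       let c' = (SOME c'. c' \<in> A \<and> \<phi> x \<in> dom_of c') in
         transpose (jacobian c c' \<phi> x) ** h c' (\<phi> x) ** jacobian c c' \<phi> x
     else 0)"

text \<open>\<open>(h, b) = \<Sum> g\<^sup>i\<^sup>k g\<^sup>j\<^sup>l h\<^sub>i\<^sub>j b\<^sub>k\<^sub>l\<close> in any chart around \<open>x\<close>; the result does not depend on
  the chart chosen.\<close>

definition pairing ::
    "('m, 'n::finite) chart set \<Rightarrow> ('m, 'n) tensor2 \<Rightarrow> ('m, 'n) tensor2 \<Rightarrow> ('m, 'n) tensor2
     \<Rightarrow> 'm \<Rightarrow> real" where
  "pairing A g h b x =
     (let c = (SOME c. c \<in> A \<and> x \<in> dom_of c); G = matrix_inv (g c x) in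
        \<Sum>i\<in>UNIV. \<Sum>j\<in>UNIV. \<Sum>k\<in>UNIV. \<Sum>l\<in>UNIV.
          G $ i $ k * G $ j $ l * h c x $ i $ j * b c x $ k $ l)"

text \<open>The Riemannian measure: the unique Borel measure given by \<open>sqrt (det g\<^sub>i\<^sub>j)\<close> times
  Lebesgue measure in every chart.\<close>

definition riemannian_measure ::
    "('m::topological_space, 'n::finite) chart set \<Rightarrow> ('m, 'n) tensor2 \<Rightarrow> 'm measure" where
  "riemannian_measure A g = (THE \<mu>. sets \<mu> = sets borel \<and>
     (\<forall>c\<in>A. \<forall>E\<in>sets borel. E \<subseteq> dom_of c \<longrightarrow>
        emeasure \<mu> E =
          (\<integral>\<^sup>+y\<in>coord c ` E. ennreal (sqrt (det (g c (coord_inv c y)))) \<partial>lborel)))"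


section \<open>Natural scalar invariants\<close>

text \<open>The variables \<open>\<partial>\<^sub>i\<^sub>s g\<^sub>i\<^sub>j\<close> and \<open>\<partial>\<^sub>i\<^sub>s g\<^sup>i\<^sup>j\<close>. A polynomial involves only finitely many of
  them, hence only a finite jet.\<close>

datatype 'n jet_var =
    Metric_Jet "'n list" 'n 'n
  | Inverse_Jet "'n list" 'n 'n

primrec jet_value ::
    "('m, 'n::finite) tensor2 \<Rightarrow> ('m, 'n) chart \<Rightarrow> 'm \<Rightarrow> 'n jet_var \<Rightarrow> real" where
  "jet_value g c x (Metric_Jet is i j) =
     iter_partial is (\<lambda>y. g c (coord_inv c y) $ i $ j) (coord c x)"
| "jet_value g c x (Inverse_Jet is i j) =
     iter_partial is (\<lambda>y. matrix_inv (g c (coord_inv c y)) $ i $ j) (coord c x)"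

text \<open>Real polynomials in variables from \<open>'v\<close>, as finitely supported maps from monomials to
  coefficients.\<close>

type_synonym 'v real_mpoly = "('v \<Rightarrow>\<^sub>0 nat) \<Rightarrow>\<^sub>0 real"

definition eval_mpoly :: "('v \<Rightarrow> real) \<Rightarrow> 'v real_mpoly \<Rightarrow> real" where
  "eval_mpoly a P =
     (\<Sum>m \<in> Poly_Mapping.keys P.
        Poly_Mapping.lookup P m * (\<Prod>v \<in> Poly_Mapping.keys m. a v ^ Poly_Mapping.lookup m v))"

text \<open>Universality: the same polynomial gives \<open>V g\<close> for every metric, in every chart and at every
  point. Values of \<open>V\<close> at arguments which are not metrics are irrelevant.\<close>

definition natural_scalar_invariant ::
    "('m::topological_space, 'n::finite) chart set \<Rightarrow> (('m, 'n) tensor2 \<Rightarrow> 'm \<Rightarrow> real) \<Rightarrow> bool" where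
  "natural_scalar_invariant A V \<longleftrightarrow>
     (\<exists>P. \<forall>g\<in>metrics A. \<forall>c\<in>A. \<forall>x\<in>dom_of c. V g x = eval_mpoly (jet_value g c x) P) \<and>
     (\<forall>g\<in>metrics A. \<forall>\<phi>. diffeomorphism A \<phi> \<longrightarrow> V g \<circ> \<phi> = V (pullback A \<phi> g))"

definition has_weight ::
    "('m, 'n::finite) chart set \<Rightarrow> (('m, 'n) tensor2 \<Rightarrow> 'm \<Rightarrow> real) \<Rightarrow> real \<Rightarrow> bool" where
  "has_weight A V l \<longleftrightarrow>
     (\<forall>g\<in>metrics A. \<forall>a>0. \<forall>x. V (tensor_scale (\<lambda>_. a\<^sup>2) g) x = a powr l * V g x)"


section \<open>Riemannian functionals\<close>

text \<open>The \<open>C\<^sup>\<infinity>\<close> topology: uniform convergence of all iterated partial derivatives of the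
  components on compact sets in charts.\<close>

definition smooth_topology :: "('m, 'n::finite) chart set \<Rightarrow> ('m, 'n) tensor2 topology" where
  "smooth_topology A = topology_generated_by
     {{k \<in> sym_tensors A. \<forall>y\<in>K.
         norm (iter_partial is (\<lambda>y. k c (coord_inv c y) - h c (coord_inv c y)) y) < \<epsilon>}
      | h c K is \<epsilon>. h \<in> sym_tensors A \<and> c \<in> A \<and> compact K \<and> K \<subseteq> coord c ` dom_of c \<and> \<epsilon> > 0}"

definition riemannian_functional ::
    "('m::topological_space, 'n::finite) chart set \<Rightarrow> (('m, 'n) tensor2 \<Rightarrow> real) \<Rightarrow> bool" where
  "riemannian_functional A S \<longleftrightarrow>
     (\<forall>g\<in>metrics A. \<forall>\<phi>. diffeomorphism A \<phi> \<longrightarrow> S (pullback A \<phi> g) = S g)"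

text \<open>\<open>S'(g) = L\<close> on the Frechet space of smooth symmetric 2-tensors (in which the metrics
  form an open set), in the sense of Hadamard: \<open>L\<close> is linear and continuous for the \<open>C\<^sup>\<infinity>\<close>
  topology, and \<open>(S(g + tk) - S(g)) / t\<close> tends to \<open>L h\<close> as \<open>t \<rightarrow> 0\<close> and \<open>k \<rightarrow> h\<close>.
  In particular \<open>L h\<close> is the derivative of \<open>S(g + th)\<close> at \<open>t = 0\<close>.\<close>

definition has_functional_derivative ::
    "('m, 'n::finite) chart set \<Rightarrow> (('m, 'n) tensor2 \<Rightarrow> real) \<Rightarrow> ('m, 'n) tensor2
     \<Rightarrow> (('m, 'n) tensor2 \<Rightarrow> real) \<Rightarrow> bool" where
  "has_functional_derivative A S g L \<longleftrightarrow>
     (\<forall>h\<in>sym_tensors A. \<forall>k\<in>sym_tensors A. L (tensor_add h k) = L h + L k) \<and>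
     (\<forall>h\<in>sym_tensors A. \<forall>a. L (tensor_scale (\<lambda>_. a) h) = a * L h) \<and>
     continuous_map (smooth_topology A) euclideanreal L \<and>
     (\<forall>h\<in>sym_tensors A.
        ((\<lambda>(t, k). (S (tensor_add g (tensor_scale (\<lambda>_. t) k)) - S g) / t) \<longlongrightarrow> L h)
          (at 0 \<times>\<^sub>F nhdsin (smooth_topology A) h))"

definition differentiable_functional ::
    "('m, 'n::finite) chart set \<Rightarrow> (('m, 'n) tensor2 \<Rightarrow> real) \<Rightarrow> bool" where
  "differentiable_functional A S \<longleftrightarrow> (\<forall>g\<in>metrics A. \<exists>L. has_functional_derivative A S g L)"

definition has_gradient ::
    "('m::topological_space, 'n::finite) chart set \<Rightarrow> (('m, 'n) tensor2 \<Rightarrow> real)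
     \<Rightarrow> ('m, 'n) tensor2 \<Rightarrow> ('m, 'n) tensor2 \<Rightarrow> bool" where
  "has_gradient A S g B \<longleftrightarrow> B \<in> sym_tensors A \<and>
     (\<exists>L. has_functional_derivative A S g L \<and>
        (\<forall>h\<in>sym_tensors A. L h = (\<integral>x. pairing A g h B x \<partial>riemannian_measure A g)))"


section \<open>Conformal variations\<close>

definition conformal_class ::
    "('m, 'n::finite) chart set \<Rightarrow> ('m, 'n) tensor2 \<Rightarrow> ('m, 'n) tensor2 set" where
  "conformal_class A g = {tensor_scale (\<lambda>x. exp (2 * \<Upsilon> x)) g | \<Upsilon>. \<Upsilon> \<in> smooth_functions A}"

text \<open>Only the values of \<open>S\<close> on the conformal class \<open>C\<close> matter here.\<close>

definition has_conformal_variation ::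
    "('m::topological_space, 'n::finite) chart set \<Rightarrow> ('m, 'n) tensor2 set
     \<Rightarrow> (('m, 'n) tensor2 \<Rightarrow> real) \<Rightarrow> (('m, 'n) tensor2 \<Rightarrow> 'm \<Rightarrow> real) \<Rightarrow> bool" where
  "has_conformal_variation A C S V \<longleftrightarrow>
     (\<forall>g\<in>C. \<forall>\<omega>\<in>smooth_functions A.
        ((\<lambda>s. S (tensor_scale (\<lambda>x. exp (2 * s * \<omega> x)) g)) has_real_derivative
           2 * (\<integral>x. \<omega> x * V g x \<partial>riemannian_measure A g)) (at 0))"

definition conformally_variational ::
    "('m::topological_space, 'n::finite) chart set \<Rightarrow> ('m, 'n) tensor2 set
     \<Rightarrow> (('m, 'n) tensor2 \<Rightarrow> 'm \<Rightarrow> real) \<Rightarrow> bool" where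
  "conformally_variational A C V \<longleftrightarrow> (\<exists>S. has_conformal_variation A C S V)"

definition naturally_conformally_variational ::
    "('m::topological_space, 'n::finite) chart set \<Rightarrow> ('m, 'n) tensor2 set
     \<Rightarrow> (('m, 'n) tensor2 \<Rightarrow> 'm \<Rightarrow> real) \<Rightarrow> bool" where
  "naturally_conformally_variational A C V \<longleftrightarrow>
     (\<exists>S. riemannian_functional A S \<and> differentiable_functional A S \<and>
        (\<forall>g\<in>C. \<exists>B. has_gradient A S g B) \<and>
        has_conformal_variation A C S V)"

end

theory Submission
  imports Defs
begin

text \<open>
  One implication holds because a Riemannian functional restricts to a functional on \<open>C\<close>. For the
  other one, let \<open>S\<^sub>0\<close> be any functional on \<open>C\<close> with conformal variation \<open>2 \<integral> \<omega> V dv\<close>. Since \<open>V\<close> has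
  weight \<open>l\<close> and \<open>dv\<close> has weight \<open>n\<close>, the derivative of \<open>s \<mapsto> S\<^sub>0(exp(2s) g)\<close> for constant \<open>s\<close> is
  \<open>2 exp((n+l)s) \<integral> V(g) dv\<close>, and as \<open>n + l \<noteq> 0\<close>, integration over \<open>0 \<le> s \<le> 1\<close> gives
  \<open>S\<^sub>0(exp(2) g) - S\<^sub>0(g) = 2 (exp(n+l) - 1) / (n+l) \<integral> V(g) dv\<close> for every \<open>g\<close> in \<open>C\<close>. The conformal
  variations of the two terms on the left are \<open>2 exp(n+l) \<integral> \<omega> V dv\<close> and \<open>2 \<integral> \<omega> V dv\<close>; hence
  \<open>S(g) = 2 / (n+l) \<integral> V(g) dv\<close> again has conformal variation \<open>2 \<integral> \<omega> V dv\<close>. This is the lemma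
  \<open>conformal_variation_integral\<close>.

  It remains to see that \<open>S\<close> is a differentiable Riemannian functional with a gradient. Invariance
  under diffeomorphisms (\<open>energy_invariant\<close>) is the naturality of \<open>V\<close> together with that of the
  Riemannian measure, which in turn is the change of variables formula. For the gradient
  (\<open>energy_derivative\<close>) a partition of unity writes \<open>S\<close> as a finite sum of integrals over compact
  sets in the images of charts, whose integrands are polynomials in the jets of the metric and of its inverse,
  times the volume density. The difference quotients of such an expression converge uniformly on
  compact sets to a linear differential operator in the variation \<open>h\<close> (\<open>linearizable_eval_mpoly\<close>,
  \<open>linearizable_vol\<close>). Integration by parts moves all derivatives away from \<open>h\<close> (\<open>has_adjoint\<close>) and
  leaves a smooth kernel with compact support in the chart. Lowering its indices with the metric and
  dividing by the volume density turns it into a symmetric tensor field that extends by zero to the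
  whole manifold (\<open>kernel_functional_represented\<close>), and the sum of these fields is the gradient.
\<close>

(* The dollar sign is to denote components of vectors only, not coefficients of power series. *)
no_notation fps_nth (infixl "$" 75)

section \<open>Calculus of smooth functions\<close>

definition partial_deriv ::
    "'n::finite \<Rightarrow> (real^'n \<Rightarrow> 'b::real_normed_vector) \<Rightarrow> real^'n \<Rightarrow> 'b" where
  "partial_deriv i f = (\<lambda>y. frechet_derivative f (at y) (axis i 1))"

text \<open>The recursion takes the innermost derivative first, whereas \<open>iter_partial\<close> peels off the
  outermost one. Product and chain rule are applied innermost, so closure properties are proved by
  induction on the order for this notion and then transferred to \<open>smooth_on\<close>.\<close>

primrec times_differentiable ::
    "nat \<Rightarrow> (real^'n::finite) set \<Rightarrow> (real^'n \<Rightarrow> 'b::real_normed_vector) \<Rightarrow> bool" where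
  "times_differentiable 0 U f \<longleftrightarrow> True"
| "times_differentiable (Suc n) U f \<longleftrightarrow>
     (\<forall>y\<in>U. f differentiable (at y)) \<and> (\<forall>i. times_differentiable n U (partial_deriv i f))"

lemma iter_partial_snoc: "iter_partial (is @ [i]) f = iter_partial is (partial_deriv i f)"
  by (induction "is") (auto simp: partial_deriv_def)

lemma iter_partial_Cons: "iter_partial (i # is) f = partial_deriv i (iter_partial is f)"
  by (simp add: partial_deriv_def)

lemma times_differentiable_iff:
  "times_differentiable n U f \<longleftrightarrow>
     (\<forall>is. length is < n \<longrightarrow> (\<forall>y\<in>U. iter_partial is f differentiable (at y)))"
proof (induction n arbitrary: f)
  case (Suc n)
  have "(\<forall>is. length is < Suc n \<longrightarrow> P is) \<longleftrightarrow> P [] \<and> (\<forall>i is. length is < n \<longrightarrow> P (is @ [i]))"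
    for P :: "'a list \<Rightarrow> bool"
    by (metis length_append_singleton list.size(3) not_less_eq rev_exhaust zero_less_Suc)
  from this[of "\<lambda>is. \<forall>y\<in>U. iter_partial is f differentiable (at y)"] show ?case
    unfolding times_differentiable.simps Suc.IH iter_partial_snoc[symmetric] by auto
qed simp

lemma smooth_on_iff_times_differentiable: "smooth_on U f \<longleftrightarrow> (\<forall>n. times_differentiable n U f)"
  unfolding smooth_on_def times_differentiable_iff by blast

lemma partial_deriv_eqI:
  assumes "(f has_derivative f') (at y)"
  shows "partial_deriv i f y = f' (axis i 1)"
  using frechet_derivative_at[OF assms] by (simp add: partial_deriv_def)

lemma differentiable_has_derivative:
  "f differentiable (at y) \<Longrightarrow> (f has_derivative frechet_derivative f (at y)) (at y)"
  by (simp add: frechet_derivative_works)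

lemma differentiable_cong_open:
  assumes "open U" "\<And>y. y \<in> U \<Longrightarrow> f y = g y" "y \<in> U"
  shows "f differentiable (at y) \<longleftrightarrow> g differentiable (at y)"
    and "partial_deriv i f y = partial_deriv i g y"
proof -
  have *: "(f has_derivative f') (at y) \<longleftrightarrow> (g has_derivative f') (at y)" for f'
    using has_derivative_transform_within_open[OF _ assms(1,3)] assms(2) by metis
  show "f differentiable (at y) \<longleftrightarrow> g differentiable (at y)"
    by (simp add: differentiable_def *)
  show "partial_deriv i f y = partial_deriv i g y"
    by (simp add: partial_deriv_def frechet_derivative_def *)
qed

lemma iter_partial_cong_open:
  assumes "open U" "\<And>y. y \<in> U \<Longrightarrow> f y = g y" "y \<in> U"
  shows "iter_partial is f y = iter_partial is g y"
  using assms(3)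
proof (induction "is" arbitrary: y)
  case (Cons i "is")
  then show ?case
    unfolding iter_partial_Cons by (intro differentiable_cong_open(2)[OF assms(1)])
qed (simp add: assms)

lemma times_differentiable_cong:
  assumes "open U" "\<And>y. y \<in> U \<Longrightarrow> f y = g y"
  shows "times_differentiable n U f \<longleftrightarrow> times_differentiable n U g"
  using assms(2)
proof (induction n arbitrary: f g)
  case (Suc n)
  have "times_differentiable n U (partial_deriv i f) \<longleftrightarrow> times_differentiable n U (partial_deriv i g)" for i
    by (rule Suc.IH) (simp add: differentiable_cong_open(2)[OF assms(1) Suc.prems])
  moreover have "\<forall>y\<in>U. f differentiable (at y) \<longleftrightarrow> g differentiable (at y)"
    by (simp add: differentiable_cong_open(1)[OF assms(1) Suc.prems])
  ultimately show ?case by auto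
qed simp

lemma times_differentiable_mono: "times_differentiable n U f \<Longrightarrow> m \<le> n \<Longrightarrow> times_differentiable m U f"
  unfolding times_differentiable_iff by auto

lemma times_differentiable_const: "times_differentiable n U (\<lambda>_. c)"
proof (induction n arbitrary: c)
  case (Suc n)
  have "partial_deriv i (\<lambda>_. c) = (\<lambda>_. 0)" for i :: 'a
    by (auto simp: fun_eq_iff intro!: partial_deriv_eqI has_derivative_const)
  with Suc show ?case by simp
qed simp

lemma times_differentiable_bounded_linear:
  assumes "bounded_linear l" "open U" "times_differentiable n U f"
  shows "times_differentiable n U (\<lambda>y. l (f y))"
  using assms(3)
proof (induction n arbitrary: f)
  case (Suc n)
  have d: "((\<lambda>y. l (f y)) has_derivative (\<lambda>v. l (frechet_derivative f (at y) v))) (at y)" if "y \<in> U" for y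
    using Suc.prems that
    by (intro bounded_linear.has_derivative[OF assms(1)] differentiable_has_derivative) auto
  have "times_differentiable n U (partial_deriv i (\<lambda>y. l (f y)))" for i
  proof (subst times_differentiable_cong[OF assms(2)])
    show "partial_deriv i (\<lambda>y. l (f y)) y = l (partial_deriv i f y)" if "y \<in> U" for y
      using partial_deriv_eqI[OF d[OF that]] by (simp add: partial_deriv_def)
  qed (use Suc in auto)
  then show ?case using d by (auto simp: differentiable_def)
qed simp

lemma times_differentiable_add:
  assumes "open U" "times_differentiable n U f" "times_differentiable n U g"
  shows "times_differentiable n U (\<lambda>y. f y + g y)"
  using assms(2,3)
proof (induction n arbitrary: f g)
  case (Suc n)
  have d: "((\<lambda>y. f y + g y) has_derivative
      (\<lambda>v. frechet_derivative f (at y) v + frechet_derivative g (at y) v)) (at y)" if "y \<in> U" for y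
    using Suc.prems that by (intro has_derivative_add differentiable_has_derivative) auto
  have "times_differentiable n U (partial_deriv i (\<lambda>y. f y + g y))" for i
  proof (subst times_differentiable_cong[OF assms(1)])
    show "partial_deriv i (\<lambda>y. f y + g y) y = partial_deriv i f y + partial_deriv i g y" if "y \<in> U" for y
      using partial_deriv_eqI[OF d[OF that]] by (simp add: partial_deriv_def)
  qed (use Suc in auto)
  then show ?case using d by (auto simp: differentiable_def)
qed simp

lemma partial_deriv_bilinear:
  assumes "bounded_bilinear prd" "f differentiable (at y)" "g differentiable (at y)"
  shows "(\<lambda>y. prd (f y) (g y)) differentiable (at y)"
    and "partial_deriv i (\<lambda>y. prd (f y) (g y)) y =
           prd (f y) (partial_deriv i g y) + prd (partial_deriv i f y) (g y)"
proof -
  have d: "((\<lambda>y. prd (f y) (g y)) has_derivative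
      (\<lambda>v. prd (f y) (frechet_derivative g (at y) v) + prd (frechet_derivative f (at y) v) (g y))) (at y)"
    by (intro bounded_bilinear.FDERIV[OF assms(1)] differentiable_has_derivative assms)
  show "(\<lambda>y. prd (f y) (g y)) differentiable (at y)"
    using d by (auto simp: differentiable_def)
  show "partial_deriv i (\<lambda>y. prd (f y) (g y)) y =
           prd (f y) (partial_deriv i g y) + prd (partial_deriv i f y) (g y)"
    using partial_deriv_eqI[OF d] by (simp add: partial_deriv_def)
qed

lemma times_differentiable_bilinear:
  assumes "bounded_bilinear prd" "open U" "times_differentiable n U f" "times_differentiable n U g"
  shows "times_differentiable n U (\<lambda>y. prd (f y) (g y))"
  using assms(3,4)
proof (induction n arbitrary: f g)
  case (Suc n)
  note d = partial_deriv_bilinear[OF assms(1)]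
  have "times_differentiable n U (partial_deriv i (\<lambda>y. prd (f y) (g y)))" for i
  proof (subst times_differentiable_cong[OF assms(2)])
    show "partial_deriv i (\<lambda>y. prd (f y) (g y)) y =
        prd (f y) (partial_deriv i g y) + prd (partial_deriv i f y) (g y)" if "y \<in> U" for y
      using Suc.prems that by (intro d) auto
    show "times_differentiable n U
        (\<lambda>y. prd (f y) (partial_deriv i g y) + prd (partial_deriv i f y) (g y))"
      using Suc.prems times_differentiable_mono[OF Suc.prems(1), of n]
        times_differentiable_mono[OF Suc.prems(2), of n]
      by (intro times_differentiable_add[OF assms(2)] Suc.IH) auto
  qed
  moreover have "\<forall>y\<in>U. (\<lambda>y. prd (f y) (g y)) differentiable (at y)"
    using Suc.prems by (intro ballI d(1)) auto
  ultimately show ?case by simp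
qed simp

text \<open>The outer function of one real variable is given by the sequence \<open>D\<close> of its successive
  derivatives; the induction on the order passes from \<open>D k\<close> to \<open>D (Suc k)\<close>.\<close>

lemma times_differentiable_compose_real:
  assumes "open U" and D: "\<And>k t. t \<in> T \<Longrightarrow> (D k has_real_derivative D (Suc k) t) (at t)"
    and "times_differentiable n U f" "f ` U \<subseteq> T"
  shows "times_differentiable n U (\<lambda>y. D k (f y))"
  using assms(3)
proof (induction n arbitrary: k)
  case (Suc n)
  have d: "((\<lambda>y. D k (f y)) has_derivative
      (\<lambda>v. D (Suc k) (f y) * frechet_derivative f (at y) v)) (at y)" if "y \<in> U" for y
  proof -
    have "(f has_derivative frechet_derivative f (at y)) (at y)"
      using Suc.prems that by (intro differentiable_has_derivative) auto
    moreover have "(D k has_derivative (\<lambda>u. D (Suc k) (f y) * u)) (at (f y))"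
      using D[of "f y" k] that assms(4) by (auto simp: has_field_derivative_def)
    ultimately show ?thesis by (rule has_derivative_compose)
  qed
  have "times_differentiable n U (partial_deriv i (\<lambda>y. D k (f y)))" for i
  proof (subst times_differentiable_cong[OF assms(1)])
    show "partial_deriv i (\<lambda>y. D k (f y)) y = D (Suc k) (f y) * partial_deriv i f y" if "y \<in> U" for y
      using partial_deriv_eqI[OF d[OF that]] by (simp add: partial_deriv_def)
    show "times_differentiable n U (\<lambda>y. D (Suc k) (f y) * partial_deriv i f y)"
      using Suc.prems times_differentiable_mono[OF Suc.prems, of n]
      by (intro times_differentiable_bilinear[OF bounded_bilinear_mult assms(1)] Suc.IH) auto
  qed
  then show ?case using d by (auto simp: differentiable_def)
qed simp

lemma times_differentiable_sum:
  assumes "open U" "\<And>i. i \<in> I \<Longrightarrow> times_differentiable n U (f i)"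
  shows "times_differentiable n U (\<lambda>y. \<Sum>i\<in>I. f i y)"
  using assms(2)
  by (induction I rule: infinite_finite_induct)
     (auto intro!: times_differentiable_const times_differentiable_add assms(1))

lemma vec_eq_sum_axis: "x = (\<Sum>j\<in>UNIV. (x $ j) *\<^sub>R axis j (1::real))"
  using basis_expansion[of x] by (simp add: scalar_mult_eq_scaleR)

lemma differentiable_vecI:
  fixes T :: "'a::real_normed_vector \<Rightarrow> real^'n"
  assumes "\<And>j. (\<lambda>y. T y $ j) differentiable (at y)"
  shows "T differentiable (at y)"
proof -
  have "(\<lambda>y. \<Sum>j\<in>UNIV. (T y $ j) *\<^sub>R axis j (1::real)) differentiable (at y)"
    using assms by (intro differentiable_sum differentiable_scaleR differentiable_const) auto
  then show ?thesis by (simp flip: vec_eq_sum_axis)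
qed

text \<open>By the chain rule \<open>\<partial>\<^sub>i (f \<circ> T) = \<Sum>\<^sub>j (\<partial>\<^sub>j f \<circ> T) \<partial>\<^sub>i T\<^sub>j\<close>, in which every factor is
  one order less differentiable.\<close>

lemma times_differentiable_compose:
  fixes f :: "real^'n \<Rightarrow> 'b::real_normed_vector" and T :: "real^'m \<Rightarrow> real^'n"
  assumes "open U" "times_differentiable n W f" "\<And>j. times_differentiable n U (\<lambda>y. T y $ j)" "T ` U \<subseteq> W"
  shows "times_differentiable n U (\<lambda>y. f (T y))"
  using assms(2,3)
proof (induction n arbitrary: f)
  case (Suc n)
  have T: "T differentiable (at y)" if "y \<in> U" for y
    using Suc.prems(2) that by (intro differentiable_vecI) auto
  have d: "((\<lambda>y. f (T y)) has_derivative
      (\<lambda>v. frechet_derivative f (at (T y)) (frechet_derivative T (at y) v))) (at y)" if "y \<in> U" for y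
    using Suc.prems that assms(4)
    by (intro has_derivative_compose[OF differentiable_has_derivative differentiable_has_derivative] T)
       auto
  have Tj: "(frechet_derivative T (at y) (axis i 1)) $ j = partial_deriv i (\<lambda>y. T y $ j) y"
    if "y \<in> U" for y i j
    by (rule partial_deriv_eqI[symmetric])
       (intro bounded_linear.has_derivative[OF bounded_linear_vec_nth] differentiable_has_derivative T that)
  have "times_differentiable n U (partial_deriv i (\<lambda>y. f (T y)))" for i
  proof (subst times_differentiable_cong[OF assms(1)])
    fix y assume y: "y \<in> U"
    define v where "v = frechet_derivative T (at y) (axis i 1)"
    interpret F: bounded_linear "frechet_derivative f (at (T y))"
      using Suc.prems(1) y assms(4) by (intro has_derivative_bounded_linear[OF differentiable_has_derivative]) auto
    have "partial_deriv i (\<lambda>y. f (T y)) y = frechet_derivative f (at (T y)) v"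
      using partial_deriv_eqI[OF d[OF y]] by (simp add: v_def)
    also have "\<dots> = frechet_derivative f (at (T y)) (\<Sum>j\<in>UNIV. (v $ j) *\<^sub>R axis j 1)"
      by (simp flip: vec_eq_sum_axis)
    also have "\<dots> = (\<Sum>j\<in>UNIV. partial_deriv i (\<lambda>y. T y $ j) y *\<^sub>R partial_deriv j f (T y))"
      using y by (simp add: F.sum F.scaleR v_def Tj partial_deriv_def)
    finally show "partial_deriv i (\<lambda>y. f (T y)) y =
      (\<Sum>j\<in>UNIV. partial_deriv i (\<lambda>y. T y $ j) y *\<^sub>R partial_deriv j f (T y))" .
  next
    show "times_differentiable n U
        (\<lambda>y. \<Sum>j\<in>UNIV. partial_deriv i (\<lambda>y. T y $ j) y *\<^sub>R partial_deriv j f (T y))"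
      using Suc.prems times_differentiable_mono[OF Suc.prems(2), of n]
      by (intro times_differentiable_sum times_differentiable_bilinear[OF bounded_bilinear_scaleR]
          Suc.IH assms(1)) auto
  qed
  then show ?case using d by (auto simp: differentiable_def)
qed simp

lemma smooth_on_Un: "smooth_on U f \<Longrightarrow> smooth_on W f \<Longrightarrow> smooth_on (U \<union> W) f"
  unfolding smooth_on_def by blast

lemma smooth_on_cong:
  assumes "open U" "\<And>y. y \<in> U \<Longrightarrow> f y = g y"
  shows "smooth_on U f \<longleftrightarrow> smooth_on U g"
  using times_differentiable_cong[OF assms] by (simp add: smooth_on_iff_times_differentiable)

lemma smooth_on_const: "smooth_on U (\<lambda>_. c)"
  by (simp add: smooth_on_iff_times_differentiable times_differentiable_const)

lemma smooth_on_bounded_linear: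
  assumes "bounded_linear l" "open U" "smooth_on U f"
  shows "smooth_on U (\<lambda>y. l (f y))"
  using times_differentiable_bounded_linear[OF assms(1,2), of _ f] assms(3)
  unfolding smooth_on_iff_times_differentiable by simp

lemma smooth_on_add:
  "open U \<Longrightarrow> smooth_on U f \<Longrightarrow> smooth_on U g \<Longrightarrow> smooth_on U (\<lambda>y. f y + g y)"
  by (simp add: smooth_on_iff_times_differentiable times_differentiable_add)

lemma smooth_on_bilinear:
  assumes "bounded_bilinear prd" "open U" "smooth_on U f" "smooth_on U g"
  shows "smooth_on U (\<lambda>y. prd (f y) (g y))"
  using times_differentiable_bilinear[OF assms(1,2), of _ f g] assms(3,4)
  unfolding smooth_on_iff_times_differentiable by simp

lemmas smooth_on_mult = smooth_on_bilinear[OF bounded_bilinear_mult]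
lemmas smooth_on_scaleR = smooth_on_bilinear[OF bounded_bilinear_scaleR]

lemma smooth_on_minus: "open U \<Longrightarrow> smooth_on U f \<Longrightarrow> smooth_on U (\<lambda>y. - f y)"
  by (rule smooth_on_bounded_linear[OF bounded_linear_minus[OF bounded_linear_ident]])

lemma smooth_on_diff:
  "open U \<Longrightarrow> smooth_on U f \<Longrightarrow> smooth_on U g \<Longrightarrow> smooth_on U (\<lambda>y. f y - g y)"
  using smooth_on_add[of U f "\<lambda>y. - g y"] smooth_on_minus[of U g] by simp

lemma smooth_on_sum:
  "open U \<Longrightarrow> (\<And>i. i \<in> I \<Longrightarrow> smooth_on U (f i)) \<Longrightarrow> smooth_on U (\<lambda>y. \<Sum>i\<in>I. f i y)"
  by (simp add: smooth_on_iff_times_differentiable times_differentiable_sum)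

lemma smooth_on_prod:
  fixes f :: "'i \<Rightarrow> real^'n::finite \<Rightarrow> real"
  shows "open U \<Longrightarrow> (\<And>i. i \<in> I \<Longrightarrow> smooth_on U (f i)) \<Longrightarrow> smooth_on U (\<lambda>y. \<Prod>i\<in>I. f i y)"
  by (induction I rule: infinite_finite_induct) (auto intro!: smooth_on_const smooth_on_mult)

lemma smooth_on_compose_real:
  assumes "open U" and D: "\<And>k t. t \<in> T \<Longrightarrow> (D k has_real_derivative D (Suc k) t) (at t)"
    and "smooth_on U f" "f ` U \<subseteq> T"
  shows "smooth_on U (\<lambda>y. D k (f y))"
  unfolding smooth_on_iff_times_differentiable
proof
  fix n
  show "times_differentiable n U (\<lambda>y. D k (f y))"
    using assms
    by (intro times_differentiable_compose_real[where D = D and T = T])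
       (auto simp: smooth_on_iff_times_differentiable)
qed

lemma smooth_on_vec_iff:
  fixes F :: "real^'n::finite \<Rightarrow> 'b::real_normed_vector^'k"
  assumes "open U"
  shows "smooth_on U F \<longleftrightarrow> (\<forall>j. smooth_on U (\<lambda>y. F y $ j))"
proof safe
  fix j assume "smooth_on U F"
  then show "smooth_on U (\<lambda>y. F y $ j)"
    by (rule smooth_on_bounded_linear[OF bounded_linear_vec_nth assms])
next
  assume *: "\<forall>j. smooth_on U (\<lambda>y. F y $ j)"
  have l: "bounded_linear (axis j :: 'b \<Rightarrow> 'b^'k)" for j
  proof (rule bounded_linear_intro[where K = 1])
    fix x :: 'b
    have "norm (axis j x :: 'b^'k) \<le> (\<Sum>i\<in>UNIV. norm ((axis j x :: 'b^'k) $ i))"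
      unfolding norm_vec_def by (rule L2_set_le_sum) simp
    also have "\<dots> = (\<Sum>i\<in>UNIV. if i = j then norm x else 0)"
      by (rule sum.cong) (auto simp: axis_def)
    finally show "norm (axis j x :: 'b^'k) \<le> norm x * 1" by simp
  qed (simp_all add: axis_def vec_eq_iff)
  have "smooth_on U (\<lambda>y. \<Sum>j\<in>UNIV. axis j (F y $ j))"
    using * by (intro smooth_on_sum smooth_on_bounded_linear[OF l] assms) auto
  moreover have "(\<Sum>j\<in>UNIV. axis j (F y $ j)) = F y" for y
    by (simp add: vec_eq_iff axis_def)
  ultimately show "smooth_on U F" by simp
qed

lemma smooth_on_compose:
  fixes T :: "real^'m::finite \<Rightarrow> real^'n::finite"
  assumes "open U" "smooth_on W f" "smooth_on U T" "T ` U \<subseteq> W"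
  shows "smooth_on U (\<lambda>y. f (T y))"
  unfolding smooth_on_iff_times_differentiable
proof
  fix n
  have "times_differentiable n U (\<lambda>y. T y $ j)" for j
    using assms(1,3) smooth_on_vec_iff[of U T] by (simp add: smooth_on_iff_times_differentiable)
  then show "times_differentiable n U (\<lambda>y. f (T y))"
    using times_differentiable_compose[OF assms(1) _ _ assms(4), of n f] assms(2)
    unfolding smooth_on_iff_times_differentiable by blast
qed

lemma smooth_on_differentiable: "smooth_on U f \<Longrightarrow> y \<in> U \<Longrightarrow> f differentiable (at y)"
  unfolding smooth_on_def by (metis iter_partial.simps(1))

lemma smooth_on_continuous:
  assumes "smooth_on U f"
  shows "continuous_on U f"
  using differentiable_imp_continuous_within[OF smooth_on_differentiable[OF assms]]
  by (intro continuous_at_imp_continuous_on ballI)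

lemma smooth_on_partial_deriv: "smooth_on U f \<Longrightarrow> smooth_on U (partial_deriv i f)"
  unfolding smooth_on_def iter_partial_snoc[symmetric] by blast

lemma smooth_on_iter_partial: "smooth_on U f \<Longrightarrow> smooth_on U (iter_partial is f)"
  by (induction "is") (simp_all add: smooth_on_partial_deriv iter_partial_Cons del: iter_partial.simps(2))

lemma smooth_on_ident: "smooth_on U (\<lambda>y. y :: real^'n::finite)"
proof -
  have p: "partial_deriv i (\<lambda>y :: real^'n. y) = (\<lambda>_. axis i 1)" for i
    by (auto simp: fun_eq_iff intro!: partial_deriv_eqI has_derivative_ident)
  have "times_differentiable n U (\<lambda>y :: real^'n. y)" for n
    by (cases n) (auto simp: p times_differentiable_const)
  then show ?thesis by (simp add: smooth_on_iff_times_differentiable)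
qed

lemma smooth_on_inverse:
  fixes f :: "real^'n::finite \<Rightarrow> real"
  assumes "open U" "smooth_on U f" "\<And>y. y \<in> U \<Longrightarrow> f y \<noteq> 0"
  shows "smooth_on U (\<lambda>y. inverse (f y))"
proof -
  \<comment> \<open>the successive derivatives of the reciprocal\<close>
  define D :: "nat \<Rightarrow> real \<Rightarrow> real" where "D k t = (- 1) ^ k * fact k * inverse t ^ Suc k" for k t
  have "(D k has_real_derivative D (Suc k) t) (at t)" if "t \<in> - {0}" for k t
  proof -
    have "((\<lambda>t. inverse t ^ Suc k) has_real_derivative - real (Suc k) * inverse t ^ Suc (Suc k)) (at t)"
      using that DERIV_power[OF DERIV_inverse, of t "Suc k" UNIV] by (simp add: algebra_simps)
    from DERIV_cmult[OF this, of "(- 1) ^ k * fact k"] show ?thesis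
      unfolding D_def[abs_def] by (rule DERIV_cong) (simp add: algebra_simps)
  qed
  then have "smooth_on U (\<lambda>y. D 0 (f y))"
    using assms(3) by (intro smooth_on_compose_real[OF assms(1) _ assms(2), where D = D and T = "- {0}"]) auto
  then show ?thesis by (simp add: D_def)
qed

lemma smooth_on_sqrt:
  fixes f :: "real^'n::finite \<Rightarrow> real"
  assumes "open U" "smooth_on U f" "\<And>y. y \<in> U \<Longrightarrow> f y > 0"
  shows "smooth_on U (\<lambda>y. sqrt (f y))"
proof -
  \<comment> \<open>the successive derivatives of the square root\<close>
  define D :: "nat \<Rightarrow> real \<Rightarrow> real"
    where "D k t = (\<Prod>j<k. 1 / 2 - real j) * t powr (1 / 2 - real k)" for k t
  have "(D k has_real_derivative D (Suc k) t) (at t)" if "t \<in> {0<..}" for k t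
  proof -
    have "((\<lambda>t. t powr (1 / 2 - real k)) has_real_derivative
        (1 / 2 - real k) * t powr (1 / 2 - real k - 1)) (at t)"
      using that by (intro has_real_derivative_powr) auto
    from DERIV_cmult[OF this, of "\<Prod>j<k. 1 / 2 - real j"] show ?thesis
      unfolding D_def[abs_def] by (rule DERIV_cong) (simp add: diff_diff_eq add.commute)
  qed
  then have "smooth_on U (\<lambda>y. D 0 (f y))"
    using assms(3) by (intro smooth_on_compose_real[OF assms(1) _ assms(2), where D = D and T = "{0<..}"]) auto
  then have "smooth_on U (\<lambda>y. f y powr (1 / 2))" by (simp add: D_def)
  then show ?thesis
    using smooth_on_cong[OF assms(1), of "\<lambda>y. f y powr (1 / 2)" "\<lambda>y. sqrt (f y)"] assms(3)
    by (simp add: powr_half_sqrt less_imp_le)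
qed

lemma smooth_on_exp:
  fixes f :: "real^'n::finite \<Rightarrow> real"
  assumes "open U" "smooth_on U f"
  shows "smooth_on U (\<lambda>y. exp (f y))"
proof -
  have "smooth_on U (\<lambda>y. (\<lambda>_. exp) (0::nat) (f y))"
    by (rule smooth_on_compose_real[OF assms(1) _ assms(2), where D = "\<lambda>_. exp" and T = UNIV])
       (auto intro: DERIV_exp)
  then show ?thesis by simp
qed

section \<open>Determinants and inverse matrices depending smoothly on a point\<close>

lemma smooth_on_det:
  fixes F :: "real^'n::finite \<Rightarrow> real^'k^'k"
  assumes "open U" "\<And>i j. smooth_on U (\<lambda>y. F y $ i $ j)"
  shows "smooth_on U (\<lambda>y. det (F y))"
  unfolding det_def
  by (intro smooth_on_sum smooth_on_mult smooth_on_prod smooth_on_const assms)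

lemma matrix_inv_mult:
  fixes A :: "real^'n^'n"
  assumes "det A \<noteq> 0"
  shows "A ** matrix_inv A = mat 1" "matrix_inv A ** A = mat 1"
proof -
  have "\<exists>A'. A ** A' = mat 1 \<and> A' ** A = mat 1"
    using assms by (simp add: invertible_det_nz[symmetric] invertible_def)
  from someI_ex[OF this] show "A ** matrix_inv A = mat 1" "matrix_inv A ** A = mat 1"
    by (simp_all add: matrix_inv_def)
qed

text \<open>By Cramer's rule the entries of the inverse are rational functions of those of the matrix; smooth
  dependence and convergence pass to the inverse through this formula.\<close>

lemma matrix_inv_entry:
  fixes A :: "real^'n^'n"
  assumes "det A \<noteq> 0"
  shows "matrix_inv A $ k $ j =
    det (\<chi> i l. if l = k then (if i = j then 1 else 0) else A $ i $ l) / det A"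
proof -
  have "A ** matrix_inv A = mat 1"
    by (rule matrix_inv_mult[OF assms])
  then have "A *v (matrix_inv A *v axis j 1) = axis j 1"
    by (simp add: matrix_vector_mul_assoc)
  then have "matrix_inv A *v axis j 1 =
      (\<chi> k. det (\<chi> i l. if l = k then axis j 1 $ i else A $ i $ l) / det A)"
    using cramer[OF assms] by blast
  moreover have "(matrix_inv A *v axis j 1) $ k = matrix_inv A $ k $ j"
    by (simp add: matrix_vector_mult_basis column_def)
  ultimately show ?thesis by (simp add: axis_def cong: if_cong)
qed

lemma smooth_on_matrix_inv:
  fixes F :: "real^'n::finite \<Rightarrow> real^'k^'k"
  assumes "open U" "\<And>i j. smooth_on U (\<lambda>y. F y $ i $ j)" "\<And>y. y \<in> U \<Longrightarrow> det (F y) \<noteq> 0"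
  shows "smooth_on U (\<lambda>y. matrix_inv (F y) $ k $ j)"
proof (subst smooth_on_cong[OF assms(1)])
  show "matrix_inv (F y) $ k $ j =
    det (\<chi> i l. if l = k then (if i = j then 1 else 0) else F y $ i $ l) * inverse (det (F y))"
    if "y \<in> U" for y
    using matrix_inv_entry[OF assms(3)[OF that]] by (simp add: divide_inverse)
  have "smooth_on U (\<lambda>y. (\<chi> i l. if l = k then (if i = j then 1 else 0) else F y $ i $ l) $ a $ b)"
    for a b :: 'k
    using assms(2) by (cases "b = k"; cases "a = j") (auto intro: smooth_on_const)
  then show "smooth_on U (\<lambda>y. det (\<chi> i l. if l = k then (if i = j then 1 else 0) else F y $ i $ l)
      * inverse (det (F y)))"
    using assms by (intro smooth_on_mult smooth_on_inverse smooth_on_det) auto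
qed

definition positive_definite :: "real^'n^'n \<Rightarrow> bool" where
  "positive_definite G \<longleftrightarrow> (\<forall>v. v \<noteq> 0 \<longrightarrow> v \<bullet> (G *v v) > 0)"

lemma positive_definite_det_nz:
  assumes "positive_definite G"
  shows "det G \<noteq> 0"
proof
  assume "det G = 0"
  then obtain v where "v \<noteq> 0" "G *v v = 0"
    by (metis invertible_det_nz invertible_left_inverse matrix_left_invertible_ker)
  then show False using assms by (auto simp: positive_definite_def)
qed

text \<open>The determinant does not vanish on the segment of positive definite matrices from
  the identity to \<open>G\<close>.\<close>

lemma positive_definite_det_pos:
  fixes G :: "real^'n^'n"
  assumes "positive_definite G"
  shows "det G > 0"
proof (rule ccontr)
  assume neg: "\<not> det G > 0"
  define P :: "real \<Rightarrow> real^'n^'n" where "P t = (1 - t) *\<^sub>R mat 1 + t *\<^sub>R G" for t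
  have pd: "positive_definite (P t)" if "0 \<le> t" "t \<le> 1" for t
    unfolding positive_definite_def
  proof safe
    fix v :: "real^'n" assume v: "v \<noteq> 0"
    have e: "v \<bullet> (P t *v v) = (1 - t) * (v \<bullet> v) + t * (v \<bullet> (G *v v))"
      by (simp add: P_def matrix_vector_mult_add_rdistrib scaleR_matrix_vector_assoc[symmetric] inner_add_right)
    have "v \<bullet> v > 0" "v \<bullet> (G *v v) > 0" using v assms by (auto simp: positive_definite_def)
    then show "v \<bullet> (P t *v v) > 0"
      unfolding e using that by (cases "t = 1") (auto intro!: add_pos_nonneg)
  qed
  have "continuous_on {0..1} (\<lambda>t. det (P t))"
    unfolding det_def P_def by (intro continuous_intros)
  moreover have "det (P 0) = 1" "det (P 1) = det G" by (simp_all add: P_def)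
  ultimately obtain t where "0 \<le> t" "t \<le> 1" "det (P t) = 0"
    using IVT2'[of "\<lambda>t. det (P t)" 1 0 0] neg by (auto simp: not_less)
  then show False using positive_definite_det_nz[OF pd] by blast
qed

section \<open>Change of variables for arbitrary finite index types\<close>

text \<open>The formula \<open>has_measure_differentiable_image\<close> for the measure of a differentiable image concerns
  \<open>real^'n\<close> with a well-ordered index type. Neither Lebesgue measure nor determinants see the order, so
  the formula is transported along a relabelling of the coordinates by a copy of \<open>'n\<close> that carries an
  arbitrary well-order.\<close>

typedef 'a ordered_copy = "UNIV :: 'a set" morphisms of_copy to_copy
  by simp

lemma bij_of_copy: "bij of_copy"
  by (metis UNIV_I bij_betw_byWitness of_copy_inverse subset_UNIV to_copy_inverse)

instance ordered_copy :: (finite) finite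
  by standard (simp add: bij_betw_finite[OF bij_of_copy])

definition copy_rank :: "'a::finite ordered_copy \<Rightarrow> nat" where
  "copy_rank = (SOME f. inj f)"

lemma inj_copy_rank: "inj (copy_rank :: 'a::finite ordered_copy \<Rightarrow> nat)"
proof -
  have "\<exists>f :: 'a ordered_copy \<Rightarrow> nat. inj f"
    using finite_imp_inj_to_nat_seg[of "UNIV :: 'a ordered_copy set"] by auto
  then show ?thesis unfolding copy_rank_def by (rule someI_ex)
qed

instantiation ordered_copy :: (finite) wellorder
begin

definition less_eq_ordered_copy :: "'a ordered_copy \<Rightarrow> 'a ordered_copy \<Rightarrow> bool" where
  "less_eq_ordered_copy x y \<longleftrightarrow> copy_rank x \<le> copy_rank y"

definition less_ordered_copy :: "'a ordered_copy \<Rightarrow> 'a ordered_copy \<Rightarrow> bool" where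
  "less_ordered_copy x y \<longleftrightarrow> copy_rank x < copy_rank y"

instance
proof
  fix P :: "'a ordered_copy \<Rightarrow> bool" and a :: "'a ordered_copy"
  assume step: "\<And>x. (\<And>y. y < x \<Longrightarrow> P y) \<Longrightarrow> P x"
  show "P a"
  proof (induction "copy_rank a" arbitrary: a rule: less_induct)
    case less
    then show ?case by (rule step) (simp add: less_ordered_copy_def)
  qed
next
  fix x y :: "'a ordered_copy"
  assume "x \<le> y" "y \<le> x"
  then have "copy_rank x = copy_rank y"
    unfolding less_eq_ordered_copy_def by (rule le_antisym)
  then show "x = y" by (rule injD[OF inj_copy_rank])
qed (unfold less_eq_ordered_copy_def less_ordered_copy_def, linarith+)

end

definition relabel :: "('k \<Rightarrow> 'n) \<Rightarrow> real^'n \<Rightarrow> real^'k" where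
  "relabel p x = (\<chi> i. x $ p i)"

lemma relabel_nth [simp]: "relabel p x $ i = x $ p i"
  by (simp add: relabel_def)

lemma relabel_inverse: "bij p \<Longrightarrow> relabel (inv p) (relabel p x) = x"
  by (simp add: vec_eq_iff bij_is_surj surj_f_inv_f)

lemma relabel_inverse': "bij p \<Longrightarrow> relabel p (relabel (inv p) x) = x"
  by (simp add: vec_eq_iff bij_is_inj)

lemma bounded_linear_relabel: "bounded_linear (relabel p :: real^'n::finite \<Rightarrow> real^'k::finite)"
  by (intro linear_conv_bounded_linear[THEN iffD1] linearI) (auto simp: vec_eq_iff)

lemma continuous_on_relabel: "continuous_on S (relabel p :: real^'n::finite \<Rightarrow> real^'k::finite)"
  by (intro linear_continuous_on bounded_linear_relabel)

lemma prod_Basis_vec: "(\<Prod>b\<in>(Basis :: (real^'n) set). f b) = (\<Prod>i\<in>UNIV. f (axis i 1))"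
proof -
  have B: "(Basis :: (real^'n) set) = range (\<lambda>i. axis i 1)" by (auto simp: Basis_vec_def)
  have "inj (\<lambda>i :: 'n. axis i (1::real))" by (auto simp: inj_def axis_eq_axis)
  then show ?thesis unfolding B by (subst prod.reindex) (auto simp: o_def)
qed

lemma lborel_relabel:
  fixes p :: "'k::finite \<Rightarrow> 'n::finite"
  assumes "bij p"
  shows "distr lborel borel (relabel p) = (lborel :: (real^'k) measure)"
proof (rule lborel_eqI[symmetric])
  have [measurable]: "relabel p \<in> borel_measurable (borel :: (real^'n) measure)"
    by (intro borel_measurable_continuous_onI continuous_on_relabel)
  fix l u :: "real^'k" assume "\<And>b. b \<in> Basis \<Longrightarrow> l \<bullet> b \<le> u \<bullet> b"
  from this[of "axis i 1" for i] have le: "l $ i \<le> u $ i" for i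
    by (simp add: axis_in_Basis_iff inner_axis)
  have "relabel p -` box l u = box (relabel (inv p) l) (relabel (inv p) u)"
  proof (rule set_eqI)
    fix x :: "real^'n"
    have "x \<in> relabel p -` box l u \<longleftrightarrow>
        (\<forall>i. l $ inv p (p i) < x $ p i \<and> x $ p i < u $ inv p (p i))"
      using assms by (simp add: mem_box_cart bij_is_inj)
    also have "\<dots> \<longleftrightarrow> (\<forall>j. l $ inv p j < x $ j \<and> x $ j < u $ inv p j)"
      using bij_is_surj[OF assms] by (metis surjD)
    finally show "x \<in> relabel p -` box l u \<longleftrightarrow> x \<in> box (relabel (inv p) l) (relabel (inv p) u)"
      by (simp add: mem_box_cart)
  qed
  then have "emeasure (distr lborel borel (relabel p)) (box l u) =
      emeasure lborel (box (relabel (inv p) l) (relabel (inv p) u))"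
    by (simp add: emeasure_distr)
  also have "\<dots> = (\<Prod>b\<in>Basis. (relabel (inv p) u - relabel (inv p) l) \<bullet> b)"
    using le by (intro emeasure_lborel_box) (auto simp: Basis_vec_def inner_axis)
  also have "\<dots> = ennreal (\<Prod>i\<in>UNIV. u $ inv p i - l $ inv p i)"
    by (simp add: prod_Basis_vec inner_axis)
  also have "(\<Prod>i\<in>UNIV. u $ inv p i - l $ inv p i) = (\<Prod>i\<in>UNIV. u $ i - l $ i)"
    using assms by (intro prod.reindex_bij_betw bij_imp_bij_inv)
  also have "\<dots> = (\<Prod>b\<in>Basis. (u - l) \<bullet> b)"
    by (simp add: prod_Basis_vec inner_axis)
  finally show "emeasure (distr lborel borel (relabel p)) (box l u) = (\<Prod>b\<in>Basis. (u - l) \<bullet> b)" .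
qed simp

lemma emeasure_relabel_image:
  fixes p :: "'k::finite \<Rightarrow> 'n::finite"
  assumes "bij p" "X \<in> sets borel"
  shows "relabel p ` X \<in> sets borel" "emeasure lborel (relabel p ` X) = emeasure lborel X"
proof -
  have m [measurable]: "relabel (inv p) \<in> borel_measurable borel"
    by (intro borel_measurable_continuous_onI continuous_on_relabel)
  have e: "relabel p ` X = relabel (inv p) -` X"
  proof (rule set_eqI)
    fix y
    show "y \<in> relabel p ` X \<longleftrightarrow> y \<in> relabel (inv p) -` X"
      using relabel_inverse[OF assms(1)] relabel_inverse'[OF assms(1), of y]
      by (auto intro!: image_eqI[of y _ "relabel (inv p) y"])
  qed
  show "relabel p ` X \<in> sets borel"
    unfolding e using measurable_sets[OF m assms(2)] by simp
  then have "emeasure lborel (relabel p ` X) = emeasure (distr lborel borel (relabel (inv p))) X"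
    using assms(2) by (simp add: e emeasure_distr)
  then show "emeasure lborel (relabel p ` X) = emeasure lborel X"
    by (simp add: lborel_relabel bij_imp_bij_inv assms(1))
qed

text \<open>Conjugation of a permutation by a bijection preserves its sign, so the two Leibniz expansions
  agree term by term.\<close>

lemma det_relabel:
  fixes A :: "real^'n^'n" and p :: "'k::finite \<Rightarrow> 'n"
  assumes "bij p"
  shows "det (\<chi> i j. A $ p i $ p j) = det A"
proof -
  define m where "m = map_permutation UNIV p"
  have m: "m q permutes UNIV" "sign (m q) = sign q" "\<And>i. m q (p i) = p (q i)"
    if "q permutes UNIV" for q
    using that assms unfolding m_def
    by (auto intro!: map_permutation_permutes sign_map_permutation map_permutation_apply simp: bij_is_inj)
  have "det (\<chi> i j. A $ p i $ p j) =
      (\<Sum>q | q permutes UNIV. of_int (sign q) * (\<Prod>i\<in>UNIV. A $ p i $ p (q i)))"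
    by (simp add: det_def)
  also have "\<dots> = (\<Sum>q | q permutes UNIV. of_int (sign (m q)) * (\<Prod>i\<in>UNIV. A $ p i $ m q (p i)))"
    by (rule sum.cong) (auto simp: m)
  also have "\<dots> = (\<Sum>q | q permutes UNIV. of_int (sign (m q)) * (\<Prod>i\<in>UNIV. A $ i $ m q i))"
    by (rule sum.cong[OF refl], rule arg_cong2[where f = "(*)", OF refl])
       (rule prod.reindex_bij_betw[OF assms])
  also have "\<dots> = det A"
    unfolding det_def
  proof (rule sum.reindex_bij_witness[where i = "map_permutation UNIV (inv p)" and j = m])
    fix q :: "'k \<Rightarrow> 'k" assume "q \<in> {q. q permutes UNIV}"
    then show "m q \<in> {q. q permutes UNIV}" using m by simp
    have "inv p \<circ> p = id" using assms by (simp add: bij_is_inj)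
    then show "map_permutation UNIV (inv p) (m q) = q"
      using \<open>q \<in> {q. q permutes UNIV}\<close> unfolding m_def
      by (subst map_permutation_compose[OF assms])
         (auto simp: bij_is_inj[OF bij_imp_bij_inv[OF assms]])
  next
    fix q :: "'n \<Rightarrow> 'n" assume q: "q \<in> {q. q permutes UNIV}"
    then show "map_permutation UNIV (inv p) q \<in> {q. q permutes UNIV}"
      using assms by (auto intro!: map_permutation_permutes bij_imp_bij_inv)
    have "p \<circ> inv p = id" using assms by (simp add: bij_is_surj surj_iff[symmetric])
    then show "m (map_permutation UNIV (inv p) q) = q"
      using q unfolding m_def
      by (subst map_permutation_compose[OF bij_imp_bij_inv[OF assms]])
         (auto simp: bij_is_inj[OF assms])
  qed auto
  finally show ?thesis .
qed

text \<open>On a compact set the Jacobian determinant is bounded, hence integrable, and the formula for the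
  measure of a differentiable image applies with a finite value.\<close>

lemma emeasure_differentiable_image_compact:
  fixes T :: "real^'n::{finite,wellorder} \<Rightarrow> real^'n::_"
  assumes K: "compact K" and E: "E \<in> sets borel" "E \<subseteq> K" "T ` E \<in> sets borel"
    and T: "\<And>x. x \<in> K \<Longrightarrow> (T has_derivative T' x) (at x)" "inj_on T K"
    and cont: "continuous_on K (\<lambda>x. det (matrix (T' x)))"
  shows "emeasure lborel (T ` E) = (\<integral>\<^sup>+x\<in>E. ennreal \<bar>det (matrix (T' x))\<bar> \<partial>lborel)"
proof -
  define f where "f x = \<bar>det (matrix (T' x))\<bar>" for x
  have "integrable lborel (\<lambda>x. indicator K x *\<^sub>R f x)"
    unfolding f_def by (intro borel_integrable_compact K continuous_intros cont)
  then have "integrable lborel (\<lambda>x. indicator E x *\<^sub>R (indicator K x *\<^sub>R f x))"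
    by (rule integrable_mult_indicator[rotated]) (use E(1) in auto)
  also have "(\<lambda>x. indicator E x *\<^sub>R (indicator K x *\<^sub>R f x)) = (\<lambda>x. indicator E x *\<^sub>R f x)"
    using E(2) by (auto simp: fun_eq_iff indicator_def)
  finally have int: "integrable lborel (\<lambda>x. indicator E x *\<^sub>R f x)" .
  define m where "m = (\<integral>x. indicator E x *\<^sub>R f x \<partial>lborel)"
  have "((\<lambda>x. indicator E x *\<^sub>R f x) has_integral m) UNIV"
    unfolding m_def by (rule has_integral_integral_lborel[OF int])
  then have "(f has_integral m) E"
    by (simp only: indicator_scaleR_eq_if has_integral_restrict_UNIV)
  moreover have "E \<in> sets lebesgue" using E(1) by simp
  moreover have "(T has_derivative T' x) (at x within E)" if "x \<in> E" for x
    using E(2) that by (blast intro: has_derivative_at_withinI[OF T(1)])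
  moreover have "inj_on T E" using T(2) E(2) by (rule inj_on_subset)
  ultimately have "T ` E \<in> lmeasurable \<and> measure lebesgue (T ` E) = m"
    using has_measure_differentiable_image[of E T T' m] unfolding f_def by blast
  then have "emeasure lebesgue (T ` E) = ennreal m"
    by (simp add: emeasure_eq_measure2)
  then have "emeasure lborel (T ` E) = ennreal m"
    using E(3) by simp
  also have "\<dots> = (\<integral>\<^sup>+x. ennreal (indicator E x *\<^sub>R f x) \<partial>lborel)"
    unfolding m_def by (intro nn_integral_eq_integral[symmetric] int) (auto simp: f_def)
  also have "\<dots> = (\<integral>\<^sup>+x\<in>E. ennreal (f x) \<partial>lborel)"
    by (intro nn_integral_cong) (auto simp: indicator_def)
  finally show ?thesis by (simp add: f_def)
qed

lemma emeasure_differentiable_image_compact_finite: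
  fixes T :: "real^'n::finite \<Rightarrow> real^'n"
  assumes K: "compact K" and E: "E \<in> sets borel" "E \<subseteq> K" "T ` E \<in> sets borel"
    and T: "\<And>x. x \<in> K \<Longrightarrow> (T has_derivative T' x) (at x)" "inj_on T K"
    and cont: "continuous_on K (\<lambda>x. det (matrix (T' x)))"
  shows "emeasure lborel (T ` E) = (\<integral>\<^sup>+x\<in>E. ennreal \<bar>det (matrix (T' x))\<bar> \<partial>lborel)"
proof -
  define p :: "'n ordered_copy \<Rightarrow> 'n" where "p = of_copy"
  have p: "bij p" by (simp add: p_def bij_of_copy)
  define R where "R = relabel p"
  define Q where "Q = relabel (inv p)"
  have RQ: "R (Q y) = y" "Q (R x) = x" for x y
    by (simp_all add: R_def Q_def relabel_inverse relabel_inverse' p)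
  have bl: "bounded_linear R" "bounded_linear Q"
    unfolding R_def Q_def by (rule bounded_linear_relabel)+
  have Rm: "R ` X \<in> sets borel" "emeasure lborel (R ` X) = emeasure lborel X"
    if "X \<in> sets borel" for X
    using emeasure_relabel_image[OF p that] by (auto simp: R_def)
  have [measurable]: "R \<in> borel_measurable borel"
    by (intro borel_measurable_continuous_onI linear_continuous_on bl)
  define S where "S = R \<circ> T \<circ> Q"
  define S' where "S' y = R \<circ> T' (Q y) \<circ> Q" for y
  have det: "det (matrix (S' y)) = det (matrix (T' (Q y)))" for y
  proof -
    have QA: "Q (axis j 1) = axis (p j) 1" for j
    proof -
      have "inv p i = j \<longleftrightarrow> i = p j" for i using bij_inv_eq_iff[OF p, of j i] by auto
      then show ?thesis by (simp add: Q_def vec_eq_iff axis_def)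
    qed
    have "matrix (S' y) = (\<chi> i j. matrix (T' (Q y)) $ p i $ p j)"
      by (simp add: matrix_def S'_def R_def QA)
    then show ?thesis by (simp add: det_relabel[OF p])
  qed
  have mem: "y \<in> R ` X \<longleftrightarrow> Q y \<in> X" for X y
    using RQ(1)[of y] by (auto simp: RQ(2) intro!: image_eqI[of y _ "Q y"])
  have im: "S ` (R ` E) = R ` (T ` E)"
    by (simp add: S_def image_comp RQ(2) o_def)
  have "emeasure lborel (T ` E) = emeasure lborel (S ` (R ` E))"
    using E(3) by (simp add: im Rm)
  also have "\<dots> = (\<integral>\<^sup>+y\<in>R ` E. ennreal \<bar>det (matrix (S' y))\<bar> \<partial>lborel)"
  proof (rule emeasure_differentiable_image_compact[where K = "R ` K"])
    show "compact (R ` K)" by (intro compact_continuous_image linear_continuous_on bl K)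
    show "R ` E \<in> sets borel" "S ` R ` E \<in> sets borel"
      unfolding im by (intro Rm E)+
    show "R ` E \<subseteq> R ` K" using E by auto
    show "inj_on S (R ` K)"
    proof (rule inj_onI, clarsimp simp: S_def RQ)
      fix x y assume "x \<in> K" "y \<in> K" "R (T x) = R (T y)"
      then show "R x = R y" using T(2) by (metis RQ(2) inj_onD)
    qed
    show "(S has_derivative S' y) (at y)" if "y \<in> R ` K" for y
    proof -
      have *: "Q y \<in> K" using that by (auto simp: RQ)
      have "((\<lambda>y. R (T (Q y))) has_derivative (\<lambda>v. R (T' (Q y) (Q v)))) (at y)"
        by (rule bounded_linear.has_derivative[OF bl(1)
              has_derivative_compose[OF bounded_linear_imp_has_derivative[OF bl(2)] T(1)[OF *]]])
      then show ?thesis by (simp add: S_def S'_def o_def)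
    qed
    show "continuous_on (R ` K) (\<lambda>x. det (matrix (S' x)))"
      unfolding det
      by (rule continuous_on_compose2[OF cont linear_continuous_on[OF bl(2)]]) (auto simp: RQ(2))
  qed
  also have "\<dots> = (\<integral>\<^sup>+y\<in>R ` E. ennreal \<bar>det (matrix (T' (Q y)))\<bar> \<partial>distr lborel borel R)"
    by (simp add: det R_def lborel_relabel p)
  also have "\<dots> = (\<integral>\<^sup>+y\<in>R ` E. ennreal (indicator K (Q y) * \<bar>det (matrix (T' (Q y)))\<bar>) \<partial>distr lborel borel R)"
    using E(2) by (intro nn_integral_cong) (auto simp: indicator_def mem)
  also have "\<dots> = (\<integral>\<^sup>+x\<in>E. ennreal (indicator K x * \<bar>det (matrix (T' x))\<bar>) \<partial>lborel)"
  proof -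
    have "(\<lambda>y. indicator (R ` K) y *\<^sub>R \<bar>det (matrix (T' (Q y)))\<bar>) \<in> borel_measurable borel"
    proof (intro borel_measurable_continuous_on_indicator borel_compact)
      show "compact (R ` K)" by (intro compact_continuous_image linear_continuous_on bl K)
      have "continuous_on (R ` K) (\<lambda>y. det (matrix (T' (Q y))))"
        by (rule continuous_on_compose2[OF cont linear_continuous_on[OF bl(2)]]) (auto simp: RQ(2))
      then show "continuous_on (R ` K) (\<lambda>y. \<bar>det (matrix (T' (Q y)))\<bar>)"
        by (rule continuous_on_rabs)
    qed
    also have "(\<lambda>y. indicator (R ` K) y *\<^sub>R \<bar>det (matrix (T' (Q y)))\<bar>) =
        (\<lambda>y. indicator K (Q y) * \<bar>det (matrix (T' (Q y)))\<bar>)"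
      by (simp add: fun_eq_iff indicator_def mem)
    finally have [measurable]: "(\<lambda>y. indicator K (Q y) * \<bar>det (matrix (T' (Q y)))\<bar>) \<in> borel_measurable borel" .
    have [measurable]: "R ` E \<in> sets borel" by (intro Rm E)
    show ?thesis
      by (simp add: nn_integral_distr) (simp add: indicator_def mem RQ(2))
  qed
  also have "\<dots> = (\<integral>\<^sup>+x\<in>E. ennreal \<bar>det (matrix (T' x))\<bar> \<partial>lborel)"
    using E(2) by (intro nn_integral_cong) (auto simp: indicator_def)
  finally show ?thesis .
qed

lemma image_borel_of_continuous_inverse:
  fixes T :: "'a::topological_space \<Rightarrow> 'b::topological_space"
  assumes "open U" "open (T ` U)" "continuous_on (T ` U) S" "\<And>x. x \<in> U \<Longrightarrow> S (T x) = x"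
    and "E \<in> sets borel" "E \<subseteq> U"
  shows "T ` E \<in> sets borel"
proof -
  have e: "T ` E = S -` E \<inter> T ` U"
    using assms(4,6) by (force simp: image_iff)
  have "S \<in> borel_measurable (restrict_space borel (T ` U))"
    by (rule borel_measurable_continuous_on_restrict[OF assms(3)])
  from measurable_sets[OF this assms(5)] show ?thesis
    using assms(2) by (auto simp: e space_restrict_space sets_restrict_space_iff)
qed

text \<open>An open set is an increasing union of compact sets, on each of which the Jacobian
  determinant is integrable.\<close>

lemma emeasure_differentiable_image_open:
  fixes T :: "real^'n::finite \<Rightarrow> real^'n"
  assumes U: "open U" "open (T ` U)" "continuous_on (T ` U) S" "\<And>x. x \<in> U \<Longrightarrow> S (T x) = x"
    and E: "E \<in> sets borel" "E \<subseteq> U"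
    and T: "\<And>x. x \<in> U \<Longrightarrow> (T has_derivative T' x) (at x)"
    and cont: "continuous_on U (\<lambda>x. det (matrix (T' x)))"
  shows "emeasure lborel (T ` E) = (\<integral>\<^sup>+x\<in>E. ennreal \<bar>det (matrix (T' x))\<bar> \<partial>lborel)"
proof -
  obtain C where C: "\<And>n. compact (C n)" "\<And>n. C n \<subseteq> U" "\<And>n. C n \<subseteq> interior (C (Suc n))"
      "\<Union> (range C) = U"
    using open_Union_compact_subsets[OF U(1)] by metis
  have "C n \<subseteq> C (Suc n)" for n using C(3) interior_subset by blast
  then have inc: "incseq C" by (rule incseq_SucI)
  have inj: "inj_on T U" using U(4) by (metis inj_onI)
  have im: "T ` X \<in> sets borel" if "X \<in> sets borel" "X \<subseteq> U" for X
    by (rule image_borel_of_continuous_inverse[OF U that])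
  have [measurable]: "C n \<in> sets borel" for n using C(1) by (rule borel_compact)
  define d where "d x = ennreal (indicator U x *\<^sub>R \<bar>det (matrix (T' x))\<bar>)" for x
  have [measurable]: "d \<in> borel_measurable borel"
    unfolding d_def using U(1)
    by (intro measurable_compose[OF borel_measurable_continuous_on_indicator measurable_ennreal]
        continuous_intros cont) auto
  note [measurable] = E(1)
  have EC: "(\<Union>n. E \<inter> C n) = E" using E(2) C(4) by auto
  have "emeasure lborel (T ` (E \<inter> C n)) = emeasure (density lborel d) (E \<inter> C n)" for n
  proof -
    have "emeasure lborel (T ` (E \<inter> C n)) =
        (\<integral>\<^sup>+x\<in>E \<inter> C n. ennreal \<bar>det (matrix (T' x))\<bar> \<partial>lborel)"
      using C(1,2)[of n] E
      by (intro emeasure_differentiable_image_compact_finite[where K = "C n"])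
         (auto intro!: im T inj_on_subset[OF inj] continuous_on_subset[OF cont])
    also have "\<dots> = (\<integral>\<^sup>+x\<in>E \<inter> C n. d x \<partial>lborel)"
      using E(2) by (intro nn_integral_cong) (auto simp: indicator_def d_def)
    finally show ?thesis by (simp add: emeasure_density)
  qed
  then have "(SUP n. emeasure lborel (T ` (E \<inter> C n))) = (SUP n. emeasure (density lborel d) (E \<inter> C n))"
    by simp
  moreover have "(SUP n. emeasure lborel (T ` (E \<inter> C n))) = emeasure lborel (\<Union>n. T ` (E \<inter> C n))"
  proof (rule SUP_emeasure_incseq)
    show "incseq (\<lambda>n. T ` (E \<inter> C n))"
      unfolding incseq_def by (intro allI impI image_mono Int_mono order_refl incseqD[OF inc])
  qed (use E in \<open>auto intro!: im\<close>)
  moreover have "(SUP n. emeasure (density lborel d) (E \<inter> C n)) = emeasure (density lborel d) (\<Union>n. E \<inter> C n)"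
    using inc by (intro SUP_emeasure_incseq) (auto simp: incseq_def)
  ultimately have "emeasure lborel (T ` E) = emeasure (density lborel d) E"
    by (simp only: image_UN[symmetric] EC)
  also have "\<dots> = (\<integral>\<^sup>+x\<in>E. d x \<partial>lborel)" by (simp add: emeasure_density)
  also have "\<dots> = (\<integral>\<^sup>+x\<in>E. ennreal \<bar>det (matrix (T' x))\<bar> \<partial>lborel)"
    using E(2) by (intro nn_integral_cong) (auto simp: indicator_def d_def)
  finally show ?thesis .
qed

text \<open>The previous lemma says that the measure with density \<open>\<bar>det T'\<bar>\<close> is carried by \<open>T\<close> to
  Lebesgue measure on the image.\<close>

lemma nn_integral_change_of_variables:
  fixes T :: "real^'n::finite \<Rightarrow> real^'n"
  assumes U: "open U" "open (T ` U)" "continuous_on (T ` U) S" "\<And>x. x \<in> U \<Longrightarrow> S (T x) = x"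
    and T: "\<And>x. x \<in> U \<Longrightarrow> (T has_derivative T' x) (at x)"
    and cont: "continuous_on U (\<lambda>x. det (matrix (T' x)))"
    and h: "h \<in> borel_measurable borel"
  shows "(\<integral>\<^sup>+y\<in>T ` U. h y \<partial>lborel) = (\<integral>\<^sup>+x\<in>U. h (T x) * ennreal \<bar>det (matrix (T' x))\<bar> \<partial>lborel)"
proof -
  define d where "d x = ennreal (indicator U x *\<^sub>R \<bar>det (matrix (T' x))\<bar>)" for x
  have [measurable]: "d \<in> borel_measurable borel"
    unfolding d_def using U(1)
    by (intro measurable_compose[OF borel_measurable_continuous_on_indicator measurable_ennreal]
        continuous_intros cont) auto
  define T1 where "T1 x = indicator U x *\<^sub>R T x" for x
  have [measurable]: "T1 \<in> borel_measurable borel"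
    unfolding T1_def using U(1) T
    by (intro borel_measurable_continuous_on_indicator continuous_at_imp_continuous_on)
       (auto intro: has_derivative_continuous)
  note [measurable] = borel_open[OF U(1)] borel_open[OF U(2)] h
  have "distr (density lborel d) borel T1 = density lborel (indicator (T ` U))"
  proof (rule measure_eqI)
    fix X assume "X \<in> sets (distr (density lborel d) borel T1)"
    then have X [measurable]: "X \<in> sets borel" by simp
    have B: "T1 -` X \<in> sets borel" using measurable_sets[OF \<open>T1 \<in> borel_measurable borel\<close> X] by simp
    then have B': "T1 -` X \<inter> U \<in> sets borel" by auto
    have "emeasure (distr (density lborel d) borel T1) X = (\<integral>\<^sup>+x\<in>T1 -` X. d x \<partial>lborel)"
      using B by (simp add: emeasure_distr emeasure_density)
    also have "\<dots> = (\<integral>\<^sup>+x\<in>T1 -` X \<inter> U. ennreal \<bar>det (matrix (T' x))\<bar> \<partial>lborel)"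
      by (intro nn_integral_cong) (auto simp: d_def indicator_def)
    also have "\<dots> = emeasure lborel (T ` (T1 -` X \<inter> U))"
      by (rule emeasure_differentiable_image_open[OF U B' _ T cont, symmetric]) auto
    also have "T ` (T1 -` X \<inter> U) = X \<inter> T ` U"
      by (auto simp: T1_def)
    also have "emeasure lborel (X \<inter> T ` U) = emeasure (density lborel (indicator (T ` U))) X"
      by (subst emeasure_density) (auto simp: Int_commute indicator_inter_arith[symmetric])
    finally show "emeasure (distr (density lborel d) borel T1) X =
      emeasure (density lborel (indicator (T ` U))) X" .
  qed simp
  then have "(\<integral>\<^sup>+y. h y \<partial>distr (density lborel d) borel T1) = (\<integral>\<^sup>+y. h y \<partial>density lborel (indicator (T ` U)))"
    by simp
  then have "(\<integral>\<^sup>+x. d x * h (T1 x) \<partial>lborel) = (\<integral>\<^sup>+y. indicator (T ` U) y * h y \<partial>lborel)"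
    by (simp add: nn_integral_distr nn_integral_density)
  moreover have "(\<integral>\<^sup>+x. d x * h (T1 x) \<partial>lborel) =
      (\<integral>\<^sup>+x\<in>U. h (T x) * ennreal \<bar>det (matrix (T' x))\<bar> \<partial>lborel)"
    by (intro nn_integral_cong) (auto simp: d_def T1_def indicator_def mult.commute)
  ultimately show ?thesis by (simp add: mult.commute)
qed

section \<open>Charts and Jacobians\<close>

locale closed_manifold =
  fixes A :: "('m::t2_space, 'n::finite) chart set"
  assumes smooth_structure: "smooth_structure A"
    and compact_UNIV: "compact (UNIV :: 'm set)"
begin

abbreviation (input) img :: "('m, 'n) chart \<Rightarrow> (real^'n) set" where
  "img c \<equiv> coord c ` dom_of c"

lemma chart:
  assumes "c \<in> A"
  shows "open (dom_of c)" "open (img c)"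
    "\<And>x. x \<in> dom_of c \<Longrightarrow> coord_inv c (coord c x) = x"
    "\<And>y. y \<in> img c \<Longrightarrow> coord c (coord_inv c y) = y"
    "\<And>y. y \<in> img c \<Longrightarrow> coord_inv c y \<in> dom_of c"
    "continuous_on (dom_of c) (coord c)" "continuous_on (img c) (coord_inv c)"
proof -
  have "is_chart c" using assms smooth_structure by (simp add: smooth_structure_def)
  then have o: "open (dom_of c)" "open (img c)"
    and h: "homeomorphism (dom_of c) (img c) (coord c) (coord_inv c)"
    by (simp_all add: is_chart_def)
  show "open (dom_of c)" "open (img c)" by (fact o)+
  show "\<And>x. x \<in> dom_of c \<Longrightarrow> coord_inv c (coord c x) = x" by (rule homeomorphism_apply1[OF h])
  show "\<And>y. y \<in> img c \<Longrightarrow> coord c (coord_inv c y) = y" by (rule homeomorphism_apply2[OF h])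
  show "\<And>y. y \<in> img c \<Longrightarrow> coord_inv c y \<in> dom_of c" using homeomorphism_image2[OF h] by blast
  show "continuous_on (dom_of c) (coord c)" by (rule homeomorphism_cont1[OF h])
  show "continuous_on (img c) (coord_inv c)" by (rule homeomorphism_cont2[OF h])
qed

lemma charts_cover: obtains c where "c \<in> A" "x \<in> dom_of c"
  using smooth_structure unfolding smooth_structure_def by (metis UN_E UNIV_I)

lemma coord_image_eq:
  assumes "c \<in> A" "X \<subseteq> dom_of c"
  shows "coord c ` X = {y \<in> img c. coord_inv c y \<in> X}"
proof (rule set_eqI, rule iffI)
  fix y assume "y \<in> {y \<in> img c. coord_inv c y \<in> X}"
  then show "y \<in> coord c ` X" using chart(4)[OF assms(1), of y] by (metis (lifting) image_eqI mem_Collect_eq)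
qed (use assms chart(3)[OF assms(1)] in auto)

lemma open_coord_image:
  assumes "c \<in> A" "open X" "X \<subseteq> dom_of c"
  shows "open (coord c ` X)"
proof -
  have "coord c ` X = img c \<inter> coord_inv c -` X"
    unfolding coord_image_eq[OF assms(1,3)] by auto
  then show ?thesis
    using continuous_open_preimage[OF chart(7)[OF assms(1)] chart(2)[OF assms(1)] assms(2)] by simp
qed

lemma compact_coord_inv_image:
  assumes "c \<in> A" "compact K" "K \<subseteq> img c"
  shows "compact (coord_inv c ` K)"
  using assms(2) continuous_on_subset[OF chart(7)[OF assms(1)] assms(3)]
  by (intro compact_continuous_image)

lemma smooth_map_id: "smooth_map A id"
  using smooth_structure
  unfolding smooth_map_def smooth_structure_def smoothly_compatible_def by (simp add: continuous_on_id)

lemma diffeomorphism_id: "diffeomorphism A id"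
  by (simp add: diffeomorphism_def smooth_map_id)

definition expr_dom :: "('m, 'n) chart \<Rightarrow> ('m, 'n) chart \<Rightarrow> ('m \<Rightarrow> 'm) \<Rightarrow> (real^'n) set" where
  "expr_dom c c' \<phi> = coord c ` (dom_of c \<inter> \<phi> -` dom_of c')"

lemma expr_domI: "x \<in> dom_of c \<Longrightarrow> \<phi> x \<in> dom_of c' \<Longrightarrow> coord c x \<in> expr_dom c c' \<phi>"
  by (auto simp: expr_dom_def)

lemma expr_dom:
  assumes "smooth_map A \<phi>" "c \<in> A" "c' \<in> A"
  shows "open (expr_dom c c' \<phi>)" "smooth_on (expr_dom c c' \<phi>) (local_expr c c' \<phi>)"
    "open (dom_of c \<inter> \<phi> -` dom_of c')"
proof -
  have "continuous_on UNIV \<phi>" using assms by (simp add: smooth_map_def)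
  then show o: "open (dom_of c \<inter> \<phi> -` dom_of c')"
    by (intro open_Int open_vimage chart(1) assms)
  show "open (expr_dom c c' \<phi>)"
    unfolding expr_dom_def using assms o by (intro open_coord_image) auto
  show "smooth_on (expr_dom c c' \<phi>) (local_expr c c' \<phi>)"
    using assms by (simp add: smooth_map_def expr_dom_def)
qed

lemma local_expr_coord: "c \<in> A \<Longrightarrow> x \<in> dom_of c \<Longrightarrow> local_expr c c' \<phi> (coord c x) = coord c' (\<phi> x)"
  by (simp add: local_expr_def chart(3))

lemma local_expr_has_derivative:
  assumes "smooth_map A \<phi>" "c \<in> A" "c' \<in> A" "x \<in> dom_of c" "\<phi> x \<in> dom_of c'"
  shows "(local_expr c c' \<phi> has_derivative
    frechet_derivative (local_expr c c' \<phi>) (at (coord c x))) (at (coord c x))"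
proof -
  have "coord c x \<in> expr_dom c c' \<phi>" by (rule expr_domI[of x c \<phi> c', OF assms(4,5)])
  from smooth_on_differentiable[OF expr_dom(2)[OF assms(1-3)] this] show ?thesis
    by (rule differentiable_has_derivative)
qed

lemma jacobian_compose:
  assumes \<phi>: "smooth_map A \<phi>" and \<psi>: "smooth_map A \<psi>" and c: "c \<in> A" "c' \<in> A" "c'' \<in> A"
    and x: "x \<in> dom_of c" "\<phi> x \<in> dom_of c'" "\<psi> (\<phi> x) \<in> dom_of c''"
  shows "jacobian c c'' (\<lambda>x. \<psi> (\<phi> x)) x = jacobian c' c'' \<psi> (\<phi> x) ** jacobian c c' \<phi> x"
proof -
  define D where "D = frechet_derivative (local_expr c c' \<phi>) (at (coord c x))"
  define D' where "D' = frechet_derivative (local_expr c' c'' \<psi>) (at (coord c' (\<phi> x)))"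
  have D: "(local_expr c c' \<phi> has_derivative D) (at (coord c x))"
    unfolding D_def by (rule local_expr_has_derivative[OF \<phi> c(1,2) x(1,2)])
  have D': "(local_expr c' c'' \<psi> has_derivative D') (at (coord c' (\<phi> x)))"
    unfolding D'_def by (rule local_expr_has_derivative[OF \<psi> c(2,3) x(2,3)])
  have "((\<lambda>y. local_expr c' c'' \<psi> (local_expr c c' \<phi> y)) has_derivative (\<lambda>v. D' (D v))) (at (coord c x))"
    by (rule has_derivative_compose[OF D]) (simp add: local_expr_coord c x D')
  then have "(local_expr c c'' (\<lambda>x. \<psi> (\<phi> x)) has_derivative (\<lambda>v. D' (D v))) (at (coord c x))"
  proof (rule has_derivative_transform_within_open)
    show "open (expr_dom c c' \<phi>)" by (rule expr_dom[OF \<phi> c(1,2)])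
    show "coord c x \<in> expr_dom c c' \<phi>" by (rule expr_domI[of x c \<phi> c', OF x(1,2)])
    show "local_expr c' c'' \<psi> (local_expr c c' \<phi> y) = local_expr c c'' (\<lambda>x. \<psi> (\<phi> x)) y"
      if "y \<in> expr_dom c c' \<phi>" for y
      using that by (auto simp: expr_dom_def local_expr_coord c)
  qed
  then have "frechet_derivative (local_expr c c'' (\<lambda>x. \<psi> (\<phi> x))) (at (coord c x)) = D' \<circ> D"
    by (simp add: frechet_derivative_at[symmetric] o_def)
  then have "jacobian c c'' (\<lambda>x. \<psi> (\<phi> x)) x = matrix (D' \<circ> D)"
    by (simp add: jacobian_def)
  also have "\<dots> = matrix D' ** matrix D"
    by (intro matrix_compose has_derivative_linear[OF D] has_derivative_linear[OF D'])
  finally show ?thesis by (simp add: jacobian_def D_def D'_def)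
qed

lemma jacobian_id_self:
  assumes "c \<in> A" "x \<in> dom_of c"
  shows "jacobian c c id x = mat 1"
proof -
  have "((\<lambda>y. y) has_derivative (\<lambda>v. v)) (at (coord c x))" by (rule has_derivative_ident)
  then have "(local_expr c c id has_derivative (\<lambda>v. v)) (at (coord c x))"
    by (rule has_derivative_transform_within_open[OF _ chart(2)[OF assms(1)]])
       (use assms in \<open>auto simp: local_expr_coord\<close>)
  then show ?thesis
    by (simp add: jacobian_def frechet_derivative_at[symmetric] matrix_def mat_def axis_def vec_eq_iff)
qed

lemma jacobian_id_inverse:
  assumes "c \<in> A" "c' \<in> A" "x \<in> dom_of c" "x \<in> dom_of c'"
  shows "jacobian c' c id x ** jacobian c c' id x = mat 1"
  using jacobian_compose[OF smooth_map_id smooth_map_id, of c c' c x] jacobian_id_self[of c x] assms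
  by (simp add: id_def)

lemma jacobian_entry_smooth:
  assumes "smooth_map A \<phi>" "c \<in> A" "c' \<in> A"
  shows "smooth_on (expr_dom c c' \<phi>) (\<lambda>y. jacobian c c' \<phi> (coord_inv c y) $ i $ j)"
proof (subst smooth_on_cong[OF expr_dom(1)[OF assms]])
  show "smooth_on (expr_dom c c' \<phi>) (\<lambda>y. partial_deriv j (local_expr c c' \<phi>) y $ i)"
    by (intro smooth_on_bounded_linear[OF bounded_linear_vec_nth] expr_dom assms smooth_on_partial_deriv)
  show "jacobian c c' \<phi> (coord_inv c y) $ i $ j = partial_deriv j (local_expr c c' \<phi>) y $ i"
    if "y \<in> expr_dom c c' \<phi>" for y
    using that assms by (auto simp: expr_dom_def chart(3) jacobian_def matrix_def partial_deriv_def)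
qed

lemma sym_tensorsD:
  assumes "h \<in> sym_tensors A"
  shows "\<And>c x. c \<notin> A \<or> x \<notin> dom_of c \<Longrightarrow> h c x = 0"
    "\<And>c x. c \<in> A \<Longrightarrow> x \<in> dom_of c \<Longrightarrow> transpose (h c x) = h c x"
    "\<And>c c' x. c \<in> A \<Longrightarrow> c' \<in> A \<Longrightarrow> x \<in> dom_of c \<Longrightarrow> x \<in> dom_of c' \<Longrightarrow>
      h c x = transpose (jacobian c c' id x) ** h c' x ** jacobian c c' id x"
    "\<And>c. c \<in> A \<Longrightarrow> smooth_on (img c) (\<lambda>y. h c (coord_inv c y))"
proof -
  note h = assms[unfolded sym_tensors_def mem_Collect_eq]
  show "\<And>c x. c \<notin> A \<or> x \<notin> dom_of c \<Longrightarrow> h c x = 0"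
    "\<And>c x. c \<in> A \<Longrightarrow> x \<in> dom_of c \<Longrightarrow> transpose (h c x) = h c x"
    using h by blast+
  show "\<And>c c' x. c \<in> A \<Longrightarrow> c' \<in> A \<Longrightarrow> x \<in> dom_of c \<Longrightarrow> x \<in> dom_of c' \<Longrightarrow>
      h c x = transpose (jacobian c c' id x) ** h c' x ** jacobian c c' id x"
    using h by blast
  show "\<And>c. c \<in> A \<Longrightarrow> smooth_on (img c) (\<lambda>y. h c (coord_inv c y))"
    using h unfolding o_def by blast
qed

lemma sym_tensor_entry_smooth:
  assumes "h \<in> sym_tensors A" "c \<in> A"
  shows "smooth_on (img c) (\<lambda>y. h c (coord_inv c y) $ i $ j)"
  using sym_tensorsD(4)[OF assms] chart(2)[OF assms(2)] by (simp add: smooth_on_vec_iff)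

text \<open>The chart chosen in the definition of the pullback drops out by the chain rule and the
  transformation law.\<close>

lemma pullback_eq:
  assumes h: "h \<in> sym_tensors A" and \<phi>: "smooth_map A \<phi>"
    and c: "c \<in> A" "x \<in> dom_of c" "c' \<in> A" "\<phi> x \<in> dom_of c'"
  shows "pullback A \<phi> h c x = transpose (jacobian c c' \<phi> x) ** h c' (\<phi> x) ** jacobian c c' \<phi> x"
proof -
  define c0 where "c0 = (SOME c'. c' \<in> A \<and> \<phi> x \<in> dom_of c')"
  have c0: "c0 \<in> A \<and> \<phi> x \<in> dom_of c0" unfolding c0_def by (rule someI_ex) (use c in blast)
  have "jacobian c c0 \<phi> x = jacobian c' c0 id (\<phi> x) ** jacobian c c' \<phi> x"
    using jacobian_compose[OF \<phi> smooth_map_id, of c c' c0 x] c c0 by simp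
  moreover have "h c' (\<phi> x) = transpose (jacobian c' c0 id (\<phi> x)) ** h c0 (\<phi> x) ** jacobian c' c0 id (\<phi> x)"
    using sym_tensorsD(3)[OF h] c c0 by blast
  ultimately show ?thesis
    using c by (simp add: pullback_def c0_def[symmetric] Let_def matrix_transpose_mul matrix_mul_assoc)
qed

text \<open>The components are sums of products of first partial derivatives of the coordinate expression of
  \<open>\<phi>\<close> and of components of \<open>b\<close> composed with it. With a diffeomorphism this serves for pullbacks, with
  the identity for tensors that are given in a single chart.\<close>

lemma smooth_on_transported:
  assumes \<phi>: "smooth_map A \<phi>" and c: "c \<in> A" "c' \<in> A"
    and b: "smooth_on (img c') b"
  shows "smooth_on (expr_dom c c' \<phi>) (\<lambda>y. transpose (jacobian c c' \<phi> (coord_inv c y)) **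
    b (coord c' (\<phi> (coord_inv c y))) ** jacobian c c' \<phi> (coord_inv c y))"
proof -
  let ?U = "expr_dom c c' \<phi>"
  note U = expr_dom(1)[OF \<phi> c]
  have "smooth_on ?U (\<lambda>y. b (local_expr c c' \<phi> y))"
    by (rule smooth_on_compose[OF U b expr_dom(2)[OF \<phi> c]])
       (use c in \<open>auto simp: expr_dom_def local_expr_coord\<close>)
  then have b': "smooth_on ?U (\<lambda>y. b (coord c' (\<phi> (coord_inv c y))) $ i $ j)" for i j
    using U by (simp add: smooth_on_vec_iff local_expr_def)
  show ?thesis
    using U by (simp add: smooth_on_vec_iff matrix_matrix_mult_def transpose_def)
      (intro allI smooth_on_sum smooth_on_mult b' jacobian_entry_smooth \<phi> c)
qed

lemma smooth_on_local:
  assumes "\<And>y. y \<in> U \<Longrightarrow> \<exists>W. open W \<and> y \<in> W \<and> W \<subseteq> U \<and> smooth_on W f"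
  shows "smooth_on U f"
  using assms unfolding smooth_on_def by blast

lemma congruence_mult:
  fixes J K H :: "real^'k^'k"
  shows "transpose (K ** J) ** H ** (K ** J) = transpose J ** (transpose K ** H ** K) ** J"
  by (simp add: matrix_transpose_mul matrix_mul_assoc)

lemma pullback_sym_tensor:
  assumes h: "h \<in> sym_tensors A" and \<phi>: "smooth_map A \<phi>"
  shows "pullback A \<phi> h \<in> sym_tensors A"
  unfolding sym_tensors_def mem_Collect_eq
proof (intro conjI allI ballI impI)
  show "pullback A \<phi> h c x = 0" if "c \<notin> A \<or> x \<notin> dom_of c" for c x
    using that by (auto simp: pullback_def)
next
  fix c x assume c: "c \<in> A" "x \<in> dom_of c"
  obtain c0 where c0: "c0 \<in> A" "\<phi> x \<in> dom_of c0" by (rule charts_cover)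
  show "transpose (pullback A \<phi> h c x) = pullback A \<phi> h c x"
    using sym_tensorsD(2)[OF h c0]
    by (simp add: pullback_eq[OF h \<phi> c c0] matrix_transpose_mul matrix_mul_assoc)
next
  fix c c' x assume c: "c \<in> A" "c' \<in> A" and x: "x \<in> dom_of c \<inter> dom_of c'"
  obtain c0 where c0: "c0 \<in> A" "\<phi> x \<in> dom_of c0" by (rule charts_cover)
  have "jacobian c c0 \<phi> x = jacobian c' c0 \<phi> x ** jacobian c c' id x"
    using jacobian_compose[OF smooth_map_id \<phi> c c0(1)] x c0 by simp
  then show "pullback A \<phi> h c x =
      transpose (jacobian c c' id x) ** pullback A \<phi> h c' x ** jacobian c c' id x"
    using x by (simp add: pullback_eq[OF h \<phi> c(1) _ c0] pullback_eq[OF h \<phi> c(2) _ c0] congruence_mult)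
next
  fix c assume c: "c \<in> A"
  show "smooth_on (img c) (pullback A \<phi> h c \<circ> coord_inv c)"
  proof (rule smooth_on_local)
    fix y assume y: "y \<in> img c"
    obtain c0 where c0: "c0 \<in> A" "\<phi> (coord_inv c y) \<in> dom_of c0" by (rule charts_cover)
    let ?W = "expr_dom c c0 \<phi>"
    have W: "open ?W" by (rule expr_dom[OF \<phi> c c0(1)])
    have "y \<in> ?W"
      using expr_domI[of "coord_inv c y" c \<phi> c0] chart(4,5)[OF c y] c0 by simp
    moreover have "?W \<subseteq> img c" by (auto simp: expr_dom_def)
    moreover have "smooth_on ?W (pullback A \<phi> h c \<circ> coord_inv c)"
    proof (subst smooth_on_cong[OF W])
      show "smooth_on ?W (\<lambda>y. transpose (jacobian c c0 \<phi> (coord_inv c y)) **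
          h c0 (coord_inv c0 (coord c0 (\<phi> (coord_inv c y)))) ** jacobian c c0 \<phi> (coord_inv c y))"
        by (rule smooth_on_transported[OF \<phi> c c0(1) sym_tensorsD(4)[OF h c0(1)]])
      fix y assume "y \<in> ?W"
      then have "coord_inv c y \<in> dom_of c" "\<phi> (coord_inv c y) \<in> dom_of c0"
        using chart(3)[OF c] by (auto simp: expr_dom_def)
      then show "(pullback A \<phi> h c \<circ> coord_inv c) y = transpose (jacobian c c0 \<phi> (coord_inv c y)) **
          h c0 (coord_inv c0 (coord c0 (\<phi> (coord_inv c y)))) ** jacobian c c0 \<phi> (coord_inv c y)"
        using chart(3)[OF c0(1)] by (simp add: pullback_eq[OF h \<phi> c _ c0(1)])
    qed
    ultimately show "\<exists>W. open W \<and> y \<in> W \<and> W \<subseteq> img c \<and> smooth_on W (pullback A \<phi> h c \<circ> coord_inv c)"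
      using W by blast
  qed
qed

section \<open>Existence and uniqueness of the Riemannian measure\<close>

definition vol :: "('m, 'n) tensor2 \<Rightarrow> ('m, 'n) chart \<Rightarrow> real^'n \<Rightarrow> real" where
  "vol g c y = sqrt (det (g c (coord_inv c y)))"

lemma vol_continuous:
  assumes "h \<in> sym_tensors A" "c \<in> A"
  shows "continuous_on (img c) (vol h c)"
  unfolding vol_def
  by (intro continuous_on_real_sqrt smooth_on_continuous[OF smooth_on_det] chart(2) assms
      sym_tensor_entry_smooth)

text \<open>Both the independence of the chart (\<open>\<phi> = id\<close>) and the behaviour under diffeomorphisms are
  instances of the change of variables formula: a congruence \<open>J\<^sup>T H J\<close> multiplies \<open>sqrt det\<close> by
  \<open>\<bar>det J\<bar>\<close>.\<close>

lemma nn_integral_vol_transform: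
  assumes \<phi>: "diffeomorphism A \<phi>" and h: "h \<in> sym_tensors A" and c: "c \<in> A" "c' \<in> A"
    and E: "E \<in> sets borel" "E \<subseteq> dom_of c" "\<phi> ` E \<subseteq> dom_of c'"
    and k: "\<And>x. x \<in> E \<Longrightarrow>
      k c x = transpose (jacobian c c' \<phi> x) ** h c' (\<phi> x) ** jacobian c c' \<phi> x"
  shows "(\<integral>\<^sup>+y\<in>coord c ` E. ennreal (vol k c y) \<partial>lborel) =
    (\<integral>\<^sup>+y\<in>coord c' ` \<phi> ` E. ennreal (vol h c' y) \<partial>lborel)"
proof -
  have sm: "smooth_map A \<phi>" "smooth_map A (inv \<phi>)" and bij: "bij \<phi>"
    using \<phi> by (auto simp: diffeomorphism_def)
  have E': "x \<in> dom_of c" "\<phi> x \<in> dom_of c'" if "x \<in> E" for x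
    using E(2,3) that by blast+
  have inj: "x = x'" if "coord c' (\<phi> x) = coord c' (\<phi> x')" "\<phi> x \<in> dom_of c'" "\<phi> x' \<in> dom_of c'" for x x'
    using chart(3)[OF c(2)] that bij by (metis bij_is_inj injD)
  have inj': "x = x'" if "coord c x = coord c x'" "x \<in> dom_of c" "x' \<in> dom_of c" for x x'
    using chart(3)[OF c(1)] that by metis
  define T where "T = local_expr c c' \<phi>"
  define S where "S = local_expr c' c (inv \<phi>)"
  define U where "U = expr_dom c c' \<phi>"
  define T' where "T' y = frechet_derivative T (at y)" for y
  have U: "open U" unfolding U_def by (rule expr_dom[OF sm(1) c])
  have EU: "coord c x \<in> U" if "x \<in> E" for x
    using E'[OF that] unfolding U_def by (blast intro: expr_domI)
  have TU: "T ` U = expr_dom c' c (inv \<phi>)"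
  proof -
    have "T ` U = coord c' ` \<phi> ` (dom_of c \<inter> \<phi> -` dom_of c')"
      unfolding U_def expr_dom_def T_def image_image by (rule image_cong) (auto simp: local_expr_coord c)
    also have "\<phi> ` (dom_of c \<inter> \<phi> -` dom_of c') = dom_of c' \<inter> inv \<phi> -` dom_of c"
      using bij by (auto simp: bij_is_inj bij_is_surj surj_f_inv_f intro!: image_eqI[where f = \<phi>])
    finally show ?thesis by (simp add: expr_dom_def)
  qed
  have oTU: "open (T ` U)" unfolding TU by (rule expr_dom[OF sm(2) c(2,1)])
  have contS: "continuous_on (T ` U) S"
    unfolding TU S_def by (rule smooth_on_continuous[OF expr_dom(2)[OF sm(2) c(2,1)]])
  have ST: "S (T y) = y" if "y \<in> U" for y
    using that bij by (auto simp: U_def T_def S_def expr_dom_def local_expr_coord c bij_is_inj)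
  have der: "(T has_derivative T' y) (at y)" if "y \<in> U" for y
    using that local_expr_has_derivative[OF sm(1) c]
    by (auto simp: U_def expr_dom_def T'_def T_def)
  have J: "matrix (T' (coord c x)) = jacobian c c' \<phi> x" for x
    by (simp add: T'_def T_def jacobian_def)
  have cont: "continuous_on U (\<lambda>y. det (matrix (T' y)))"
  proof -
    have "continuous_on U (\<lambda>y. det (jacobian c c' \<phi> (coord_inv c y)))"
      unfolding U_def
      by (intro smooth_on_continuous[OF smooth_on_det] expr_dom(1) sm c jacobian_entry_smooth)
    then show ?thesis
      by (rule continuous_on_eq) (use c in \<open>auto simp: U_def expr_dom_def chart(3) J[symmetric]\<close>)
  qed
  have B: "coord c' ` \<phi> ` E \<in> sets borel"
  proof -
    have "coord c ` E \<in> sets borel"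
      by (rule image_borel_of_continuous_inverse[OF chart(1,2,7,3)[OF c(1)] E(1,2)])
    then have "T ` coord c ` E \<in> sets borel"
      using EU by (intro image_borel_of_continuous_inverse[OF U oTU contS ST]) auto
    also have "T ` coord c ` E = coord c' ` \<phi> ` E"
      unfolding image_image T_def by (rule image_cong) (use E c in \<open>auto simp: local_expr_coord\<close>)
    finally show ?thesis .
  qed
  \<comment> \<open>the density on the image of \<open>E\<close>, continued by 0 to a Borel function on the whole space\<close>
  define f where "f y = ennreal (indicator (img c') y * vol h c' y) * indicator (coord c' ` \<phi> ` E) y" for y
  have [measurable]: "(\<lambda>y. indicator (img c') y * vol h c' y) \<in> borel_measurable borel"
    using borel_measurable_continuous_on_indicator[OF _ vol_continuous[OF h c(2)]] chart(2)[OF c(2)] by simp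
  have f: "f \<in> borel_measurable borel"
    unfolding f_def using B by measurable
  have "(\<integral>\<^sup>+y\<in>coord c' ` \<phi> ` E. ennreal (vol h c' y) \<partial>lborel) = (\<integral>\<^sup>+y\<in>T ` U. f y \<partial>lborel)"
  proof (rule nn_integral_cong)
    fix y
    have "y \<in> T ` U \<and> y \<in> img c'" if "y \<in> coord c' ` \<phi> ` E"
    proof -
      from that obtain x where x: "x \<in> E" "y = coord c' (\<phi> x)" by blast
      then have "y = T (coord c x)" using E' c by (simp add: T_def local_expr_coord)
      then show ?thesis using x(2) EU[OF x(1)] E'(2)[OF x(1)] by blast
    qed
    then show "ennreal (vol h c' y) * indicator (coord c' ` \<phi> ` E) y = f y * indicator (T ` U) y"
      by (auto simp: f_def indicator_def)
  qed
  also have "\<dots> = (\<integral>\<^sup>+y\<in>U. f (T y) * ennreal \<bar>det (matrix (T' y))\<bar> \<partial>lborel)"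
    by (rule nn_integral_change_of_variables[OF U oTU contS ST der cont f])
  also have "\<dots> = (\<integral>\<^sup>+y\<in>coord c ` E. ennreal (vol k c y) \<partial>lborel)"
  proof (rule nn_integral_cong)
    fix y
    show "f (T y) * ennreal \<bar>det (matrix (T' y))\<bar> * indicator U y =
      ennreal (vol k c y) * indicator (coord c ` E) y"
    proof (cases "y \<in> U")
      case False
      moreover have "y \<notin> coord c ` E" using False EU by blast
      ultimately show ?thesis by simp
    next
      case True
      then obtain x where x: "x \<in> dom_of c" "\<phi> x \<in> dom_of c'" "y = coord c x"
        by (auto simp: U_def expr_dom_def)
      have T: "T y = coord c' (\<phi> x)" using x c by (simp add: T_def local_expr_coord)
      have mem: "T y \<in> coord c' ` \<phi> ` E \<longleftrightarrow> x \<in> E"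
      proof
        assume "T y \<in> coord c' ` \<phi> ` E"
        then obtain x' where x': "x' \<in> E" "coord c' (\<phi> x) = coord c' (\<phi> x')"
          unfolding T by blast
        then show "x \<in> E" using inj[OF x'(2) x(2) E'(2)[OF x'(1)]] by simp
      qed (simp add: T)
      have mem': "y \<in> coord c ` E \<longleftrightarrow> x \<in> E"
      proof
        assume "y \<in> coord c ` E"
        then obtain x' where x': "x' \<in> E" "coord c x = coord c x'"
          unfolding x(3) by blast
        then show "x \<in> E" using inj'[OF x'(2) x(1) E'(1)[OF x'(1)]] by simp
      qed (simp add: x(3))
      have "vol k c y = vol h c' (T y) * \<bar>det (matrix (T' y))\<bar>" if "x \<in> E"
      proof -
        have "det (k c x) = det (h c' (\<phi> x)) * (det (jacobian c c' \<phi> x))\<^sup>2"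
          by (simp add: k[OF that] det_mul det_transpose power2_eq_square)
        then show ?thesis
          using x c T[unfolded x(3)] by (simp add: vol_def J chart(3) real_sqrt_mult)
      qed
      then show ?thesis
        using True x(2) mem mem' unfolding f_def
        by (cases "x \<in> E") (simp_all add: T ennreal_mult'')
    qed
  qed
  finally show ?thesis by simp
qed

definition riemannian_measure_axioms :: "('m, 'n) tensor2 \<Rightarrow> 'm measure \<Rightarrow> bool" where
  "riemannian_measure_axioms g \<mu> \<longleftrightarrow> sets \<mu> = sets borel \<and>
     (\<forall>c\<in>A. \<forall>E\<in>sets borel. E \<subseteq> dom_of c \<longrightarrow>
        emeasure \<mu> E = (\<integral>\<^sup>+y\<in>coord c ` E. ennreal (vol g c y) \<partial>lborel))"

text \<open>Finitely many charts suffice by compactness, and removing from each domain the previous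
  ones gives a partition into Borel sets.\<close>

lemma finite_borel_partition:
  obtains N :: nat and cs :: "nat \<Rightarrow> ('m, 'n) chart" and P :: "nat \<Rightarrow> 'm set"
  where "\<And>a. a < N \<Longrightarrow> cs a \<in> A" "\<And>a. a < N \<Longrightarrow> P a \<in> sets borel" "\<And>a. a < N \<Longrightarrow> P a \<subseteq> dom_of (cs a)"
    "disjoint_family_on P {..<N}" "(\<Union>a<N. P a) = UNIV"
proof -
  have "\<exists>F. F \<subseteq> A \<and> finite F \<and> (UNIV :: 'm set) \<subseteq> (\<Union>c\<in>F. dom_of c)"
    using compactE_image[OF compact_UNIV, of A dom_of] chart(1) smooth_structure
    unfolding smooth_structure_def by (metis subset_UNIV)
  then obtain F where F: "F \<subseteq> A" "finite F" "(UNIV :: 'm set) \<subseteq> (\<Union>c\<in>F. dom_of c)" by blast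
  obtain N :: nat and cs where Fcs: "F = cs ` {i. i < N}"
    using finite_imp_nat_seg_image_inj_on[OF F(2)] by blast
  then have csA: "cs a \<in> A" if "a < N" for a
    using F(1) that by auto
  have cov: "\<exists>a<N. x \<in> dom_of (cs a)" for x
    using F(3) unfolding Fcs by blast
  define P where "P a = dom_of (cs a) - (\<Union>b<a. dom_of (cs b))" for a
  show ?thesis
  proof (rule that[of N cs P])
    show "P a \<in> sets borel" if "a < N" for a
    proof -
      have "open (\<Union>b<a. dom_of (cs b))"
        using that by (intro open_UN ballI chart(1) csA) simp
      then show ?thesis unfolding P_def using chart(1)[OF csA[OF that]] by (intro sets.Diff borel_open)
    qed
    have "P a \<inter> P b = {}" if "a < b" for a b using that by (auto simp: P_def)
    then show "disjoint_family_on P {..<N}"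
      unfolding disjoint_family_on_def by (metis inf_commute linorder_neqE_nat)
    show "(\<Union>a<N. P a) = UNIV"
    proof (rule set_eqI, simp)
      fix x
      have ex: "\<exists>a. a < N \<and> x \<in> dom_of (cs a)" using cov by blast
      define a where "a = (LEAST a. a < N \<and> x \<in> dom_of (cs a))"
      have a: "a < N" "x \<in> dom_of (cs a)" unfolding a_def using LeastI_ex[OF ex] by blast+
      moreover have "x \<notin> dom_of (cs b)" if "b < a" for b
        using not_less_Least[of b "\<lambda>a. a < N \<and> x \<in> dom_of (cs a)"] that a(1)
        unfolding a_def[symmetric] by simp
      ultimately show "\<exists>a\<in>{..<N}. x \<in> P a" unfolding P_def by blast
    qed
  qed (auto simp: csA P_def)
qed

text \<open>Every Borel set is the disjoint union of its intersections with the pieces of the partition, each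
  of which lies in a chart domain, where the measure is prescribed.\<close>

lemma riemannian_measure_axioms_unique:
  assumes "riemannian_measure_axioms g \<mu>" "riemannian_measure_axioms g \<mu>'"
  shows "\<mu> = \<mu>'"
proof (rule measure_eqI)
  show "sets \<mu> = sets \<mu>'" using assms by (simp add: riemannian_measure_axioms_def)
  fix X assume "X \<in> sets \<mu>"
  then have X: "X \<in> sets borel" using assms by (simp add: riemannian_measure_axioms_def)
  obtain N :: nat and cs and P where P: "\<And>a. a < N \<Longrightarrow> cs a \<in> A" "\<And>a. a < N \<Longrightarrow> P a \<in> sets borel"
    "\<And>a. a < N \<Longrightarrow> P a \<subseteq> dom_of (cs a)" "disjoint_family_on P {..<N}" "(\<Union>a<N. P a) = UNIV"
    by (rule finite_borel_partition) blast
  have split: "emeasure \<nu> X = (\<Sum>a<N. \<integral>\<^sup>+y\<in>coord (cs a) ` (X \<inter> P a). ennreal (vol g (cs a) y) \<partial>lborel)"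
    if \<nu>: "riemannian_measure_axioms g \<nu>" for \<nu>
  proof -
    have "disjoint_family_on (\<lambda>a. X \<inter> P a) {..<N}"
      using P(4) unfolding disjoint_family_on_def by blast
    then have "(\<Sum>a<N. emeasure \<nu> (X \<inter> P a)) = emeasure \<nu> (\<Union>a<N. X \<inter> P a)"
      using P(2) X \<nu> by (intro sum_emeasure) (auto simp: riemannian_measure_axioms_def)
    also have "(\<Union>a<N. X \<inter> P a) = X \<inter> (\<Union>a<N. P a)" by blast
    finally have "emeasure \<nu> X = (\<Sum>a<N. emeasure \<nu> (X \<inter> P a))" by (simp add: P(5))
    also have "\<dots> = (\<Sum>a<N. \<integral>\<^sup>+y\<in>coord (cs a) ` (X \<inter> P a). ennreal (vol g (cs a) y) \<partial>lborel)"
    proof (rule sum.cong[OF refl])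
      fix a assume "a \<in> {..<N}"
      then have "X \<inter> P a \<in> sets borel" "X \<inter> P a \<subseteq> dom_of (cs a)" "cs a \<in> A"
        using P(1-3)[of a] X by auto
      then show "emeasure \<nu> (X \<inter> P a) =
          (\<integral>\<^sup>+y\<in>coord (cs a) ` (X \<inter> P a). ennreal (vol g (cs a) y) \<partial>lborel)"
        using \<nu> unfolding riemannian_measure_axioms_def by blast
    qed
    finally show ?thesis .
  qed
  show "emeasure \<mu> X = emeasure \<mu>' X" using split[OF assms(1)] split[OF assms(2)] by simp
qed

lemma measurable_coord_inv:
  assumes "c \<in> A"
  shows "coord_inv c \<in> borel_measurable borel"
proof (rule measurableI)
  fix X :: "'m set" assume X: "X \<in> sets borel"
  define z where "z = (SOME x :: 'm. False)"
  \<comment> \<open>Off the image of the chart, \<open>inv_into\<close> returns one fixed point.\<close>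
  have z: "coord_inv c y = z" if "y \<notin> img c" for y
  proof -
    have "(\<lambda>x. x \<in> dom_of c \<and> coord c x = y) = (\<lambda>x. False)" using that by auto
    then show ?thesis by (simp add: coord_inv_def inv_into_def z_def)
  qed
  have "coord_inv c \<in> borel_measurable (restrict_space borel (img c))"
    by (rule borel_measurable_continuous_on_restrict[OF chart(7)[OF assms]])
  from measurable_sets[OF this X] have "coord_inv c -` X \<inter> img c \<in> sets borel"
    using chart(2)[OF assms] by (auto simp: space_restrict_space sets_restrict_space_iff)
  moreover have "- img c \<in> sets borel" using chart(2)[OF assms] by auto
  ultimately have "coord_inv c -` X \<inter> img c \<union> (if z \<in> X then - img c else {}) \<in> sets borel"
    by (intro sets.Un) auto
  moreover have "coord_inv c -` X = coord_inv c -` X \<inter> img c \<union> (if z \<in> X then - img c else {})"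
    using z by auto
  ultimately have "coord_inv c -` X \<in> sets borel" by argo
  then show "coord_inv c -` X \<inter> space borel \<in> sets borel" by simp
qed simp

text \<open>The image of the volume density under the inverse of the chart. By \<open>chart_measure_eq_density\<close> it is the
  restriction of the Riemannian measure to the domain of the chart.\<close>

definition chart_measure :: "('m, 'n) tensor2 \<Rightarrow> ('m, 'n) chart \<Rightarrow> 'm measure" where
  "chart_measure g c =
     distr (density lborel (\<lambda>y. ennreal (indicator (img c) y * vol g c y))) borel (coord_inv c)"

lemma vol_measurable:
  assumes "g \<in> sym_tensors A" "c \<in> A"
  shows "(\<lambda>y. indicator (img c) y * vol g c y) \<in> borel_measurable borel"
  using borel_measurable_continuous_on_indicator[OF _ vol_continuous[OF assms]] chart(2)[OF assms(2)] by simp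

lemma emeasure_chart_measure:
  assumes g: "g \<in> sym_tensors A" and c: "c \<in> A" and X: "X \<in> sets borel"
  shows "emeasure (chart_measure g c) X = (\<integral>\<^sup>+y\<in>coord c ` (X \<inter> dom_of c). ennreal (vol g c y) \<partial>lborel)"
proof -
  note [measurable] = vol_measurable[OF g c] measurable_coord_inv[OF c]
  have B: "coord_inv c -` X \<in> sets borel"
    using measurable_sets[OF measurable_coord_inv[OF c] X] by simp
  have "emeasure (chart_measure g c) X =
      (\<integral>\<^sup>+y\<in>coord_inv c -` X. ennreal (indicator (img c) y * vol g c y) \<partial>lborel)"
    unfolding chart_measure_def using X B by (simp add: emeasure_distr emeasure_density)
  also have "\<dots> = (\<integral>\<^sup>+y\<in>coord c ` (X \<inter> dom_of c). ennreal (vol g c y) \<partial>lborel)"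
  proof (rule nn_integral_cong)
    fix y
    have "y \<in> coord c ` (X \<inter> dom_of c) \<longleftrightarrow> y \<in> img c \<and> y \<in> coord_inv c -` X"
      using chart(5)[OF c, of y] coord_image_eq[OF c, of "X \<inter> dom_of c"] by blast
    then show "ennreal (indicator (img c) y * vol g c y) * indicator (coord_inv c -` X) y =
        ennreal (vol g c y) * indicator (coord c ` (X \<inter> dom_of c)) y"
      by (simp add: indicator_def)
  qed
  finally show ?thesis .
qed

text \<open>The measures prescribed in the charts agree on overlaps by \<open>nn_integral_vol_transform\<close> for the
  identity, so gluing them along the Borel partition gives a measure with the prescribed values in all
  charts.\<close>

lemma ex_riemannian_measure:
  assumes g: "g \<in> sym_tensors A"
  shows "\<exists>\<mu>. riemannian_measure_axioms g \<mu>"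
proof -
  obtain N :: nat and cs and P where P: "\<And>a. a < N \<Longrightarrow> cs a \<in> A" "\<And>a. a < N \<Longrightarrow> P a \<in> sets borel"
    "\<And>a. a < N \<Longrightarrow> P a \<subseteq> dom_of (cs a)" "disjoint_family_on P {..<N}" "(\<Union>a<N. P a) = UNIV"
    by (rule finite_borel_partition) blast
  define m where "m X = (\<Sum>a<N. emeasure (chart_measure g (cs a)) (X \<inter> P a))" for X
  define \<mu> where "\<mu> = measure_of (UNIV :: 'm set) (sets borel) m"
  have sc: "sets (chart_measure g c) = sets borel" for c by (simp add: chart_measure_def)
  have "countably_additive (sets borel) m"
  proof (rule countably_additiveI)
    fix B :: "nat \<Rightarrow> 'm set"
    assume B: "range B \<subseteq> sets borel" "disjoint_family B" "\<Union> (range B) \<in> sets borel"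
    have "suminf (\<lambda>i. m (B i)) = (\<Sum>a<N. suminf (\<lambda>i. emeasure (chart_measure g (cs a)) (B i \<inter> P a)))"
      unfolding m_def by (rule suminf_sum) simp
    also have "\<dots> = (\<Sum>a<N. emeasure (chart_measure g (cs a)) (\<Union>i. B i \<inter> P a))"
    proof (rule sum.cong[OF refl], rule suminf_emeasure)
      fix a assume "a \<in> {..<N}"
      then show "range (\<lambda>i. B i \<inter> P a) \<subseteq> sets (chart_measure g (cs a))"
        using B(1) P(2)[of a] by (auto simp: sc)
      show "disjoint_family (\<lambda>i. B i \<inter> P a)"
        using B(2) unfolding disjoint_family_on_def by blast
    qed
    finally show "suminf (\<lambda>i. m (B i)) = m (\<Union> (range B))"
      by (simp add: m_def)
  qed
  moreover have "positive (sets borel) m" by (simp add: positive_def m_def)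
  moreover have "sigma_algebra (UNIV :: 'm set) (sets borel)"
    using sets.sigma_algebra_axioms[of borel] by simp
  ultimately have em: "emeasure \<mu> X = m X" if "X \<in> sets borel" for X
    unfolding \<mu>_def using that by (intro emeasure_measure_of_sigma) auto
  have "riemannian_measure_axioms g \<mu>"
    unfolding riemannian_measure_axioms_def
  proof (intro conjI ballI impI)
    show "sets \<mu> = sets borel"
      unfolding \<mu>_def using sets.sigma_sets_eq[of borel] by (simp add: sets_measure_of)
    fix c and X :: "'m set" assume c: "c \<in> A" and X: "X \<in> sets borel" "X \<subseteq> dom_of c"
    have "emeasure (chart_measure g (cs a)) (X \<inter> P a) = emeasure (chart_measure g c) (X \<inter> P a)" if "a < N" for a
    proof -
      have XP: "X \<inter> P a \<in> sets borel" "X \<inter> P a \<inter> dom_of c = X \<inter> P a" "X \<inter> P a \<inter> dom_of (cs a) = X \<inter> P a"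
        using X P(2,3)[OF that] by auto
      have "(\<integral>\<^sup>+y\<in>coord c ` (X \<inter> P a). ennreal (vol g c y) \<partial>lborel) =
          (\<integral>\<^sup>+y\<in>coord (cs a) ` id ` (X \<inter> P a). ennreal (vol g (cs a) y) \<partial>lborel)"
      proof (rule nn_integral_vol_transform[OF diffeomorphism_id g c P(1)[OF that] XP(1)])
        fix x assume "x \<in> X \<inter> P a"
        then show "g c x = transpose (jacobian c (cs a) id x) ** g (cs a) (id x) ** jacobian c (cs a) id x"
          using sym_tensorsD(3)[OF g c P(1)[OF that], of x] X(2) P(3)[OF that]
          unfolding id_apply by blast
      next
        show "X \<inter> P a \<subseteq> dom_of c" "id ` (X \<inter> P a) \<subseteq> dom_of (cs a)"
          using X(2) P(3)[OF that] unfolding image_id id_apply by blast+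
      qed
      then show ?thesis
        unfolding emeasure_chart_measure[OF g c XP(1)] emeasure_chart_measure[OF g P(1)[OF that] XP(1)]
        unfolding XP(2,3) image_id id_apply by (rule sym)
    qed
    then have "m X = (\<Sum>a<N. emeasure (chart_measure g c) (X \<inter> P a))" by (simp add: m_def)
    also have "\<dots> = emeasure (chart_measure g c) (\<Union>a<N. X \<inter> P a)"
    proof (rule sum_emeasure)
      show "disjoint_family_on (\<lambda>a. X \<inter> P a) {..<N}"
        using P(4) unfolding disjoint_family_on_def by blast
    qed (use X P(2) in \<open>auto simp: sc\<close>)
    also have "(\<Union>a<N. X \<inter> P a) = X \<inter> (\<Union>a<N. P a)" by blast
    also have "\<dots> = X" by (simp add: P(5))
    finally show "emeasure \<mu> X = (\<integral>\<^sup>+y\<in>coord c ` X. ennreal (vol g c y) \<partial>lborel)"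
      using X by (simp add: em emeasure_chart_measure[OF g c] Int_absorb2)
  qed
  then show ?thesis by blast
qed

lemma riemannian_measure_The:
  "riemannian_measure A g = (THE \<mu>. riemannian_measure_axioms g \<mu>)"
  by (simp add: riemannian_measure_def riemannian_measure_axioms_def vol_def)

lemma riemannian_measure_eqI:
  "riemannian_measure_axioms g \<mu> \<Longrightarrow> riemannian_measure A g = \<mu>"
  unfolding riemannian_measure_The by (rule the_equality) (auto intro: riemannian_measure_axioms_unique)

lemma riemannian_measure:
  "g \<in> sym_tensors A \<Longrightarrow> riemannian_measure_axioms g (riemannian_measure A g)"
  using ex_riemannian_measure riemannian_measure_eqI by metis

lemma sets_riemannian_measure [simp]:
  "g \<in> sym_tensors A \<Longrightarrow> sets (riemannian_measure A g) = sets borel"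
  using riemannian_measure by (simp add: riemannian_measure_axioms_def)

lemma chart_measure_eq_density:
  assumes g: "g \<in> sym_tensors A" and c: "c \<in> A"
  shows "chart_measure g c = density (riemannian_measure A g) (indicator (dom_of c))"
proof (rule measure_eqI)
  show "sets (chart_measure g c) = sets (density (riemannian_measure A g) (indicator (dom_of c)))"
    by (simp add: chart_measure_def g)
  fix X assume "X \<in> sets (chart_measure g c)"
  then have X: "X \<in> sets borel" by (simp add: chart_measure_def)
  have D: "dom_of c \<in> sets borel" using chart(1)[OF c] by auto
  have "emeasure (density (riemannian_measure A g) (indicator (dom_of c))) X =
      emeasure (riemannian_measure A g) (X \<inter> dom_of c)"
    using X D g borel_measurable_indicator[of "dom_of c" "riemannian_measure A g"]
    by (subst emeasure_density) (auto simp: indicator_inter_arith[symmetric] Int_commute)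
  also have "\<dots> = (\<integral>\<^sup>+y\<in>coord c ` (X \<inter> dom_of c). ennreal (vol g c y) \<partial>lborel)"
    using riemannian_measure[OF g] X D c unfolding riemannian_measure_axioms_def by auto
  finally show "emeasure (chart_measure g c) X =
      emeasure (density (riemannian_measure A g) (indicator (dom_of c))) X"
    by (simp add: emeasure_chart_measure[OF g c X])
qed

lemma metrics_sym_tensors: "g \<in> metrics A \<Longrightarrow> g \<in> sym_tensors A"
  by (simp add: metrics_def)

lemma metric_positive_definite:
  "g \<in> metrics A \<Longrightarrow> c \<in> A \<Longrightarrow> x \<in> dom_of c \<Longrightarrow> positive_definite (g c x)"
  by (simp add: metrics_def positive_definite_def)

text \<open>Restricted to a chart domain, the Riemannian measure is the image of a Lebesgue measure with
  density.\<close>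

lemma integral_in_chart:
  fixes f :: "'m \<Rightarrow> real"
  assumes g: "g \<in> metrics A" and c: "c \<in> A" and f: "f \<in> borel_measurable borel"
    and supp: "\<And>x. x \<notin> dom_of c \<Longrightarrow> f x = 0"
  shows "integral\<^sup>L (riemannian_measure A g) f =
      (\<integral>y. indicator (img c) y * (f (coord_inv c y) * vol g c y) \<partial>lborel)"
    and "integrable (riemannian_measure A g) f \<longleftrightarrow>
      integrable lborel (\<lambda>y. indicator (img c) y * (f (coord_inv c y) * vol g c y))"
proof -
  note gs = metrics_sym_tensors[OF g]
  note [measurable] = vol_measurable[OF gs c] measurable_coord_inv[OF c] f
  have [measurable]: "dom_of c \<in> sets borel" using chart(1)[OF c] by auto
  have fM: "f \<in> borel_measurable (riemannian_measure A g)"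
    using f by (simp add: gs cong: measurable_cong_sets)
  have D: "dom_of c \<in> sets (riemannian_measure A g)" by (simp add: gs)
  have nonneg: "0 \<le> indicator (img c) y * vol g c y" for y
    using positive_definite_det_pos[OF metric_positive_definite[OF g c chart(5)[OF c]], of y]
    by (auto simp: indicator_def vol_def)
  have 1: "integral\<^sup>L (chart_measure g c) f = integral\<^sup>L (riemannian_measure A g) f"
    "integrable (chart_measure g c) f \<longleftrightarrow> integrable (riemannian_measure A g) f"
  proof -
    have e: "chart_measure g c = density (riemannian_measure A g) (\<lambda>x. ennreal (indicator (dom_of c) x))"
      unfolding chart_measure_eq_density[OF gs c] by (simp add: ennreal_indicator)
    have i: "(\<lambda>x. indicator (dom_of c) x *\<^sub>R f x) = f" using supp by (auto simp: fun_eq_iff indicator_def)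
    have m: "(\<lambda>x. indicator (dom_of c) x :: real) \<in> borel_measurable (riemannian_measure A g)"
      using D by measurable
    show "integral\<^sup>L (chart_measure g c) f = integral\<^sup>L (riemannian_measure A g) f"
      unfolding e by (subst integral_density[OF fM m]) (simp_all add: i[simplified])
    show "integrable (chart_measure g c) f \<longleftrightarrow> integrable (riemannian_measure A g) f"
      unfolding e by (subst integrable_density[OF fM m]) (simp_all add: i[simplified])
  qed
  have 2: "(\<lambda>y. indicator (img c) y * (f (coord_inv c y) * vol g c y)) =
      (\<lambda>y. (indicator (img c) y * vol g c y) *\<^sub>R f (coord_inv c y))"
    by (simp add: fun_eq_iff mult_ac)
  show "integral\<^sup>L (riemannian_measure A g) f =
      (\<integral>y. indicator (img c) y * (f (coord_inv c y) * vol g c y) \<partial>lborel)"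
    unfolding 1(1)[symmetric] 2 chart_measure_def
    using nonneg by (subst integral_distr) (auto simp: integral_density)
  show "integrable (riemannian_measure A g) f \<longleftrightarrow>
      integrable lborel (\<lambda>y. indicator (img c) y * (f (coord_inv c y) * vol g c y))"
    unfolding 1(2)[symmetric] 2 chart_measure_def
    using nonneg by (subst integrable_distr_eq) (auto simp: integrable_density)
qed

text \<open>The image measure has the values that characterise the Riemannian measure of \<open>\<phi>\<^sup>*g\<close>. A subset of a
  chart domain need not be mapped into a single chart, so it is cut along the Borel partition first.\<close>

lemma riemannian_measure_pullback:
  assumes \<phi>: "diffeomorphism A \<phi>" and g: "g \<in> sym_tensors A"
  shows "riemannian_measure A (pullback A \<phi> g) = distr (riemannian_measure A g) borel (inv \<phi>)"
proof (rule riemannian_measure_eqI, unfold riemannian_measure_axioms_def, intro conjI ballI impI)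
  have sm: "smooth_map A \<phi>" "smooth_map A (inv \<phi>)" and bij: "bij \<phi>"
    using \<phi> by (auto simp: diffeomorphism_def)
  have inv: "inv \<phi> \<in> borel_measurable borel" "\<phi> \<in> borel_measurable borel"
    using sm by (auto intro!: borel_measurable_continuous_onI simp: smooth_map_def)
  let ?\<nu> = "distr (riemannian_measure A g) borel (inv \<phi>)"
  show "sets ?\<nu> = sets borel" by simp
  have mI: "inv \<phi> \<in> measurable (riemannian_measure A g) borel"
    using inv(1) g by (simp cong: measurable_cong_sets)
  fix c and X :: "'m set" assume c: "c \<in> A" and X: "X \<in> sets borel" "X \<subseteq> dom_of c"
  obtain N :: nat and cs and P where P: "\<And>a. a < N \<Longrightarrow> cs a \<in> A" "\<And>a. a < N \<Longrightarrow> P a \<in> sets borel"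
    "\<And>a. a < N \<Longrightarrow> P a \<subseteq> dom_of (cs a)" "disjoint_family_on P {..<N}" "(\<Union>a<N. P a) = UNIV"
    by (rule finite_borel_partition) blast
  define Y where "Y a = X \<inter> \<phi> -` P a" for a
  have Yb: "Y a \<in> sets borel" if "a < N" for a
    unfolding Y_def using X(1) measurable_sets[OF inv(2) P(2)[OF that]] by auto
  have XY: "X = (\<Union>a<N. Y a)" unfolding Y_def using P(5) by blast
  have disj: "disjoint_family_on Y {..<N}" using P(4) by (auto simp: disjoint_family_on_def Y_def)
  have piece: "emeasure ?\<nu> (Y a) = (\<integral>\<^sup>+y\<in>coord c ` Y a. ennreal (vol (pullback A \<phi> g) c y) \<partial>lborel)"
    if a: "a < N" for a
  proof -
    have im: "inv \<phi> -` Y a = \<phi> ` Y a" using bij_vimage_eq_inv_image[OF bij_imp_bij_inv[OF bij]] bij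
      by (simp add: inv_inv_eq)
    have b: "\<phi> ` Y a \<in> sets borel"
      using measurable_sets[OF inv(1) Yb[OF a]] by (simp add: im)
    have sub: "\<phi> ` Y a \<subseteq> dom_of (cs a)" "Y a \<subseteq> dom_of c"
      using P(3)[OF a] X(2) by (auto simp: Y_def)
    have "emeasure ?\<nu> (Y a) = emeasure (riemannian_measure A g) (\<phi> ` Y a)"
      using Yb[OF a] mI sets_eq_imp_space_eq[OF sets_riemannian_measure[OF g]]
      by (subst emeasure_distr) (auto simp: im)
    also have "\<dots> = (\<integral>\<^sup>+y\<in>coord (cs a) ` \<phi> ` Y a. ennreal (vol g (cs a) y) \<partial>lborel)"
      using riemannian_measure[OF g] b sub(1) P(1)[OF a] unfolding riemannian_measure_axioms_def by blast
    also have "\<dots> = (\<integral>\<^sup>+y\<in>coord c ` Y a. ennreal (vol (pullback A \<phi> g) c y) \<partial>lborel)"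
    proof (rule nn_integral_vol_transform[OF \<phi> g c P(1)[OF a] Yb[OF a] sub(2,1), symmetric])
      fix x assume "x \<in> Y a"
      then show "pullback A \<phi> g c x =
          transpose (jacobian c (cs a) \<phi> x) ** g (cs a) (\<phi> x) ** jacobian c (cs a) \<phi> x"
        using sub by (intro pullback_eq[OF g sm(1) c _ P(1)[OF a]]) auto
    qed
    finally show ?thesis .
  qed
  note k = pullback_sym_tensor[OF g sm(1)]
  have "emeasure ?\<nu> X = (\<Sum>a<N. emeasure ?\<nu> (Y a))"
    unfolding XY using Yb disj by (intro sum_emeasure[symmetric]) auto
  also have "\<dots> = (\<Sum>a<N. emeasure (chart_measure (pullback A \<phi> g) c) (Y a))"
  proof (rule sum.cong[OF refl])
    fix a assume "a \<in> {..<N}"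
    moreover have "Y a \<inter> dom_of c = Y a" using X(2) by (auto simp: Y_def)
    ultimately show "emeasure ?\<nu> (Y a) = emeasure (chart_measure (pullback A \<phi> g) c) (Y a)"
      by (simp add: piece emeasure_chart_measure[OF k c] Yb)
  qed
  also have "\<dots> = emeasure (chart_measure (pullback A \<phi> g) c) X"
    unfolding XY using Yb disj by (intro sum_emeasure) (auto simp: chart_measure_def)
  also have "\<dots> = (\<integral>\<^sup>+y\<in>coord c ` X. ennreal (vol (pullback A \<phi> g) c y) \<partial>lborel)"
    using X by (simp add: emeasure_chart_measure[OF k c] Int_absorb2)
  finally show "emeasure ?\<nu> X = (\<integral>\<^sup>+y\<in>coord c ` X. ennreal (vol (pullback A \<phi> g) c y) \<partial>lborel)" .
qed

end

section \<open>A smooth bump function\<close>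

lemma poly_exp_tendsto_0:
  fixes p :: "real poly"
  shows "((\<lambda>x. poly p x * exp (- x)) \<longlongrightarrow> 0) at_top"
proof -
  have "((\<lambda>x. \<Sum>i\<le>degree p. coeff p i * (x ^ i / exp x)) \<longlongrightarrow> (\<Sum>i\<le>degree p. coeff p i * 0)) at_top"
    by (intro tendsto_sum tendsto_mult tendsto_const tendsto_power_div_exp_0)
  moreover have "(\<Sum>i\<le>degree p. coeff p i * (x ^ i / exp x)) = poly p x * exp (- x)" for x
    by (simp add: poly_altdef sum_distrib_right exp_minus divide_inverse mult.assoc)
  ultimately show ?thesis by simp
qed

text \<open>The derivatives of \<open>exp (- 1 / t)\<close> are polynomials in \<open>1 / t\<close> times the same exponential,
  and these stay differentiable when continued by 0 to \<open>t \<le> 0\<close>.\<close>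

primrec flat_poly :: "nat \<Rightarrow> real poly" where
  "flat_poly 0 = 1"
| "flat_poly (Suc k) = [:0, 0, 1:] * (flat_poly k - pderiv (flat_poly k))"

definition flat_deriv :: "nat \<Rightarrow> real \<Rightarrow> real" where
  "flat_deriv k t = (if t > 0 then poly (flat_poly k) (inverse t) * exp (- inverse t) else 0)"

lemma flat_deriv: "(flat_deriv k has_real_derivative flat_deriv (Suc k) t) (at t)"
proof -
  consider "t > 0" | "t < 0" | "t = 0" by linarith
  then show ?thesis
  proof cases
    case 1
    have "((\<lambda>t. poly (flat_poly k) (inverse t) * exp (- inverse t)) has_real_derivative
        poly (pderiv (flat_poly k)) (inverse t) * (- (inverse t)\<^sup>2) * exp (- inverse t) +
        exp (- inverse t) * (inverse t)\<^sup>2 * poly (flat_poly k) (inverse t)) (at t)"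
      using 1
      by (auto intro!: derivative_eq_intros DERIV_chain2[OF poly_DERIV] simp: power2_eq_square)
    then have "((\<lambda>t. poly (flat_poly k) (inverse t) * exp (- inverse t)) has_real_derivative
        flat_deriv (Suc k) t) (at t)"
      by (rule DERIV_cong) (use 1 in \<open>simp add: flat_deriv_def algebra_simps power2_eq_square\<close>)
    then show ?thesis
      by (rule has_field_derivative_transform_within_open[of _ _ _ "{0<..}"]) (use 1 in \<open>auto simp: flat_deriv_def\<close>)
  next
    case 2
    have "((\<lambda>t. 0) has_real_derivative 0) (at t)" by simp
    then have "(flat_deriv k has_real_derivative 0) (at t)"
      by (rule has_field_derivative_transform_within_open[of _ _ _ "{..<0}"]) (use 2 in \<open>auto simp: flat_deriv_def\<close>)
    then show ?thesis using 2 by (simp add: flat_deriv_def)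
  next
    case 3
    have "((\<lambda>h. flat_deriv k h / h) \<longlongrightarrow> 0) (at 0)"
    proof (rule filterlim_split_at)
      show "((\<lambda>h. flat_deriv k h / h) \<longlongrightarrow> 0) (at_left 0)"
      proof (rule tendsto_eventually)
        show "\<forall>\<^sub>F h in at_left 0. flat_deriv k h / h = 0"
          by (rule eventually_at_leftI[of "-1"]) (auto simp: flat_deriv_def)
      qed
      have "((\<lambda>x. poly ([:0, 1:] * flat_poly k) x * exp (- x)) \<longlongrightarrow> 0) at_top"
        by (rule poly_exp_tendsto_0)
      then have "((\<lambda>x. flat_deriv k (inverse x) / inverse x) \<longlongrightarrow> 0) at_top"
        by (rule Lim_transform_eventually)
           (auto simp: flat_deriv_def field_simps intro!: eventually_mono[OF eventually_gt_at_top[of 0]])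
      then show "((\<lambda>h. flat_deriv k h / h) \<longlongrightarrow> 0) (at_right 0)"
        by (simp add: filterlim_at_right_to_top)
    qed
    then have "(flat_deriv k has_real_derivative 0) (at 0)"
      unfolding DERIV_def by (simp add: flat_deriv_def[of k 0])
    then show ?thesis using 3 by (simp add: flat_deriv_def[of "Suc k"])
  qed
qed

lemma smooth_on_flat:
  assumes "open U" "smooth_on U f"
  shows "smooth_on U (\<lambda>y. flat_deriv 0 (f y))"
  by (rule smooth_on_compose_real[OF assms(1) _ assms(2), where D = flat_deriv and T = UNIV])
     (auto intro: flat_deriv)

lemma flat_pos: "t > 0 \<Longrightarrow> flat_deriv 0 t > 0"
  by (simp add: flat_deriv_def)

lemma flat_nonneg: "flat_deriv 0 t \<ge> 0"
  by (simp add: flat_deriv_def)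

context closed_manifold
begin

section \<open>Smooth functions on the manifold\<close>

lemma continuous_if_in_charts:
  fixes f :: "'m \<Rightarrow> 'b::topological_space"
  assumes "\<And>c. c \<in> A \<Longrightarrow> continuous_on (img c) (\<lambda>y. f (coord_inv c y))"
  shows "continuous_on UNIV f"
proof -
  have "continuous_on (\<Union> (dom_of ` A)) f"
  proof (rule continuous_on_open_Union)
    fix X assume "X \<in> dom_of ` A"
    then obtain c where c: "c \<in> A" "X = dom_of c" by auto
    show "open X" using c chart(1) by simp
    have "continuous_on X (\<lambda>x. f (coord_inv c (coord c x)))"
      unfolding c(2) by (rule continuous_on_compose2[OF assms[OF c(1)] chart(6)[OF c(1)]]) simp
    then show "continuous_on X f"
      by (rule continuous_on_eq) (simp add: c chart(3)[OF c(1)])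
  qed
  moreover have "\<Union> (dom_of ` A) = UNIV" using charts_cover by blast
  ultimately show ?thesis by simp
qed

lemma smooth_functionsD: "f \<in> smooth_functions A \<Longrightarrow> c \<in> A \<Longrightarrow> smooth_on (img c) (\<lambda>y. f (coord_inv c y))"
  by (auto simp: smooth_functions_def o_def)

lemma smooth_functionsI:
  "(\<And>c. c \<in> A \<Longrightarrow> smooth_on (img c) (\<lambda>y. f (coord_inv c y))) \<Longrightarrow> f \<in> smooth_functions A"
  by (auto simp: smooth_functions_def o_def)

lemma smooth_function_continuous: "f \<in> smooth_functions A \<Longrightarrow> continuous_on UNIV f"
  by (rule continuous_if_in_charts) (rule smooth_on_continuous[OF smooth_functionsD])

lemma smooth_function_measurable: "f \<in> smooth_functions A \<Longrightarrow> f \<in> borel_measurable borel"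
  by (rule borel_measurable_continuous_onI[OF smooth_function_continuous])

lemma smooth_function_const: "(\<lambda>_. r) \<in> smooth_functions A"
  by (intro smooth_functionsI smooth_on_const)

lemma smooth_function_add:
  "f \<in> smooth_functions A \<Longrightarrow> g \<in> smooth_functions A \<Longrightarrow> (\<lambda>x. f x + g x) \<in> smooth_functions A"
  by (rule smooth_functionsI) (intro smooth_on_add smooth_functionsD chart(2))

lemma smooth_function_mult:
  "f \<in> smooth_functions A \<Longrightarrow> g \<in> smooth_functions A \<Longrightarrow> (\<lambda>x. f x * g x) \<in> smooth_functions A"
  by (rule smooth_functionsI) (intro smooth_on_mult smooth_functionsD chart(2))

lemma smooth_function_exp:
  "f \<in> smooth_functions A \<Longrightarrow> (\<lambda>x. exp (f x)) \<in> smooth_functions A"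
  by (rule smooth_functionsI) (intro smooth_on_exp smooth_functionsD chart(2))

lemma coord_image_diff_compact:
  assumes c: "c \<in> A" "c' \<in> A" and K: "compact K" "K \<subseteq> img c"
  shows "open (coord c' ` (dom_of c' - coord_inv c ` K))"
    "img c' = expr_dom c' c id \<union> coord c' ` (dom_of c' - coord_inv c ` K)"
proof -
  have "closed (coord_inv c ` K)"
    by (intro compact_imp_closed compact_coord_inv_image c K)
  then show "open (coord c' ` (dom_of c' - coord_inv c ` K))"
    using c chart(1)[OF c(2)] by (intro open_coord_image) auto
  show "img c' = expr_dom c' c id \<union> coord c' ` (dom_of c' - coord_inv c ` K)"
  proof -
    have "dom_of c' = (dom_of c' \<inter> id -` dom_of c) \<union> (dom_of c' - coord_inv c ` K)"
      using K(2) chart(5)[OF c(1)] by auto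
    from arg_cong[OF this, of "(`) (coord c')"] show ?thesis
      unfolding image_Un expr_dom_def .
  qed
qed

text \<open>A compact set is closed in the Hausdorff space \<open>'m\<close>, so the chart domain and the complement of
  the support form an open cover, and the extension by zero is smooth on both sets.\<close>

lemma smooth_function_extension:
  fixes u :: "real^'n \<Rightarrow> real"
  assumes c: "c \<in> A" and K: "compact K" "K \<subseteq> img c"
    and u: "smooth_on (img c) u" "\<And>y. y \<in> img c \<Longrightarrow> y \<notin> K \<Longrightarrow> u y = 0"
  shows "(\<lambda>x. if x \<in> dom_of c then u (coord c x) else 0) \<in> smooth_functions A"
proof (rule smooth_functionsI)
  fix c' assume c': "c' \<in> A"
  let ?f = "\<lambda>y. if coord_inv c' y \<in> dom_of c then u (coord c (coord_inv c' y)) else 0"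
  note E = expr_dom[OF smooth_map_id c' c]
  have "smooth_on (expr_dom c' c id) (\<lambda>y. u (local_expr c' c id y))"
    by (rule smooth_on_compose[OF E(1) u(1) E(2)]) (use c' in \<open>auto simp: expr_dom_def local_expr_coord\<close>)
  also have "?this \<longleftrightarrow> smooth_on (expr_dom c' c id) ?f"
    by (rule smooth_on_cong[OF E(1)]) (use c' in \<open>auto simp: expr_dom_def local_expr_coord chart(3)\<close>)
  finally have 1: "smooth_on (expr_dom c' c id) ?f" .
  have "smooth_on (coord c' ` (dom_of c' - coord_inv c ` K)) (\<lambda>y. 0 :: real)"
    by (rule smooth_on_const)
  also have "?this \<longleftrightarrow> smooth_on (coord c' ` (dom_of c' - coord_inv c ` K)) ?f"
  proof (rule smooth_on_cong[OF coord_image_diff_compact(1)[OF c c' K]])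
    fix y assume "y \<in> coord c' ` (dom_of c' - coord_inv c ` K)"
    then obtain x where x: "x \<in> dom_of c'" "x \<notin> coord_inv c ` K" "y = coord c' x" by auto
    have "u (coord c x) = 0" if "x \<in> dom_of c"
    proof (rule u(2)[OF imageI[OF that]])
      show "coord c x \<notin> K" using x(2) chart(3)[OF c that] by (metis image_eqI)
    qed
    then show "0 = ?f y" using x chart(3)[OF c'] by auto
  qed
  finally show "smooth_on (img c') ?f"
    unfolding coord_image_diff_compact(2)[OF c c' K] using 1 by (intro smooth_on_Un)
qed

text \<open>Every point has a chart around it and a bump function in this chart that is positive at the point.
  By compactness finitely many of these bump functions have a positive sum, and division by the sum
  gives the partition. It is indexed by the points that were selected.\<close>

lemma partition_of_unity:
  obtains F :: "'m set" and cs :: "'m \<Rightarrow> ('m, 'n) chart" and K :: "'m \<Rightarrow> (real^'n) set"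
    and \<psi> :: "'m \<Rightarrow> 'm \<Rightarrow> real"
  where "finite F" "\<And>a. cs a \<in> A" "\<And>a. compact (K a)" "\<And>a. K a \<subseteq> img (cs a)"
    "\<And>a. \<psi> a \<in> smooth_functions A" "\<And>a x. x \<notin> coord_inv (cs a) ` K a \<Longrightarrow> \<psi> a x = 0"
    "\<And>x. (\<Sum>a\<in>F. \<psi> a x) = 1"
proof -
  have "\<exists>c r. c \<in> A \<and> a \<in> dom_of c \<and> r > 0 \<and> cball (coord c a) r \<subseteq> img c" for a
  proof -
    obtain c where c: "c \<in> A" "a \<in> dom_of c" by (rule charts_cover)
    from bspec[OF chart(2)[OF c(1), unfolded open_contains_cball] imageI[OF c(2)]]
    obtain r where "r > 0" "cball (coord c a) r \<subseteq> img c" by (elim exE conjE)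
    with c show ?thesis by (intro exI conjI)
  qed
  then have "\<forall>a. \<exists>c r. c \<in> A \<and> a \<in> dom_of c \<and> r > 0 \<and> cball (coord c a) r \<subseteq> img c" by blast
  from choice[OF this] obtain cs where "\<forall>a. \<exists>r. cs a \<in> A \<and> a \<in> dom_of (cs a) \<and> r > 0 \<and>
      cball (coord (cs a) a) r \<subseteq> img (cs a)" by blast
  from choice[OF this] obtain r :: "'m \<Rightarrow> real" where "\<forall>a. cs a \<in> A \<and> a \<in> dom_of (cs a) \<and> r a > 0 \<and>
      cball (coord (cs a) a) (r a) \<subseteq> img (cs a)" by blast
  then have cr: "\<And>a. cs a \<in> A" "\<And>a. a \<in> dom_of (cs a)" "\<And>a. r a > 0"
    "\<And>a. cball (coord (cs a) a) (r a) \<subseteq> img (cs a)" by blast+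
  define K where "K a = cball (coord (cs a) a) (r a)" for a
  have K: "compact (K a)" "K a \<subseteq> img (cs a)" for a using cr(4) by (auto simp: K_def)
  define u where "u a y = flat_deriv 0 ((r a)\<^sup>2 - (y - coord (cs a) a) \<bullet> (y - coord (cs a) a))" for a y
  have u0: "u a y = 0" if "y \<notin> K a" for a y
  proof -
    have "r a < norm (y - coord (cs a) a)"
      using that by (simp add: K_def dist_norm norm_minus_commute)
    then have "(r a)\<^sup>2 < (norm (y - coord (cs a) a))\<^sup>2"
      using cr(3)[of a] by (intro power_strict_mono) auto
    then show ?thesis by (simp add: u_def flat_deriv_def dot_square_norm)
  qed
  have usm: "smooth_on (img (cs a)) (u a)" for a
    unfolding u_def
    by (intro smooth_on_flat smooth_on_diff smooth_on_bilinear[OF bounded_bilinear_inner]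
        smooth_on_const smooth_on_ident chart(2) cr)
  define \<beta> where "\<beta> a x = (if x \<in> dom_of (cs a) then u a (coord (cs a) x) else 0)" for a x
  have \<beta>: "\<beta> a \<in> smooth_functions A" for a
    unfolding \<beta>_def using smooth_function_extension[OF cr(1) K usm u0] by blast
  have \<beta>0: "\<beta> a x = 0" if "x \<notin> coord_inv (cs a) ` K a" for a x
  proof (cases "x \<in> dom_of (cs a)")
    case True
    then have "coord (cs a) x \<notin> K a"
      using that chart(3)[OF cr(1) True] by (metis image_eqI)
    then show ?thesis by (simp add: \<beta>_def u0)
  qed (simp add: \<beta>_def)
  have \<beta>nn: "\<beta> a x \<ge> 0" for a x by (simp add: \<beta>_def u_def flat_nonneg)
  have \<beta>pos: "\<beta> a a > 0" for a
    using cr(2,3)[of a] by (simp add: \<beta>_def u_def flat_pos)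
  have op: "open {x. \<beta> a x > 0}" for a
    using open_Collect_less[OF continuous_on_const smooth_function_continuous[OF \<beta>]] by simp
  have cov: "(UNIV :: 'm set) \<subseteq> (\<Union>a\<in>UNIV. {x. \<beta> a x > 0})" using \<beta>pos by auto
  obtain F where F: "finite F" "(UNIV :: 'm set) \<subseteq> (\<Union>a\<in>F. {x. \<beta> a x > 0})"
    by (rule compactE_image[OF compact_UNIV op cov])
  define s where "s x = (\<Sum>a\<in>F. \<beta> a x)" for x
  have spos: "s x > 0" for x
  proof -
    obtain a where "a \<in> F" "\<beta> a x > 0" using F(2) by blast
    then show ?thesis unfolding s_def using F(1) \<beta>nn by (intro sum_pos2) auto
  qed
  define \<psi> where "\<psi> a x = \<beta> a x * inverse (s x)" for a x
  show ?thesis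
  proof (rule that[of F cs K \<psi>])
    show "\<psi> a \<in> smooth_functions A" for a
    proof (rule smooth_functionsI)
      fix c assume c: "c \<in> A"
      have "s (coord_inv c y) \<noteq> 0" for y using spos[of "coord_inv c y"] by simp
      then show "smooth_on (img c) (\<lambda>y. \<psi> a (coord_inv c y))"
        unfolding \<psi>_def using chart(2)[OF c] smooth_functionsD[OF \<beta> c]
        by (intro smooth_on_mult smooth_on_inverse) (auto simp: s_def intro!: smooth_on_sum)
    qed
    show "\<psi> a x = 0" if "x \<notin> coord_inv (cs a) ` K a" for a x
      using \<beta>0[OF that] by (simp add: \<psi>_def)
    show "(\<Sum>a\<in>F. \<psi> a x) = 1" for x
      using spos[of x] by (simp add: \<psi>_def sum_distrib_right[symmetric] s_def[symmetric])
  qed (use F cr K in auto)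
qed

lemma integrable_supported_in_chart:
  fixes f :: "'m \<Rightarrow> real"
  assumes g: "g \<in> metrics A" and c: "c \<in> A" and f: "continuous_on UNIV f"
    and K: "compact K" "K \<subseteq> img c" and supp: "\<And>x. x \<notin> coord_inv c ` K \<Longrightarrow> f x = 0"
  shows "integrable (riemannian_measure A g) f"
    and "integral\<^sup>L (riemannian_measure A g) f = (\<integral>y. indicator K y * (f (coord_inv c y) * vol g c y) \<partial>lborel)"
proof -
  have f0: "f x = 0" if "x \<notin> dom_of c" for x
    using that K(2) chart(5)[OF c] by (intro supp) auto
  have e: "indicator (img c) y * (f (coord_inv c y) * vol g c y) =
      indicator K y * (f (coord_inv c y) * vol g c y)" for y
  proof (cases "y \<in> img c \<and> y \<notin> K")
    case True
    have "coord_inv c y \<notin> coord_inv c ` K"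
    proof
      assume "coord_inv c y \<in> coord_inv c ` K"
      then obtain z where z: "z \<in> K" "coord_inv c y = coord_inv c z" by blast
      then have "coord c (coord_inv c y) = coord c (coord_inv c z)" by simp
      then have "y = z"
        unfolding chart(4)[OF c conjunct1[OF True]] chart(4)[OF c subsetD[OF K(2) z(1)]] .
      then show False using z(1) True by blast
    qed
    then show ?thesis by (simp add: supp)
  next
    case False
    then have "y \<in> img c \<longleftrightarrow> y \<in> K" using K(2) by blast
    then show ?thesis by (simp add: indicator_def)
  qed
  have "continuous_on K (\<lambda>y. f (coord_inv c y) * vol g c y)"
    using K(2) by (intro continuous_on_mult continuous_on_compose2[OF f]
        continuous_on_subset[OF chart(7)[OF c]] continuous_on_subset[OF vol_continuous[OF _ c]]
        metrics_sym_tensors[OF g]) auto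
  from borel_integrable_compact[OF K(1) this] have int: "integrable lborel (\<lambda>y. indicator K y * (f (coord_inv c y) * vol g c y))" by simp
  have "integral\<^sup>L (riemannian_measure A g) f =
      (\<integral>y. indicator (img c) y * (f (coord_inv c y) * vol g c y) \<partial>lborel)"
    by (rule integral_in_chart(1)[OF g c borel_measurable_continuous_onI[OF f]]) (rule f0)
  then show "integral\<^sup>L (riemannian_measure A g) f =
      (\<integral>y. indicator K y * (f (coord_inv c y) * vol g c y) \<partial>lborel)"
    by (simp only: e)
  have "integrable (riemannian_measure A g) f \<longleftrightarrow>
      integrable lborel (\<lambda>y. indicator (img c) y * (f (coord_inv c y) * vol g c y))"
    by (rule integral_in_chart(2)[OF g c borel_measurable_continuous_onI[OF f]]) (rule f0)
  then show "integrable (riemannian_measure A g) f"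
    using int by (simp only: e)
qed

section \<open>Scaling a metric by a positive function\<close>

lemma tensor_scale_sym_tensor:
  assumes "f \<in> smooth_functions A" "h \<in> sym_tensors A"
  shows "tensor_scale f h \<in> sym_tensors A"
  unfolding sym_tensors_def mem_Collect_eq
proof (intro conjI allI ballI impI)
  show "tensor_scale f h c x = 0" if "c \<notin> A \<or> x \<notin> dom_of c" for c x
    using sym_tensorsD(1)[OF assms(2) that] by (simp add: tensor_scale_def)
  show "transpose (tensor_scale f h c x) = tensor_scale f h c x" if "c \<in> A" "x \<in> dom_of c" for c x
    using sym_tensorsD(2)[OF assms(2) that] by (simp add: tensor_scale_def transpose_scalar)
  show "tensor_scale f h c x = transpose (jacobian c c' id x) ** tensor_scale f h c' x ** jacobian c c' id x"
    if "c \<in> A" "c' \<in> A" "x \<in> dom_of c \<inter> dom_of c'" for c c' x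
    using sym_tensorsD(3)[OF assms(2) that(1,2), of x] that(3)
    by (simp add: tensor_scale_def matrix_scalar_ac scalar_matrix_assoc[symmetric])
  show "smooth_on (img c) (tensor_scale f h c \<circ> coord_inv c)" if "c \<in> A" for c
    unfolding tensor_scale_def o_def
    by (intro smooth_on_scaleR chart(2) that smooth_functionsD assms sym_tensorsD(4))
qed

lemma tensor_scale_metric:
  assumes "f \<in> smooth_functions A" "g \<in> metrics A" "\<And>x. f x > 0"
  shows "tensor_scale f g \<in> metrics A"
proof -
  have "v \<bullet> (tensor_scale f g c x *v v) = f x * (v \<bullet> (g c x *v v))" for c x v
    by (simp add: tensor_scale_def scaleR_matrix_vector_assoc[symmetric])
  then show ?thesis
    using assms tensor_scale_sym_tensor[OF assms(1) metrics_sym_tensors[OF assms(2)]]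
    by (simp add: metrics_def)
qed

text \<open>The factor is \<open>a ^ n\<close> because \<open>det (a\<^sup>2 G) = (a ^ n)\<^sup>2 det G\<close>.\<close>

lemma riemannian_measure_scale:
  assumes g: "g \<in> metrics A" and a: "a > 0"
  shows "riemannian_measure A (tensor_scale (\<lambda>_. a\<^sup>2) g) =
    density (riemannian_measure A g) (\<lambda>_. ennreal (a ^ CARD('n)))"
proof (rule riemannian_measure_eqI, unfold riemannian_measure_axioms_def, intro conjI ballI impI)
  note gs = metrics_sym_tensors[OF g]
  show "sets (density (riemannian_measure A g) (\<lambda>_. ennreal (a ^ CARD('n)))) = sets borel"
    using gs by simp
  fix c and E :: "'m set" assume c: "c \<in> A" and E: "E \<in> sets borel" "E \<subseteq> dom_of c"
  have v: "vol (tensor_scale (\<lambda>_. a\<^sup>2) g) c y = a ^ CARD('n) * vol g c y" for y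
  proof -
    have "a\<^sup>2 *\<^sub>R G = (a\<^sup>2 *\<^sub>R mat 1) ** G" for G :: "real^'n^'n"
      by (simp add: scalar_matrix_assoc[symmetric])
    moreover have "det (a\<^sup>2 *\<^sub>R mat 1 :: real^'n^'n) = (a\<^sup>2) ^ CARD('n)"
      by (subst det_diagonal) (auto simp: mat_def)
    ultimately have "det (a\<^sup>2 *\<^sub>R G) = (a ^ CARD('n))\<^sup>2 * det G" for G :: "real^'n^'n"
      by (metis det_mul power_mult mult.commute)
    then show ?thesis using a by (simp add: vol_def tensor_scale_def real_sqrt_mult)
  qed
  have B: "coord c ` E \<in> sets borel"
    by (rule image_borel_of_continuous_inverse[OF chart(1,2,7,3)[OF c] E])
  note [measurable] = vol_measurable[OF gs c] B
  have sub: "coord c ` E \<subseteq> img c" using E(2) by auto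
  have ind: "(\<integral>\<^sup>+y\<in>coord c ` E. ennreal (r * vol g c y) \<partial>lborel) =
      (\<integral>\<^sup>+y. ennreal r * (ennreal (indicator (img c) y * vol g c y) * indicator (coord c ` E) y) \<partial>lborel)"
    if "r \<ge> 0" for r
    using that sub by (intro nn_integral_cong) (auto simp: indicator_def ennreal_mult')
  have "emeasure (density (riemannian_measure A g) (\<lambda>_. ennreal (a ^ CARD('n)))) E =
      ennreal (a ^ CARD('n)) * emeasure (riemannian_measure A g) E"
    using E gs by (intro emeasure_density_const) simp
  also have "emeasure (riemannian_measure A g) E = (\<integral>\<^sup>+y\<in>coord c ` E. ennreal (1 * vol g c y) \<partial>lborel)"
    using riemannian_measure[OF gs] E c unfolding riemannian_measure_axioms_def by simp
  also have "ennreal (a ^ CARD('n)) * \<dots> = (\<integral>\<^sup>+y\<in>coord c ` E. ennreal (a ^ CARD('n) * vol g c y) \<partial>lborel)"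
    using a by (subst (1 2) ind) (auto simp: nn_integral_cmult)
  finally show "emeasure (density (riemannian_measure A g) (\<lambda>_. ennreal (a ^ CARD('n)))) E =
      (\<integral>\<^sup>+y\<in>coord c ` E. ennreal (vol (tensor_scale (\<lambda>_. a\<^sup>2) g) c y) \<partial>lborel)"
    by (simp add: v)
qed

end

section \<open>Integration by parts\<close>

text \<open>The function vanishes everywhere outside the compact set, also outside \<open>U\<close>, so that its integral over
  the whole space is the integral over \<open>U\<close>.\<close>

definition compactly_supported :: "(real^'n::finite) set \<Rightarrow> (real^'n \<Rightarrow> real) \<Rightarrow> bool" where
  "compactly_supported U f \<longleftrightarrow>
     smooth_on U f \<and> (\<exists>K. compact K \<and> K \<subseteq> U \<and> (\<forall>y. y \<notin> K \<longrightarrow> f y = 0))"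

lemma compactly_supported_smooth_UNIV:
  assumes "open U" "compactly_supported U f"
  shows "smooth_on UNIV f"
proof -
  obtain K where K: "smooth_on U f" "compact K" "K \<subseteq> U" "\<And>y. y \<notin> K \<Longrightarrow> f y = 0"
    using assms by (auto simp: compactly_supported_def)
  have "open (- K)" using compact_imp_closed[OF K(2)] by (simp add: open_Compl)
  then have "smooth_on (- K) f"
    using smooth_on_cong[of "- K" f "\<lambda>_. 0"] K(4) smooth_on_const by auto
  then have "smooth_on (U \<union> - K) f" by (intro smooth_on_Un K)
  moreover have "U \<union> - K = UNIV" using K(3) by auto
  ultimately show ?thesis by simp
qed

lemma compactly_supported_mult:
  assumes "open U" "compactly_supported U f" "smooth_on U u"
  shows "compactly_supported U (\<lambda>y. f y * u y)"
proof -
  obtain K where K: "smooth_on U f" "compact K" "K \<subseteq> U" "\<And>y. y \<notin> K \<Longrightarrow> f y = 0"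
    using assms(2) unfolding compactly_supported_def by blast
  have "smooth_on U (\<lambda>y. f y * u y)" by (rule smooth_on_mult[OF assms(1) K(1) assms(3)])
  then show ?thesis unfolding compactly_supported_def using K(2-4) by (metis mult_zero_left)
qed

lemma compactly_supported_zero: "compactly_supported U (\<lambda>_. 0)"
  unfolding compactly_supported_def by (auto intro!: smooth_on_const exI[of _ "{}"])

lemma compactly_supported_add:
  assumes "open U" "compactly_supported U f" "compactly_supported U g"
  shows "compactly_supported U (\<lambda>y. f y + g y)"
proof -
  obtain K L where "compact K" "K \<subseteq> U" "\<And>y. y \<notin> K \<Longrightarrow> f y = 0"
    "compact L" "L \<subseteq> U" "\<And>y. y \<notin> L \<Longrightarrow> g y = 0"
    using assms(2,3) unfolding compactly_supported_def by blast
  then have "compact (K \<union> L) \<and> K \<union> L \<subseteq> U \<and> (\<forall>y. y \<notin> K \<union> L \<longrightarrow> f y + g y = 0)" by auto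
  moreover have "smooth_on U (\<lambda>y. f y + g y)"
    using assms by (intro smooth_on_add) (auto simp: compactly_supported_def)
  ultimately show ?thesis unfolding compactly_supported_def by blast
qed

lemma compactly_supported_sum:
  assumes "open U" "\<And>i. i \<in> I \<Longrightarrow> compactly_supported U (f i)"
  shows "compactly_supported U (\<lambda>y. \<Sum>i\<in>I. f i y)"
  using assms(2)
  by (induction I rule: infinite_finite_induct)
     (auto intro!: compactly_supported_zero compactly_supported_add assms(1))

lemma compactly_supported_partial_deriv:
  assumes "open U" "compactly_supported U f"
  shows "compactly_supported U (partial_deriv i f)"
proof -
  obtain K where K: "smooth_on U f" "compact K" "K \<subseteq> U" "\<And>y. y \<notin> K \<Longrightarrow> f y = 0"
    using assms by (auto simp: compactly_supported_def)
  have "open (- K)" using compact_imp_closed[OF K(2)] by (simp add: open_Compl)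
  then have "partial_deriv i f y = partial_deriv i (\<lambda>_. 0) y" if "y \<notin> K" for y
    using differentiable_cong_open(2)[of "- K" f "\<lambda>_. 0" y i] K(4) that by auto
  moreover have "partial_deriv i (\<lambda>_. 0 :: real) y = 0" for y
    by (intro partial_deriv_eqI has_derivative_const)
  ultimately show ?thesis
    unfolding compactly_supported_def using K(2,3) smooth_on_partial_deriv[OF K(1), of i] by metis
qed

lemma compactly_supported_integrable:
  assumes "open U" "compactly_supported U f"
  shows "integrable lborel f"
proof -
  obtain K where K: "smooth_on U f" "compact K" "K \<subseteq> U" "\<And>y. y \<notin> K \<Longrightarrow> f y = 0"
    using assms by (auto simp: compactly_supported_def)
  have "integrable lborel (\<lambda>y. indicator K y *\<^sub>R f y)"
    using K continuous_on_subset[OF smooth_on_continuous] by (intro borel_integrable_compact) auto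
  also have "(\<lambda>y. indicator K y *\<^sub>R f y) = f" using K(4) by (auto simp: fun_eq_iff indicator_def)
  finally show ?thesis .
qed

text \<open>The difference quotients in direction \<open>e\<^sub>i\<close> have integral 0, since Lebesgue measure is invariant
  under translations; they are bounded and supported in one fixed compact set.\<close>

lemma integral_partial_deriv_zero:
  fixes f :: "real^'n::finite \<Rightarrow> real"
  assumes U: "open U" and f: "compactly_supported U f"
  shows "(\<integral>y. partial_deriv i f y \<partial>lborel) = 0"
proof -
  note sm = compactly_supported_smooth_UNIV[OF U f]
  define e where "e = (axis i 1 :: real^'n)"
  have ne: "norm e = 1" by (simp add: e_def)
  obtain K where K: "compact K" "\<And>y. y \<notin> K \<Longrightarrow> f y = 0"
    using f by (auto simp: compactly_supported_def)
  obtain R where R: "\<And>y. y \<in> K \<Longrightarrow> norm y \<le> R"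
    using compact_imp_bounded[OF K(1)] by (auto simp: bounded_iff)
  define d where "d = partial_deriv i f"
  have der: "((\<lambda>s. f (y + s *\<^sub>R e)) has_real_derivative d (y + s *\<^sub>R e)) (at s)" for y s
  proof -
    have "(f has_derivative frechet_derivative f (at (y + s *\<^sub>R e))) (at (y + s *\<^sub>R e))"
      using smooth_on_differentiable[OF sm] by (intro differentiable_has_derivative) auto
    moreover have "((\<lambda>s. y + s *\<^sub>R e) has_derivative (\<lambda>t. t *\<^sub>R e)) (at s)"
      by (auto intro!: derivative_eq_intros)
    ultimately have h: "((\<lambda>s. f (y + s *\<^sub>R e)) has_derivative
        (\<lambda>t. frechet_derivative f (at (y + s *\<^sub>R e)) (t *\<^sub>R e))) (at s)"
      using has_derivative_compose by blast
    have "linear (frechet_derivative f (at (y + s *\<^sub>R e)))"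
      using smooth_on_differentiable[OF sm] by (intro linear_frechet_derivative) auto
    then have "frechet_derivative f (at (y + s *\<^sub>R e)) (t *\<^sub>R e) = d (y + s *\<^sub>R e) * t" for t
      by (simp add: linear_scale d_def partial_deriv_def e_def)
    with h show ?thesis by (simp add: has_field_derivative_def)
  qed
  have cd: "continuous_on UNIV d"
    unfolding d_def by (intro smooth_on_continuous smooth_on_partial_deriv sm)
  have cf: "continuous_on UNIV f" by (intro smooth_on_continuous sm)
  \<comment> \<open>Steps have length at most 1: a difference quotient vanishes unless \<open>norm y \<le> R + 1\<close>, and it is
    then a value of the derivative at distance at most \<open>R + 2\<close> from the origin.\<close>
  have "bounded (d ` cball 0 (R + 2))"
    by (intro compact_imp_bounded compact_continuous_image continuous_on_subset[OF cd]) auto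
  then obtain M where "\<forall>x\<in>d ` cball 0 (R + 2). norm x \<le> M"
    unfolding bounded_iff by blast
  then have M: "\<bar>d y\<bar> \<le> M" if "norm y \<le> R + 2" for y using that by simp
  define q where "q k y = (f (y + inverse (real (Suc k)) *\<^sub>R e) - f y) / inverse (real (Suc k))" for k y
  have q0: "(\<integral>y. q k y \<partial>lborel) = 0" for k
  proof -
    define s where "s = inverse (real (Suc k)) *\<^sub>R e"
    have i: "integrable lborel f" by (rule compactly_supported_integrable[OF U f])
    have "(\<integral>y. f y \<partial>lborel) = (\<integral>y. f y \<partial>distr lborel borel ((+) s))" by (simp add: lborel_distr_plus)
    also have "\<dots> = (\<integral>y. f (s + y) \<partial>lborel)"
      using borel_measurable_continuous_onI[OF cf] by (intro integral_distr) auto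
    finally have e1: "(\<integral>y. f (y + s) \<partial>lborel) = (\<integral>y. f y \<partial>lborel)" by (simp add: add.commute)
    have "integrable (distr lborel borel ((+) s)) f" using i by (simp add: lborel_distr_plus)
    then have "integrable lborel (\<lambda>y. f (y + s))"
      using borel_measurable_continuous_onI[OF cf]
      by (subst (asm) integrable_distr_eq) (auto simp: add.commute)
    with i e1 show ?thesis by (simp add: q_def s_def)
  qed
  have "(\<lambda>k. \<integral>y. q k y \<partial>lborel) \<longlonglongrightarrow> (\<integral>y. d y \<partial>lborel)"
  proof (rule integral_dominated_convergence[where w = "\<lambda>y. indicator (cball 0 (R + 1)) y * \<bar>M\<bar>"])
    show "d \<in> borel_measurable lborel" using borel_measurable_continuous_onI[OF cd] by simp
    have [measurable]: "f \<in> borel_measurable borel" by (rule borel_measurable_continuous_onI[OF cf])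
    show "q k \<in> borel_measurable lborel" for k unfolding q_def by measurable
    have "integrable lborel (\<lambda>y :: real^'n. indicator (cball 0 (R + 1)) y *\<^sub>R \<bar>M\<bar>)"
      by (intro borel_integrable_compact compact_cball continuous_on_const)
    then show "integrable lborel (\<lambda>y :: real^'n. indicator (cball 0 (R + 1)) y * \<bar>M\<bar>)" by simp
    show "AE y in lborel. (\<lambda>k. q k y) \<longlonglongrightarrow> d y"
    proof (rule AE_I2)
      fix y
      have "((\<lambda>h. (f (y + h *\<^sub>R e) - f y) / h) \<longlongrightarrow> d y) (at 0)"
        using der[of y 0] by (simp add: DERIV_def)
      moreover have "filterlim (\<lambda>k. inverse (real (Suc k))) (at 0) sequentially"
        unfolding filterlim_at using LIMSEQ_inverse_real_of_nat by auto
      ultimately show "(\<lambda>k. q k y) \<longlonglongrightarrow> d y"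
        unfolding q_def by (rule filterlim_compose)
    qed
    show "AE y in lborel. norm (q k y) \<le> indicator (cball 0 (R + 1)) y * \<bar>M\<bar>" for k
    proof (rule AE_I2)
      fix y
      define t where "t = inverse (real (Suc k))"
      have t: "0 < t" "t \<le> 1" by (simp_all add: t_def inverse_eq_divide)
      have qt: "q k y = (f (y + t *\<^sub>R e) - f y) / t" by (simp only: q_def t_def)
      show "norm (q k y) \<le> indicator (cball 0 (R + 1)) y * \<bar>M\<bar>"
      proof (cases "norm y \<le> R + 1")
        case True
        obtain s where s: "0 < s" "s < t" "f (y + t *\<^sub>R e) - f (y + 0 *\<^sub>R e) = (t - 0) * d (y + s *\<^sub>R e)"
          using MVT2[OF t(1), of "\<lambda>s. f (y + s *\<^sub>R e)" "\<lambda>s. d (y + s *\<^sub>R e)"] der by blast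
        have "q k y = d (y + s *\<^sub>R e)" using s(3) t by (simp add: qt)
        moreover have "norm (y + s *\<^sub>R e) \<le> R + 2"
          using norm_triangle_ineq[of y "s *\<^sub>R e"] True s t by (simp add: ne)
        then have "\<bar>d (y + s *\<^sub>R e)\<bar> \<le> M" by (rule M)
        ultimately show ?thesis using True by simp
      next
        case False
        have "norm y \<le> norm (y + t *\<^sub>R e) + t"
          using norm_triangle_ineq4[of "y + t *\<^sub>R e" "t *\<^sub>R e"] t by (simp add: ne)
        then have "\<not> norm (y + t *\<^sub>R e) \<le> R" using False t by linarith
        moreover have "\<not> norm y \<le> R" using False by linarith
        ultimately have "f (y + t *\<^sub>R e) = 0" "f y = 0" using R K(2) by metis+
        then show ?thesis by (simp add: qt)
      qed
    qed
  qed
  then show ?thesis using LIMSEQ_unique[OF _ tendsto_const[of 0]] by (simp add: q0 d_def)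
qed

text \<open>The partial derivative of the product \<open>f u\<close> has integral 0.\<close>

lemma integration_by_parts:
  fixes f u :: "real^'n::finite \<Rightarrow> real"
  assumes U: "open U" and f: "compactly_supported U f" and u: "smooth_on U u"
  shows "(\<integral>y. f y * partial_deriv i u y \<partial>lborel) = (\<integral>y. - partial_deriv i f y * u y \<partial>lborel)"
proof -
  note fu = compactly_supported_mult[OF U f u]
  have "partial_deriv i (\<lambda>y. f y * u y) y = f y * partial_deriv i u y + partial_deriv i f y * u y" for y
  proof (cases "y \<in> U")
    case True
    then show ?thesis
      using f u by (intro partial_deriv_bilinear[OF bounded_bilinear_mult] smooth_on_differentiable[of U])
        (auto simp: compactly_supported_def)
  next
    case False
    then show ?thesis
      using f fu compactly_supported_partial_deriv[OF U f, of i] compactly_supported_partial_deriv[OF U fu, of i]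
      unfolding compactly_supported_def by (metis add_0 mult_zero_left subsetD)
  qed
  then have "0 = (\<integral>y. f y * partial_deriv i u y + partial_deriv i f y * u y \<partial>lborel)"
    using integral_partial_deriv_zero[OF U fu, of i] by simp
  also have "\<dots> = (\<integral>y. f y * partial_deriv i u y \<partial>lborel) + (\<integral>y. partial_deriv i f y * u y \<partial>lborel)"
    using U f u
    by (intro Bochner_Integration.integral_add compactly_supported_integrable[OF U]
        compactly_supported_mult compactly_supported_partial_deriv smooth_on_partial_deriv)
  finally show ?thesis by simp
qed

text \<open>Linear differential operators on matrix fields enter only through the property that they
  can be moved to the other factor under the integral. This property is preserved by the
  operations from which the linearisation of a natural invariant is built.\<close>

definition has_adjoint ::
    "(real^'n::finite) set \<Rightarrow> ((real^'n \<Rightarrow> real^'k^'k) \<Rightarrow> real^'n \<Rightarrow> real) \<Rightarrow> bool" where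
  "has_adjoint U D \<longleftrightarrow>
     (\<forall>H. smooth_on U H \<longrightarrow> smooth_on U (D H)) \<and>
     (\<forall>f. compactly_supported U f \<longrightarrow>
        (\<exists>e. (\<forall>i j. compactly_supported U (e i j)) \<and>
          (\<forall>H. smooth_on U H \<longrightarrow>
             (\<integral>y. f y * D H y \<partial>lborel) = (\<integral>y. (\<Sum>i\<in>UNIV. \<Sum>j\<in>UNIV. e i j y * H y $ i $ j) \<partial>lborel))))"

lemma smooth_on_entry: "open U \<Longrightarrow> smooth_on U H \<Longrightarrow> smooth_on U (\<lambda>y. H y $ i $ j)"
  by (simp add: smooth_on_vec_iff)

lemma has_adjoint_entry:
  assumes U: "open U"
  shows "has_adjoint U (\<lambda>H y. H y $ i $ j)"
  unfolding has_adjoint_def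
proof (intro conjI allI impI)
  show "smooth_on U (\<lambda>y. H y $ i $ j)" if "smooth_on U H" for H :: "real^'a \<Rightarrow> real^'b^'b"
    using smooth_on_entry[OF U that] .
  fix f assume f: "compactly_supported U f"
  define e where "e k l y = (if k = i \<and> l = j then f y else 0)" for k l y
  have "compactly_supported U (e k l)" for k l
    using f compactly_supported_zero by (cases "k = i \<and> l = j") (auto simp: e_def[abs_def])
  moreover have "(\<Sum>k\<in>UNIV. \<Sum>l\<in>UNIV. e k l y * H y $ k $ l) = f y * H y $ i $ j"
    for H :: "real^'a \<Rightarrow> real^'b^'b" and y
  proof -
    have "(\<Sum>l\<in>UNIV. e k l y * H y $ k $ l) = (if k = i then f y * H y $ i $ j else 0)" for k
      by (cases "k = i") (simp_all add: e_def if_distrib[of "\<lambda>x. x * _"] cong: if_cong)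
    then show ?thesis by simp
  qed
  ultimately show "\<exists>e. (\<forall>i j. compactly_supported U (e i j)) \<and> (\<forall>H :: real^'a \<Rightarrow> real^'b^'b. smooth_on U H \<longrightarrow>
      (\<integral>y. f y * H y $ i $ j \<partial>lborel) = (\<integral>y. (\<Sum>i\<in>UNIV. \<Sum>j\<in>UNIV. e i j y * H y $ i $ j) \<partial>lborel))"
    by (intro exI[of _ e]) auto
qed

lemma has_adjoint_zero: "has_adjoint U (\<lambda>H y. 0)"
  unfolding has_adjoint_def
  by (auto intro!: smooth_on_const exI[of _ "\<lambda>_ _ _. 0"] compactly_supported_zero)

lemma has_adjoint_add:
  assumes U: "open U" and D: "has_adjoint U D" "has_adjoint U D'"
  shows "has_adjoint U (\<lambda>H y. D H y + D' H y)"
  unfolding has_adjoint_def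
proof (intro conjI allI impI)
  show "smooth_on U (\<lambda>y. D H y + D' H y)" if "smooth_on U H" for H
    using that D by (intro smooth_on_add U) (auto simp: has_adjoint_def)
  fix f assume f: "compactly_supported U f"
  obtain e where e: "\<And>i j. compactly_supported U (e i j)" "\<And>H. smooth_on U H \<Longrightarrow>
      (\<integral>y. f y * D H y \<partial>lborel) = (\<integral>y. (\<Sum>i\<in>UNIV. \<Sum>j\<in>UNIV. e i j y * H y $ i $ j) \<partial>lborel)"
    using D(1) f unfolding has_adjoint_def by blast
  obtain e' where e': "\<And>i j. compactly_supported U (e' i j)" "\<And>H. smooth_on U H \<Longrightarrow>
      (\<integral>y. f y * D' H y \<partial>lborel) = (\<integral>y. (\<Sum>i\<in>UNIV. \<Sum>j\<in>UNIV. e' i j y * H y $ i $ j) \<partial>lborel)"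
    using D(2) f unfolding has_adjoint_def by blast
  have "(\<integral>y. f y * (D H y + D' H y) \<partial>lborel) =
      (\<integral>y. (\<Sum>i\<in>UNIV. \<Sum>j\<in>UNIV. (e i j y + e' i j y) * H y $ i $ j) \<partial>lborel)" if H: "smooth_on U H" for H
  proof -
    have i: "integrable lborel (\<lambda>y. f y * D H y)" "integrable lborel (\<lambda>y. f y * D' H y)"
      using D H by (auto intro!: compactly_supported_integrable[OF U] compactly_supported_mult U f
          simp: has_adjoint_def)
    have i': "integrable lborel (\<lambda>y. \<Sum>i\<in>UNIV. \<Sum>j\<in>UNIV. e i j y * H y $ i $ j)"
      "integrable lborel (\<lambda>y. \<Sum>i\<in>UNIV. \<Sum>j\<in>UNIV. e' i j y * H y $ i $ j)"
      by (intro compactly_supported_integrable[OF U] compactly_supported_sum[OF U]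
          compactly_supported_mult[OF U] e(1) e'(1) smooth_on_entry[OF U H])+
    have "(\<integral>y. f y * (D H y + D' H y) \<partial>lborel) = (\<integral>y. f y * D H y \<partial>lborel) + (\<integral>y. f y * D' H y \<partial>lborel)"
      using i by (simp add: distrib_left)
    also have "\<dots> = (\<integral>y. (\<Sum>i\<in>UNIV. \<Sum>j\<in>UNIV. e i j y * H y $ i $ j) +
        (\<Sum>i\<in>UNIV. \<Sum>j\<in>UNIV. e' i j y * H y $ i $ j) \<partial>lborel)"
      unfolding e(2)[OF H] e'(2)[OF H] using i' by (rule Bochner_Integration.integral_add[symmetric])
    also have "\<dots> = (\<integral>y. (\<Sum>i\<in>UNIV. \<Sum>j\<in>UNIV. (e i j y + e' i j y) * H y $ i $ j) \<partial>lborel)"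
      by (simp add: sum.distrib distrib_right)
    finally show ?thesis .
  qed
  then show "\<exists>e. (\<forall>i j. compactly_supported U (e i j)) \<and> (\<forall>H. smooth_on U H \<longrightarrow>
      (\<integral>y. f y * (D H y + D' H y) \<partial>lborel) =
      (\<integral>y. (\<Sum>i\<in>UNIV. \<Sum>j\<in>UNIV. e i j y * H y $ i $ j) \<partial>lborel))"
    using e(1) e'(1)
    by (intro exI[of _ "\<lambda>i j y. e i j y + e' i j y"] conjI allI impI compactly_supported_add[OF U])
qed

lemma has_adjoint_sum:
  assumes "open U" "\<And>i. i \<in> I \<Longrightarrow> has_adjoint U (D i)"
  shows "has_adjoint U (\<lambda>H y. \<Sum>i\<in>I. D i H y)"
  using assms(2)
  by (induction I rule: infinite_finite_induct)
     (auto intro!: has_adjoint_zero has_adjoint_add assms(1))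

lemma has_adjoint_mult:
  assumes U: "open U" and D: "has_adjoint U D" and u: "smooth_on U u"
  shows "has_adjoint U (\<lambda>H y. u y * D H y)"
  unfolding has_adjoint_def
proof (intro conjI allI impI)
  show "smooth_on U (\<lambda>y. u y * D H y)" if "smooth_on U H" for H
    using that D by (intro smooth_on_mult U u) (auto simp: has_adjoint_def)
  fix f assume "compactly_supported U f"
  then have "compactly_supported U (\<lambda>y. f y * u y)" by (intro compactly_supported_mult U u)
  then obtain e where e: "\<And>i j. compactly_supported U (e i j)" "\<And>H. smooth_on U H \<Longrightarrow>
      (\<integral>y. (f y * u y) * D H y \<partial>lborel) = (\<integral>y. (\<Sum>i\<in>UNIV. \<Sum>j\<in>UNIV. e i j y * H y $ i $ j) \<partial>lborel)"
    using D unfolding has_adjoint_def by blast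
  then show "\<exists>e. (\<forall>i j. compactly_supported U (e i j)) \<and> (\<forall>H. smooth_on U H \<longrightarrow>
      (\<integral>y. f y * (u y * D H y) \<partial>lborel) = (\<integral>y. (\<Sum>i\<in>UNIV. \<Sum>j\<in>UNIV. e i j y * H y $ i $ j) \<partial>lborel))"
    by (intro exI[of _ e]) (auto simp: mult.assoc)
qed

lemma has_adjoint_partial_deriv:
  assumes U: "open U" and D: "has_adjoint U D"
  shows "has_adjoint U (\<lambda>H. partial_deriv i (D H))"
  unfolding has_adjoint_def
proof (intro conjI allI impI)
  show "smooth_on U (partial_deriv i (D H))" if "smooth_on U H" for H
    using that D by (intro smooth_on_partial_deriv) (auto simp: has_adjoint_def)
  fix f assume f: "compactly_supported U f"
  have "compactly_supported U (\<lambda>y. partial_deriv i f y * - 1)"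
    by (intro compactly_supported_mult U compactly_supported_partial_deriv f smooth_on_const)
  then have "compactly_supported U (\<lambda>y. - partial_deriv i f y)" by simp
  then obtain e where e: "\<And>i j. compactly_supported U (e i j)" "\<And>H. smooth_on U H \<Longrightarrow>
      (\<integral>y. - partial_deriv i f y * D H y \<partial>lborel) = (\<integral>y. (\<Sum>i\<in>UNIV. \<Sum>j\<in>UNIV. e i j y * H y $ i $ j) \<partial>lborel)"
    using D unfolding has_adjoint_def by blast
  moreover have "(\<integral>y. f y * partial_deriv i (D H) y \<partial>lborel) = (\<integral>y. - partial_deriv i f y * D H y \<partial>lborel)"
    if "smooth_on U H" for H
    using that D by (intro integration_by_parts[OF U f]) (auto simp: has_adjoint_def)
  ultimately show "\<exists>e. (\<forall>i j. compactly_supported U (e i j)) \<and> (\<forall>H. smooth_on U H \<longrightarrow>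
      (\<integral>y. f y * partial_deriv i (D H) y \<partial>lborel) = (\<integral>y. (\<Sum>i\<in>UNIV. \<Sum>j\<in>UNIV. e i j y * H y $ i $ j) \<partial>lborel))"
    by (intro exI[of _ e]) auto
qed

lemma has_adjoint_iter_partial:
  assumes "open U" "has_adjoint U D"
  shows "has_adjoint U (\<lambda>H. iter_partial is (D H))"
proof (induction "is")
  case (Cons i "is")
  then show ?case
    unfolding iter_partial_Cons by (rule has_adjoint_partial_deriv[OF assms(1)])
qed (simp add: assms)

section \<open>Uniform convergence of functions and of difference quotients\<close>

lemma partial_deriv_add:
  assumes "f differentiable (at y)" "g differentiable (at y)"
  shows "partial_deriv i (\<lambda>y. f y + g y) y = partial_deriv i f y + partial_deriv i g y"
proof -
  have "((\<lambda>y. f y + g y) has_derivative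
      (\<lambda>v. frechet_derivative f (at y) v + frechet_derivative g (at y) v)) (at y)"
    by (rule has_derivative_add[OF differentiable_has_derivative[OF assms(1)]
          differentiable_has_derivative[OF assms(2)]])
  from partial_deriv_eqI[OF this] show ?thesis by (simp add: partial_deriv_def)
qed

lemma partial_deriv_const: "partial_deriv i (\<lambda>_. c) = (\<lambda>_. 0)"
  using partial_deriv_eqI[OF has_derivative_const] by (rule ext)

lemma partial_deriv_inverse:
  fixes f :: "real^'n::finite \<Rightarrow> real"
  assumes "f differentiable (at y)" "f y \<noteq> 0"
  shows "partial_deriv i (\<lambda>y. inverse (f y)) y = - 1 * (partial_deriv i f y * (inverse (f y) * inverse (f y)))"
  using partial_deriv_eqI[OF Deriv.has_derivative_inverse[OF assms(2) differentiable_has_derivative[OF assms(1)]]]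
  by (simp add: partial_deriv_def)

lemma iter_partial_add_scaled:
  fixes q k :: "real^'n::finite \<Rightarrow> real"
  assumes U: "open U" and q: "smooth_on U q" and k: "smooth_on U k" and y: "y \<in> U"
  shows "iter_partial is (\<lambda>y. q y + r * k y) y = iter_partial is q y + r * iter_partial is k y"
  using y
proof (induction "is" arbitrary: y)
  case (Cons i "is")
  have "iter_partial (i # is) (\<lambda>y. q y + r * k y) y =
      partial_deriv i (\<lambda>y. iter_partial is q y + r * iter_partial is k y) y"
    unfolding iter_partial_Cons by (rule differentiable_cong_open(2)[OF U Cons.IH Cons.prems])
  also have "\<dots> = partial_deriv i (iter_partial is q) y + partial_deriv i (\<lambda>y. r * iter_partial is k y) y"
    using smooth_on_differentiable[OF smooth_on_iter_partial[OF q] Cons.prems]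
      smooth_on_differentiable[OF smooth_on_mult[OF U smooth_on_const smooth_on_iter_partial[OF k]] Cons.prems]
    by (rule partial_deriv_add)
  also have "partial_deriv i (\<lambda>y. r * iter_partial is k y) y = r * partial_deriv i (iter_partial is k) y"
    using smooth_on_differentiable[OF smooth_on_iter_partial[OF k] Cons.prems]
    by (subst partial_deriv_bilinear[OF bounded_bilinear_mult]) (auto simp: partial_deriv_const)
  finally show ?case by (simp only: iter_partial_Cons)
qed simp

lemma iter_partial_entry:
  fixes H :: "real^'n::finite \<Rightarrow> real^'k^'k"
  assumes U: "open U" and H: "smooth_on U H" and y: "y \<in> U"
  shows "iter_partial is (\<lambda>y. H y $ i $ j) y = iter_partial is H y $ i $ j"
  using y
proof (induction "is" arbitrary: y)
  case (Cons l "is")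
  have "iter_partial (l # is) (\<lambda>y. H y $ i $ j) y = partial_deriv l (\<lambda>y. iter_partial is H y $ i $ j) y"
    unfolding iter_partial_Cons by (rule differentiable_cong_open(2)[OF U Cons.IH Cons.prems])
  also have "\<dots> = partial_deriv l (iter_partial is H) y $ i $ j"
    using partial_deriv_eqI[OF bounded_linear.has_derivative[OF bounded_linear_vec_nth
          bounded_linear.has_derivative[OF bounded_linear_vec_nth differentiable_has_derivative[OF
            smooth_on_differentiable[OF smooth_on_iter_partial[OF H] Cons.prems]]]]]
    by (simp add: partial_deriv_def)
  finally show ?case by (simp only: iter_partial_Cons)
qed simp

text \<open>Uniform convergence on \<open>K\<close> of all partial derivatives up to order \<open>n\<close>; the set \<open>U\<close> is a
  neighbourhood of \<open>K\<close> on which everything is smooth.\<close>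

primrec smooth_limit ::
    "(real^'n::finite) set \<Rightarrow> (real^'n) set \<Rightarrow> nat \<Rightarrow> 'p filter \<Rightarrow>
     ('p \<Rightarrow> real^'n \<Rightarrow> real) \<Rightarrow> (real^'n \<Rightarrow> real) \<Rightarrow> bool" where
  "smooth_limit U K 0 F Q q \<longleftrightarrow>
     (\<forall>\<^sub>F p in F. smooth_on U (Q p)) \<and> smooth_on U q \<and> uniform_limit K Q q F"
| "smooth_limit U K (Suc n) F Q q \<longleftrightarrow>
     (\<forall>\<^sub>F p in F. smooth_on U (Q p)) \<and> smooth_on U q \<and> uniform_limit K Q q F \<and>
     (\<forall>i. smooth_limit U K n F (\<lambda>p. partial_deriv i (Q p)) (partial_deriv i q))"

lemma smooth_limitD:
  assumes "smooth_limit U K n F Q q"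
  shows "\<forall>\<^sub>F p in F. smooth_on U (Q p)" "smooth_on U q" "uniform_limit K Q q F"
  using assms by (cases n; simp)+

lemma smooth_limit_Suc_lower: "smooth_limit U K (Suc n) F Q q \<Longrightarrow> smooth_limit U K n F Q q"
  by (induction n arbitrary: Q q) auto

lemma smooth_limit_iter_partial:
  "smooth_limit U K (length is) F Q q \<Longrightarrow> uniform_limit K (\<lambda>p. iter_partial is (Q p)) (iter_partial is q) F"
proof (induction "is" arbitrary: Q q rule: rev_induct)
  case (snoc i "is")
  then show ?case by (auto simp: iter_partial_snoc)
qed (simp add: smooth_limitD)

lemma smooth_limitI:
  assumes "\<forall>\<^sub>F p in F. smooth_on U (Q p)" "smooth_on U q"
    "\<And>is. uniform_limit K (\<lambda>p. iter_partial is (Q p)) (iter_partial is q) F"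
  shows "smooth_limit U K n F Q q"
  using assms
proof (induction n arbitrary: Q q)
  case 0
  then show ?case using "0.prems"(3)[of "[]"] by simp
next
  case (Suc n)
  have "smooth_limit U K n F (\<lambda>p. partial_deriv i (Q p)) (partial_deriv i q)" for i
  proof (rule Suc.IH)
    show "\<forall>\<^sub>F p in F. smooth_on U (partial_deriv i (Q p))"
      using Suc.prems(1) by (rule eventually_mono) (rule smooth_on_partial_deriv)
    show "smooth_on U (partial_deriv i q)" using Suc.prems(2) by (rule smooth_on_partial_deriv)
    show "uniform_limit K (\<lambda>p. iter_partial is (partial_deriv i (Q p))) (iter_partial is (partial_deriv i q)) F"
      for "is"
      using Suc.prems(3)[of "is @ [i]"] by (simp add: iter_partial_snoc)
  qed
  then show ?case using Suc.prems Suc.prems(3)[of "[]"] by simp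
qed

locale smooth_convergence =
  fixes U K :: "(real^'n::finite) set" and F :: "'p filter"
  assumes open_U: "open U" and compact_K: "compact K" and K_subset: "K \<subseteq> U"
begin

lemma bounded_on_K:
  fixes q :: "real^'n \<Rightarrow> real"
  assumes "smooth_on U q"
  shows "bounded (q ` K)"
  using continuous_on_subset[OF smooth_on_continuous[OF assms] K_subset] compact_K
  by (intro compact_imp_bounded compact_continuous_image)

lemma smooth_limit_cong_0:
  assumes "smooth_limit U K 0 F Q q"
    and "\<forall>\<^sub>F p in F. \<forall>y\<in>U. Q p y = Q' p y" "\<And>y. y \<in> U \<Longrightarrow> q y = q' y"
  shows "smooth_limit U K 0 F Q' q'"
proof -
  have "\<forall>\<^sub>F p in F. smooth_on U (Q' p)"
    using smooth_limitD(1)[OF assms(1)] assms(2)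
    by eventually_elim (use smooth_on_cong[OF open_U] in blast)
  moreover have "smooth_on U q'"
    using smooth_limitD(2)[OF assms(1)] smooth_on_cong[OF open_U, of q q'] assms(3) by simp
  moreover have "uniform_limit K Q' q' F"
  proof -
    have "\<forall>\<^sub>F p in F. \<forall>y\<in>K. Q p y = Q' p y"
      using assms(2) by eventually_elim (use K_subset in blast)
    moreover have "\<And>y. y \<in> K \<Longrightarrow> q y = q' y" using assms(3) K_subset by blast
    ultimately show ?thesis
      using uniform_limit_cong smooth_limitD(3)[OF assms(1)] by blast
  qed
  ultimately show ?thesis by simp
qed

lemma smooth_limit_cong:
  assumes "smooth_limit U K n F Q q"
    and "\<forall>\<^sub>F p in F. \<forall>y\<in>U. Q p y = Q' p y" "\<And>y. y \<in> U \<Longrightarrow> q y = q' y"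
  shows "smooth_limit U K n F Q' q'"
  using assms
proof (induction n arbitrary: Q q Q' q')
  case (0 Q q Q' q')
  show ?case by (rule smooth_limit_cong_0[OF 0])
next
  case (Suc n Q q Q' q')
  have "smooth_limit U K 0 F Q q" using smooth_limitD[OF Suc.prems(1)] by simp
  then have low: "smooth_limit U K 0 F Q' q'" by (rule smooth_limit_cong_0[OF _ Suc.prems(2,3)])
  have "smooth_limit U K n F (\<lambda>p. partial_deriv i (Q' p)) (partial_deriv i q')" for i
  proof (rule Suc.IH)
    show "smooth_limit U K n F (\<lambda>p. partial_deriv i (Q p)) (partial_deriv i q)"
      using Suc.prems(1) by simp
    show "\<forall>\<^sub>F p in F. \<forall>y\<in>U. partial_deriv i (Q p) y = partial_deriv i (Q' p) y"
      using Suc.prems(2)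
    proof eventually_elim
      case (elim p)
      show ?case
      proof
        fix y assume "y \<in> U"
        then show "partial_deriv i (Q p) y = partial_deriv i (Q' p) y"
          by (rule differentiable_cong_open(2)[OF open_U, rotated]) (use elim in blast)
      qed
    qed
    show "partial_deriv i q y = partial_deriv i q' y" if "y \<in> U" for y
      by (rule differentiable_cong_open(2)[OF open_U _ that]) (rule Suc.prems(3))
  qed
  then show ?case using low by simp
qed

lemma smooth_limit_const:
  assumes "(l \<longlongrightarrow> r) F"
  shows "smooth_limit U K n F (\<lambda>p _. l p) (\<lambda>_. r)"
  using assms
proof (induction n arbitrary: l r)
  case 0
  have "uniform_limit K (\<lambda>p _. l p) (\<lambda>_. r) F"
  proof (rule uniform_limitI)
    fix e :: real assume "e > 0"
    from tendstoD[OF 0 this] show "\<forall>\<^sub>F p in F. \<forall>x\<in>K. dist (l p) r < e" by simp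
  qed
  then show ?case by (simp add: smooth_on_const)
next
  case (Suc n)
  have "uniform_limit K (\<lambda>p _. l p) (\<lambda>_. r) F"
  proof (rule uniform_limitI)
    fix e :: real assume "e > 0"
    from tendstoD[OF Suc.prems this] show "\<forall>\<^sub>F p in F. \<forall>x\<in>K. dist (l p) r < e" by simp
  qed
  then show ?case using Suc.IH[OF tendsto_const] by (simp add: smooth_on_const partial_deriv_const)
qed

lemma smooth_limit_self:
  assumes "smooth_on U q"
  shows "smooth_limit U K n F (\<lambda>_. q) q"
  by (rule smooth_limitI) (simp_all add: assms uniform_limit_const)

lemma smooth_limit_add:
  assumes "smooth_limit U K n F Q q" "smooth_limit U K n F R r"
  shows "smooth_limit U K n F (\<lambda>p y. Q p y + R p y) (\<lambda>y. q y + r y)"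
  using assms
proof (induction n arbitrary: Q q R r)
  case 0
  have "\<forall>\<^sub>F p in F. smooth_on U (\<lambda>y. Q p y + R p y)"
    using smooth_limitD(1)[OF 0(1)] smooth_limitD(1)[OF 0(2)]
    by eventually_elim (rule smooth_on_add[OF open_U])
  then show ?case
    using 0 smooth_on_add[OF open_U] uniform_limit_add by (auto simp: smooth_limitD)
next
  case (Suc n)
  have ev: "\<forall>\<^sub>F p in F. smooth_on U (\<lambda>y. Q p y + R p y)"
    using smooth_limitD(1)[OF Suc.prems(1)] smooth_limitD(1)[OF Suc.prems(2)]
    by eventually_elim (rule smooth_on_add[OF open_U])
  have "smooth_limit U K n F (\<lambda>p. partial_deriv i (\<lambda>y. Q p y + R p y)) (partial_deriv i (\<lambda>y. q y + r y))" for i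
  proof (rule smooth_limit_cong)
    show "smooth_limit U K n F (\<lambda>p y. partial_deriv i (Q p) y + partial_deriv i (R p) y)
        (\<lambda>y. partial_deriv i q y + partial_deriv i r y)"
      by (rule Suc.IH) (use Suc.prems in simp_all)
    show "\<forall>\<^sub>F p in F. \<forall>y\<in>U. partial_deriv i (Q p) y + partial_deriv i (R p) y =
        partial_deriv i (\<lambda>y. Q p y + R p y) y"
      using smooth_limitD(1)[OF Suc.prems(1)] smooth_limitD(1)[OF Suc.prems(2)]
      by eventually_elim (simp add: partial_deriv_add smooth_on_differentiable)
    show "partial_deriv i q y + partial_deriv i r y = partial_deriv i (\<lambda>y. q y + r y) y" if "y \<in> U" for y
      using smooth_limitD(2)[OF Suc.prems(1)] smooth_limitD(2)[OF Suc.prems(2)] that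
      by (simp add: partial_deriv_add smooth_on_differentiable)
  qed
  then show ?case
    using ev smooth_on_add[OF open_U smooth_limitD(2)[OF Suc.prems(1)] smooth_limitD(2)[OF Suc.prems(2)]]
      uniform_limit_add[OF smooth_limitD(3)[OF Suc.prems(1)] smooth_limitD(3)[OF Suc.prems(2)]]
    by simp
qed

lemma smooth_limit_mult:
  assumes "smooth_limit U K n F Q q" "smooth_limit U K n F R r"
  shows "smooth_limit U K n F (\<lambda>p y. Q p y * R p y) (\<lambda>y. q y * r y)"
  using assms
proof (induction n arbitrary: Q q R r)
  case 0
  have "\<forall>\<^sub>F p in F. smooth_on U (\<lambda>y. Q p y * R p y)"
    using smooth_limitD(1)[OF 0(1)] smooth_limitD(1)[OF 0(2)]
    by eventually_elim (rule smooth_on_mult[OF open_U])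
  then show ?case
    using smooth_on_mult[OF open_U smooth_limitD(2)[OF 0(1)] smooth_limitD(2)[OF 0(2)]]
      uniform_lim_mult[OF smooth_limitD(3)[OF 0(1)] smooth_limitD(3)[OF 0(2)]
        bounded_on_K[OF smooth_limitD(2)[OF 0(1)]] bounded_on_K[OF smooth_limitD(2)[OF 0(2)]]]
    by simp
next
  case (Suc n)
  have ev: "\<forall>\<^sub>F p in F. smooth_on U (\<lambda>y. Q p y * R p y)"
    using smooth_limitD(1)[OF Suc.prems(1)] smooth_limitD(1)[OF Suc.prems(2)]
    by eventually_elim (rule smooth_on_mult[OF open_U])
  have "smooth_limit U K n F (\<lambda>p. partial_deriv i (\<lambda>y. Q p y * R p y)) (partial_deriv i (\<lambda>y. q y * r y))" for i
  proof (rule smooth_limit_cong)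
    show "smooth_limit U K n F (\<lambda>p y. Q p y * partial_deriv i (R p) y + partial_deriv i (Q p) y * R p y)
        (\<lambda>y. q y * partial_deriv i r y + partial_deriv i q y * r y)"
      by (rule smooth_limit_add; rule Suc.IH)
         (use Suc.prems smooth_limit_Suc_lower in simp_all)
    show "\<forall>\<^sub>F p in F. \<forall>y\<in>U. Q p y * partial_deriv i (R p) y + partial_deriv i (Q p) y * R p y =
        partial_deriv i (\<lambda>y. Q p y * R p y) y"
      using smooth_limitD(1)[OF Suc.prems(1)] smooth_limitD(1)[OF Suc.prems(2)]
      by eventually_elim (simp add: partial_deriv_bilinear[OF bounded_bilinear_mult] smooth_on_differentiable)
    show "q y * partial_deriv i r y + partial_deriv i q y * r y = partial_deriv i (\<lambda>y. q y * r y) y" if "y \<in> U" for y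
      using smooth_limitD(2)[OF Suc.prems(1)] smooth_limitD(2)[OF Suc.prems(2)] that
      by (simp add: partial_deriv_bilinear[OF bounded_bilinear_mult] smooth_on_differentiable)
  qed
  then show ?case
    using ev smooth_on_mult[OF open_U smooth_limitD(2)[OF Suc.prems(1)] smooth_limitD(2)[OF Suc.prems(2)]]
      uniform_lim_mult[OF smooth_limitD(3)[OF Suc.prems(1)] smooth_limitD(3)[OF Suc.prems(2)]
        bounded_on_K[OF smooth_limitD(2)[OF Suc.prems(1)]] bounded_on_K[OF smooth_limitD(2)[OF Suc.prems(2)]]]
    by simp
qed

lemma smooth_limit_sum:
  assumes "\<And>i. i \<in> I \<Longrightarrow> smooth_limit U K n F (Q i) (q i)"
  shows "smooth_limit U K n F (\<lambda>p y. \<Sum>i\<in>I. Q i p y) (\<lambda>y. \<Sum>i\<in>I. q i y)"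
  using assms
proof (induction I rule: infinite_finite_induct)
  case (insert i I)
  then show ?case by (simp add: smooth_limit_add)
qed (simp_all add: smooth_limit_const)

lemma smooth_limit_prod:
  assumes "\<And>i. i \<in> I \<Longrightarrow> smooth_limit U K n F (Q i) (q i)"
  shows "smooth_limit U K n F (\<lambda>p y. \<Prod>i\<in>I. Q i p y) (\<lambda>y. \<Prod>i\<in>I. q i y)"
  using assms
proof (induction I rule: infinite_finite_induct)
  case (insert i I)
  then show ?case by (simp add: smooth_limit_mult)
qed (simp_all add: smooth_limit_const)

lemma bounded_below_on_K:
  fixes q :: "real^'n \<Rightarrow> real"
  assumes "smooth_on U q" "\<And>y. y \<in> U \<Longrightarrow> q y \<noteq> 0"
  obtains b where "b > 0" "\<And>y. y \<in> K \<Longrightarrow> b \<le> \<bar>q y\<bar>"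
proof (cases "K = {}")
  case True
  then show ?thesis using that[of 1] by simp
next
  case False
  have "continuous_on K (\<lambda>y. \<bar>q y\<bar>)"
    by (intro continuous_on_rabs continuous_on_subset[OF smooth_on_continuous[OF assms(1)] K_subset])
  then obtain z where z: "z \<in> K" "\<forall>y\<in>K. \<bar>q z\<bar> \<le> \<bar>q y\<bar>"
    using continuous_attains_inf[OF compact_K False] by blast
  show ?thesis
  proof (rule that[of "\<bar>q z\<bar>"])
    show "0 < \<bar>q z\<bar>" using assms(2)[of z] z(1) K_subset by auto
  qed (use z in blast)
qed

text \<open>The derivative \<open>\<partial>\<^sub>i (1 / Q) = - (\<partial>\<^sub>i Q) / Q\<^sup>2\<close> involves \<open>1 / Q\<close> at lower order only.\<close>

lemma smooth_limit_inverse: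
  assumes "smooth_limit U K n F Q q" "\<forall>\<^sub>F p in F. \<forall>y\<in>U. Q p y \<noteq> 0" "\<And>y. y \<in> U \<Longrightarrow> q y \<noteq> 0"
  shows "smooth_limit U K n F (\<lambda>p y. inverse (Q p y)) (\<lambda>y. inverse (q y))"
  using assms(1)
proof (induction n)
  case 0
  obtain b where b: "b > 0" "\<And>y. y \<in> K \<Longrightarrow> b \<le> \<bar>q y\<bar>"
    using bounded_below_on_K[OF smooth_limitD(2)[OF 0] assms(3)] by blast
  have "uniform_limit K (\<lambda>p y. inverse (Q p y)) (inverse \<circ> q) F"
    by (rule uniform_lim_inverse[OF smooth_limitD(3)[OF 0] _ b(1)]) (use b(2) in simp)
  moreover have "\<forall>\<^sub>F p in F. smooth_on U (\<lambda>y. inverse (Q p y))"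
    using smooth_limitD(1)[OF 0] assms(2)
    by eventually_elim (rule smooth_on_inverse[OF open_U], blast+)
  ultimately show ?case
    using smooth_on_inverse[OF open_U smooth_limitD(2)[OF 0] assms(3)] by (simp add: o_def)
next
  case (Suc n)
  note IH = Suc.IH[OF smooth_limit_Suc_lower[OF Suc.prems]]
  have "smooth_limit U K n F (\<lambda>p. partial_deriv i (\<lambda>y. inverse (Q p y))) (partial_deriv i (\<lambda>y. inverse (q y)))" for i
  proof (rule smooth_limit_cong)
    show "smooth_limit U K n F (\<lambda>p y. - 1 * (partial_deriv i (Q p) y * (inverse (Q p y) * inverse (Q p y))))
        (\<lambda>y. - 1 * (partial_deriv i q y * (inverse (q y) * inverse (q y))))"
      by (rule smooth_limit_mult[OF smooth_limit_const[OF tendsto_const] smooth_limit_mult[OF _ smooth_limit_mult[OF IH IH]]])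
         (use Suc.prems in simp)
    show "\<forall>\<^sub>F p in F. \<forall>y\<in>U. - 1 * (partial_deriv i (Q p) y * (inverse (Q p y) * inverse (Q p y))) =
        partial_deriv i (\<lambda>y. inverse (Q p y)) y"
      using smooth_limitD(1)[OF Suc.prems] assms(2)
      by eventually_elim (simp add: partial_deriv_inverse smooth_on_differentiable)
    show "- 1 * (partial_deriv i q y * (inverse (q y) * inverse (q y))) = partial_deriv i (\<lambda>y. inverse (q y)) y"
      if "y \<in> U" for y
      using smooth_limitD(2)[OF Suc.prems] that assms(3)
      by (simp add: partial_deriv_inverse smooth_on_differentiable)
  qed
  then show ?case using smooth_limitD[OF IH] by simp
qed

lemma smooth_limit_det:
  fixes Q :: "'p \<Rightarrow> real^'n \<Rightarrow> real^'k^'k"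
  assumes "\<And>i j. smooth_limit U K n F (\<lambda>p y. Q p y $ i $ j) (\<lambda>y. q y $ i $ j)"
  shows "smooth_limit U K n F (\<lambda>p y. det (Q p y)) (\<lambda>y. det (q y))"
  unfolding det_def
  by (rule smooth_limit_sum, rule smooth_limit_mult[OF smooth_limit_const[OF tendsto_const]],
      rule smooth_limit_prod, rule assms)

lemma smooth_limit_matrix_inv:
  fixes Q :: "'p \<Rightarrow> real^'n \<Rightarrow> real^'k^'k"
  assumes Q: "\<And>i j. smooth_limit U K n F (\<lambda>p y. Q p y $ i $ j) (\<lambda>y. q y $ i $ j)"
    and nz: "\<forall>\<^sub>F p in F. \<forall>y\<in>U. det (Q p y) \<noteq> 0" "\<And>y. y \<in> U \<Longrightarrow> det (q y) \<noteq> 0"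
  shows "smooth_limit U K n F (\<lambda>p y. matrix_inv (Q p y) $ k $ j) (\<lambda>y. matrix_inv (q y) $ k $ j)"
proof -
  define M where "M A = (\<chi> i l. if l = k then (if i = j then 1 else 0) else A $ i $ l)" for A :: "real^'k^'k"
  have "smooth_limit U K n F (\<lambda>p y. M (Q p y) $ a $ b) (\<lambda>y. M (q y) $ a $ b)" for a b
    using Q[of a b] smooth_limit_const[OF tendsto_const, of n] by (cases "b = k") (simp_all add: M_def)
  then have "smooth_limit U K n F (\<lambda>p y. det (M (Q p y)) * inverse (det (Q p y)))
      (\<lambda>y. det (M (q y)) * inverse (det (q y)))"
    using nz Q by (intro smooth_limit_mult smooth_limit_det smooth_limit_inverse)
  then show ?thesis
  proof (rule smooth_limit_cong)
    show "\<forall>\<^sub>F p in F. \<forall>y\<in>U. det (M (Q p y)) * inverse (det (Q p y)) = matrix_inv (Q p y) $ k $ j"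
      using nz(1) by eventually_elim (simp add: matrix_inv_entry M_def divide_inverse)
    show "det (M (q y)) * inverse (det (q y)) = matrix_inv (q y) $ k $ j" if "y \<in> U" for y
      using nz(2)[OF that] by (simp add: matrix_inv_entry M_def divide_inverse)
  qed
qed

end

text \<open>The parameter \<open>p\<close> of a family of functions \<open>Q p\<close> comes with a step \<open>t p\<close> that tends to 0. In
  \<open>rate Q q d\<close> below, \<open>Q p = q + t p d + o(t p)\<close> uniformly on \<open>K\<close>.\<close>

locale smooth_difference = smooth_convergence U K F
  for U K :: "(real^'n::finite) set" and F :: "'p filter" +
  fixes t :: "'p \<Rightarrow> real"
  assumes t_tendsto: "(t \<longlongrightarrow> 0) F" and t_nonzero: "\<forall>\<^sub>F p in F. t p \<noteq> 0"
begin

definition rate :: "('p \<Rightarrow> real^'n \<Rightarrow> real) \<Rightarrow> (real^'n \<Rightarrow> real) \<Rightarrow> (real^'n \<Rightarrow> real) \<Rightarrow> bool" where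
  "rate Q q d \<longleftrightarrow> uniform_limit K (\<lambda>p y. (Q p y - q y) / t p) d F"

lemma rate_cong:
  assumes "rate Q q d" "\<forall>\<^sub>F p in F. \<forall>y\<in>K. Q p y = Q' p y" "\<And>y. y \<in> K \<Longrightarrow> q y = q' y"
    "\<And>y. y \<in> K \<Longrightarrow> d y = d' y"
  shows "rate Q' q' d'"
proof -
  have "\<forall>\<^sub>F p in F. \<forall>y\<in>K. (Q p y - q y) / t p = (Q' p y - q' y) / t p"
    using assms(2) by eventually_elim (use assms(3) in simp)
  from uniform_limit_cong[OF this, of d d'] show ?thesis
    using assms(1,4) unfolding rate_def by blast
qed

lemma rate_const: "rate (\<lambda>_. q) q (\<lambda>_. 0)"
  unfolding rate_def by (simp add: uniform_limit_const)

lemma rate_add: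
  assumes "rate Q q d" "rate R r e"
  shows "rate (\<lambda>p y. Q p y + R p y) (\<lambda>y. q y + r y) (\<lambda>y. d y + e y)"
  using uniform_limit_add[OF assms[unfolded rate_def]]
  by (simp add: rate_def add_diff_add add_divide_distrib)

lemma rate_limit:
  assumes "rate Q q d" "bounded (d ` K)"
  shows "uniform_limit K Q q F"
proof -
  have m: "uniform_limit K (\<lambda>p y. t p * ((Q p y - q y) / t p)) (\<lambda>y. 0 * d y) F"
    by (rule uniform_lim_mult[OF smooth_limitD(3)[OF smooth_limit_const[OF t_tendsto, of 0]]
          assms(1)[unfolded rate_def] _ assms(2)]) (auto simp: bounded_iff)
  have c: "uniform_limit K (\<lambda>_. q) q F" by (rule uniform_limit_const)
  from uniform_limit_add[OF c m]
  have lim: "uniform_limit K (\<lambda>p y. q y + t p * ((Q p y - q y) / t p)) q F"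
    by (simp only: mult_zero_left add_0_right)
  have "\<forall>\<^sub>F p in F. \<forall>y\<in>K. q y + t p * ((Q p y - q y) / t p) = Q p y"
    using t_nonzero by eventually_elim simp
  from uniform_limit_cong[THEN iffD1, OF this refl lim] show ?thesis .
qed

lemma rate_mult:
  assumes "rate Q q d" "rate R r e" "bounded (d ` K)" "bounded (e ` K)" "bounded (q ` K)" "bounded (r ` K)"
  shows "rate (\<lambda>p y. Q p y * R p y) (\<lambda>y. q y * r y) (\<lambda>y. d y * r y + q y * e y)"
proof -
  have "uniform_limit K (\<lambda>p y. ((Q p y - q y) / t p) * R p y + q y * ((R p y - r y) / t p))
      (\<lambda>y. d y * r y + q y * e y) F"
  proof (rule uniform_limit_add)
    show "uniform_limit K (\<lambda>p y. (Q p y - q y) / t p * R p y) (\<lambda>y. d y * r y) F"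
      by (rule uniform_lim_mult[OF assms(1)[unfolded rate_def] rate_limit[OF assms(2,4)] assms(3,6)])
    show "uniform_limit K (\<lambda>p y. q y * ((R p y - r y) / t p)) (\<lambda>y. q y * e y) F"
      by (rule uniform_lim_mult[OF uniform_limit_const assms(2)[unfolded rate_def] assms(5,4)])
  qed
  moreover have "((Q p y - q y) / t p) * R p y + q y * ((R p y - r y) / t p) =
      (Q p y * R p y - q y * r y) / t p" for p y
  proof -
    have "Q p y * R p y - q y * r y = (Q p y - q y) * R p y + q y * (R p y - r y)"
      by (simp add: left_diff_distrib right_diff_distrib)
    then show ?thesis by (simp add: add_divide_distrib)
  qed
  ultimately show ?thesis unfolding rate_def by (simp only:)
qed

text \<open>\<open>(sqrt a - sqrt b) / t = ((a - b) / t) / (sqrt a + sqrt b)\<close>, and the denominator stays away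
  from 0.\<close>

lemma rate_sqrt:
  assumes "rate Q q d" "bounded (d ` K)" "smooth_on U q" "\<And>y. y \<in> U \<Longrightarrow> q y > 0"
  shows "rate (\<lambda>p y. sqrt (Q p y)) (\<lambda>y. sqrt (q y)) (\<lambda>y. inverse (2 * sqrt (q y)) * d y)"
proof -
  have "q y \<noteq> 0" if "y \<in> U" for y using assms(4)[OF that] by simp
  from bounded_below_on_K[OF assms(3) this]
  obtain b where b: "b > 0" "\<And>y. y \<in> K \<Longrightarrow> b \<le> \<bar>q y\<bar>" by blast
  have pos: "q y > 0" "b \<le> q y" if "y \<in> K" for y
  proof -
    show "q y > 0" using assms(4)[of y] that K_subset by blast
    then show "b \<le> q y" using b(2)[OF that] by simp
  qed
  note lim = rate_limit[OF assms(1,2)]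
  have ev: "\<forall>\<^sub>F p in F. \<forall>y\<in>K. Q p y > 0"
    using uniform_limitD[OF lim b(1)]
  proof eventually_elim
    case (elim p)
    show ?case
    proof
      fix y assume "y \<in> K"
      then have "\<bar>Q p y - q y\<bar> < b" "b \<le> q y" using elim pos(2) by (auto simp: dist_real_def)
      then show "Q p y > 0" by linarith
    qed
  qed
  have "uniform_limit K (\<lambda>p y. sqrt (Q p y)) (\<lambda>y. sqrt (q y)) F"
  proof (rule uniform_limitI)
    fix e :: real assume e: "e > 0"
    have "e * sqrt b > 0" using e b(1) by simp
    from uniform_limitD[OF lim this] ev
    show "\<forall>\<^sub>F p in F. \<forall>y\<in>K. dist (sqrt (Q p y)) (sqrt (q y)) < e"
    proof eventually_elim
      case (elim p)
      show ?case
      proof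
        fix y assume y: "y \<in> K"
        have "Q p y > 0" using elim(2) y by blast
        then have "(sqrt (Q p y) - sqrt (q y)) * (sqrt (Q p y) + sqrt (q y)) = Q p y - q y"
          using pos(1)[OF y] by (simp add: algebra_simps)
        then have "\<bar>sqrt (Q p y) - sqrt (q y)\<bar> * \<bar>sqrt (Q p y) + sqrt (q y)\<bar> = \<bar>Q p y - q y\<bar>"
          by (metis abs_mult)
        moreover have "sqrt b \<le> \<bar>sqrt (Q p y) + sqrt (q y)\<bar>"
        proof -
          have "sqrt b \<le> sqrt (q y)" "0 \<le> sqrt (Q p y)"
            using \<open>Q p y > 0\<close> pos(2)[OF y] by simp_all
          then show ?thesis by linarith
        qed
        ultimately have "\<bar>sqrt (Q p y) - sqrt (q y)\<bar> * sqrt b \<le> \<bar>Q p y - q y\<bar>"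
          by (metis abs_ge_zero mult_left_mono)
        also have "\<dots> < e * sqrt b" using elim(1) y by (auto simp: dist_real_def)
        finally show "dist (sqrt (Q p y)) (sqrt (q y)) < e" using b(1) by (simp add: dist_real_def)
      qed
    qed
  qed
  then have "uniform_limit K (\<lambda>p y. sqrt (Q p y) + sqrt (q y)) (\<lambda>y. sqrt (q y) + sqrt (q y)) F"
    by (rule uniform_limit_add[OF _ uniform_limit_const])
  then have "uniform_limit K (\<lambda>p y. ((Q p y - q y) / t p) / (sqrt (Q p y) + sqrt (q y)))
      (\<lambda>y. d y / (sqrt (q y) + sqrt (q y))) F"
  proof (rule uniform_lim_divide[OF assms(1)[unfolded rate_def] _ assms(2)])
    show "sqrt b > 0" using b(1) by simp
    show "sqrt b \<le> norm (sqrt (q y) + sqrt (q y))" if "y \<in> K" for y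
    proof -
      have "sqrt b \<le> sqrt (q y)" "0 \<le> sqrt (q y)" using pos[OF that] by auto
      then have "sqrt b \<le> sqrt (q y) + sqrt (q y)" by linarith
      also have "\<dots> \<le> norm (sqrt (q y) + sqrt (q y))" by (simp only: real_norm_def abs_ge_self)
      finally show ?thesis .
    qed
  qed
  note lim' = this
  have ev': "\<forall>\<^sub>F p in F. \<forall>y\<in>K. ((Q p y - q y) / t p) / (sqrt (Q p y) + sqrt (q y)) =
      (sqrt (Q p y) - sqrt (q y)) / t p"
    using ev
  proof eventually_elim
    case (elim p)
    show ?case
    proof
      fix y assume y: "y \<in> K"
      have Q: "Q p y > 0" using elim y by blast
      then have "Q p y - q y = (sqrt (Q p y) - sqrt (q y)) * (sqrt (Q p y) + sqrt (q y))"
        using pos(1)[OF y] by (simp add: algebra_simps)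
      moreover have "sqrt (Q p y) + sqrt (q y) > 0"
        by (intro add_pos_pos real_sqrt_gt_zero Q pos(1)[OF y])
      ultimately show "((Q p y - q y) / t p) / (sqrt (Q p y) + sqrt (q y)) = (sqrt (Q p y) - sqrt (q y)) / t p"
        by simp
    qed
  qed
  have "d y / (sqrt (q y) + sqrt (q y)) = inverse (2 * sqrt (q y)) * d y" for y
    by (simp add: field_simps)
  then show ?thesis
    unfolding rate_def by (intro uniform_limit_cong[THEN iffD1, OF ev' _ lim'])
qed

text \<open>The difference quotient of \<open>q + t p k p\<close> is \<open>k p\<close>, so the rate of change of the iterated partial
  derivatives is the convergence of those of \<open>k p\<close>.\<close>

lemma rate_iter_partial:
  assumes q: "smooth_on U q" and k: "smooth_limit U K (length is) F k h"
    and Q: "\<forall>\<^sub>F p in F. \<forall>y\<in>U. Q p y = q y + t p * k p y"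
  shows "rate (\<lambda>p. iter_partial is (Q p)) (iter_partial is q) (iter_partial is h)"
  unfolding rate_def
proof (rule uniform_limit_cong[THEN iffD1, OF _ _ smooth_limit_iter_partial[OF k]])
  show "\<forall>\<^sub>F p in F. \<forall>y\<in>K. iter_partial is (k p) y = (iter_partial is (Q p) y - iter_partial is q y) / t p"
    using Q smooth_limitD(1)[OF k] t_nonzero
  proof eventually_elim
    case (elim p)
    show ?case
    proof
      fix y assume "y \<in> K"
      then have y: "y \<in> U" using K_subset by blast
      have "iter_partial is (Q p) y = iter_partial is (\<lambda>y. q y + t p * k p y) y"
        by (rule iter_partial_cong_open[OF open_U _ y]) (use elim(1) in blast)
      then show "iter_partial is (k p) y = (iter_partial is (Q p) y - iter_partial is q y) / t p"
        using elim(3) by (simp add: iter_partial_add_scaled[OF open_U q elim(2) y])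
    qed
  qed
qed simp

lemma smooth_limit_perturbation:
  assumes "smooth_on U q" "smooth_limit U K n F k h"
  shows "smooth_limit U K n F (\<lambda>p y. q y + t p * k p y) q"
  using smooth_limit_add[OF smooth_limit_self[OF assms(1)]
      smooth_limit_mult[OF smooth_limit_const[OF t_tendsto] assms(2)]]
  by simp

text \<open>The inverse satisfies \<open>(G + t k)\<^sup>-\<^sup>1 = G\<^sup>-\<^sup>1 + t (- (G + t k)\<^sup>-\<^sup>1 k G\<^sup>-\<^sup>1)\<close>, which has the form of
  the previous lemma.\<close>

lemma rate_iter_partial_matrix_inv:
  fixes G :: "real^'n \<Rightarrow> real^'k^'k" and H :: "real^'n \<Rightarrow> real^'k^'k"
  assumes G: "\<And>i j. smooth_on U (\<lambda>y. G y $ i $ j)"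
    and k: "\<And>n i j. smooth_limit U K n F (\<lambda>p y. k p y $ i $ j) (\<lambda>y. H y $ i $ j)"
    and nz: "\<And>y. y \<in> U \<Longrightarrow> det (G y) \<noteq> 0" "\<forall>\<^sub>F p in F. \<forall>y\<in>U. det (G y + t p *\<^sub>R k p y) \<noteq> 0"
  shows "rate (\<lambda>p. iter_partial is (\<lambda>y. matrix_inv (G y + t p *\<^sub>R k p y) $ i $ j))
    (iter_partial is (\<lambda>y. matrix_inv (G y) $ i $ j))
    (iter_partial is (\<lambda>y. \<Sum>b\<in>UNIV. \<Sum>a\<in>UNIV.
       (- 1 * matrix_inv (G y) $ i $ a * matrix_inv (G y) $ b $ j) * H y $ a $ b))"
proof (rule rate_iter_partial)
  show "smooth_on U (\<lambda>y. matrix_inv (G y) $ i $ j)"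
    by (rule smooth_on_matrix_inv[OF open_U G nz(1)])
  define P where "P p y = G y + t p *\<^sub>R k p y" for p y
  define k' where "k' p y = (\<Sum>b\<in>UNIV. \<Sum>a\<in>UNIV.
      (- 1 * matrix_inv (P p y) $ i $ a * matrix_inv (G y) $ b $ j) * k p y $ a $ b)" for p y
  have "smooth_limit U K n F (\<lambda>p y. P p y $ i $ j) (\<lambda>y. G y $ i $ j)" for n i j
    using smooth_limit_perturbation[OF G[of i j] k[of n i j]] by (simp add: P_def)
  from smooth_limit_matrix_inv[OF this nz(2)[folded P_def] nz(1)]
  have inv: "smooth_limit U K n F (\<lambda>p y. matrix_inv (P p y) $ i $ j) (\<lambda>y. matrix_inv (G y) $ i $ j)" for n i j
    by blast
  show "smooth_limit U K (length is) F k' (\<lambda>y. \<Sum>b\<in>UNIV. \<Sum>a\<in>UNIV.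
       (- 1 * matrix_inv (G y) $ i $ a * matrix_inv (G y) $ b $ j) * H y $ a $ b)"
    unfolding k'_def
    by (rule smooth_limit_sum, rule smooth_limit_sum, rule smooth_limit_mult[OF smooth_limit_mult[OF
          smooth_limit_mult[OF smooth_limit_const[OF tendsto_const] inv]
          smooth_limit_self[OF smooth_on_matrix_inv[OF open_U G nz(1)]]] k])
  show "\<forall>\<^sub>F p in F. \<forall>y\<in>U. matrix_inv (G y + t p *\<^sub>R k p y) $ i $ j = matrix_inv (G y) $ i $ j + t p * k' p y"
    using nz(2)
  proof eventually_elim
    case (elim p)
    show ?case
    proof
      fix y assume y: "y \<in> U"
      define N where "N = matrix_inv (P p y)"
      define M where "M = matrix_inv (G y)"
      have "N ** P p y = mat 1" using matrix_inv_mult(2)[of "P p y"] elim y by (simp add: N_def P_def)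
      moreover have "G y ** M = mat 1" using matrix_inv_mult(1)[of "G y"] nz(1)[OF y] by (simp add: M_def)
      moreover have "N ** (P p y ** M) = (N ** P p y) ** M" by (rule matrix_mul_assoc)
      moreover have "P p y ** M = G y ** M + (t p *\<^sub>R k p y) ** M"
        by (simp add: P_def vec_eq_iff matrix_matrix_mult_def sum.distrib distrib_right)
      then have "N ** (P p y ** M) = N ** (G y ** M) + N ** ((t p *\<^sub>R k p y) ** M)"
        by (simp add: matrix_add_ldistrib)
      ultimately have "M = N + N ** ((t p *\<^sub>R k p y) ** M)" by simp
      then have "N $ i $ j = M $ i $ j - (N ** ((t p *\<^sub>R k p y) ** M)) $ i $ j"
        by (metis add_diff_cancel_right' vector_minus_component)
      also have "(N ** ((t p *\<^sub>R k p y) ** M)) $ i $ j =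
          (\<Sum>a\<in>UNIV. \<Sum>b\<in>UNIV. t p * (N $ i $ a * M $ b $ j * k p y $ a $ b))"
        by (simp add: matrix_matrix_mult_def sum_distrib_left mult_ac)
      also have "\<dots> = (\<Sum>b\<in>UNIV. \<Sum>a\<in>UNIV. t p * (N $ i $ a * M $ b $ j * k p y $ a $ b))"
        by (rule sum.swap)
      also have "\<dots> = - (t p * k' p y)"
        by (simp add: k'_def N_def M_def sum_distrib_left sum_negf)
      finally show "matrix_inv (G y + t p *\<^sub>R k p y) $ i $ j = matrix_inv (G y) $ i $ j + t p * k' p y"
        by (simp add: N_def M_def P_def)
    qed
  qed
qed

end

context closed_manifold
begin

section \<open>The topology on tensors and perturbations of a metric\<close>

lemma topspace_smooth_topology: "topspace (smooth_topology A) = sym_tensors A"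
proof
  show "topspace (smooth_topology A) \<subseteq> sym_tensors A"
    by (auto simp: smooth_topology_def)
  show "sym_tensors A \<subseteq> topspace (smooth_topology A)"
  proof
    fix h assume h: "h \<in> sym_tensors A"
    obtain c where c: "c \<in> A" by (rule charts_cover)
    let ?B = "{k \<in> sym_tensors A. \<forall>y\<in>{}.
        norm (iter_partial [] (\<lambda>y. k c (coord_inv c y) - h c (coord_inv c y)) y) < 1}"
    have "h \<in> ?B" using h by simp
    moreover have "openin (smooth_topology A) ?B"
      unfolding smooth_topology_def
    proof (rule topology_generated_by_Basis, rule CollectI)
      show "\<exists>h' c' K is \<epsilon>. ?B = {k \<in> sym_tensors A. \<forall>y\<in>K.
          norm (iter_partial is (\<lambda>y. k c' (coord_inv c' y) - h' c' (coord_inv c' y)) y) < \<epsilon>} \<and>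
          h' \<in> sym_tensors A \<and> c' \<in> A \<and> compact K \<and> K \<subseteq> img c' \<and> \<epsilon> > 0"
        by (rule exI[of _ h], rule exI[of _ c], rule exI[of _ "{}"], rule exI[of _ "[]"], rule exI[of _ 1])
           (simp add: h c)
    qed
    ultimately show "h \<in> topspace (smooth_topology A)" using openin_subset by blast
  qed
qed

lemma eventually_nhdsin_basis:
  assumes h: "h \<in> sym_tensors A" and c: "c \<in> A" and K: "compact K" "K \<subseteq> img c" and \<epsilon>: "\<epsilon> > 0"
  shows "\<forall>\<^sub>F k in nhdsin (smooth_topology A) h. k \<in> sym_tensors A \<and> (\<forall>y\<in>K.
        norm (iter_partial is (\<lambda>y. k c (coord_inv c y) - h c (coord_inv c y)) y) < \<epsilon>)"
proof -
  let ?B = "{k \<in> sym_tensors A. \<forall>y\<in>K.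
      norm (iter_partial is (\<lambda>y. k c (coord_inv c y) - h c (coord_inv c y)) y) < \<epsilon>}"
  have "openin (smooth_topology A) ?B"
    unfolding smooth_topology_def
  proof (rule topology_generated_by_Basis, rule CollectI)
    show "\<exists>h' c' K' is' \<epsilon>'. ?B = {k \<in> sym_tensors A. \<forall>y\<in>K'.
        norm (iter_partial is' (\<lambda>y. k c' (coord_inv c' y) - h' c' (coord_inv c' y)) y) < \<epsilon>'} \<and>
        h' \<in> sym_tensors A \<and> c' \<in> A \<and> compact K' \<and> K' \<subseteq> img c' \<and> \<epsilon>' > 0"
      by (rule exI[of _ h], rule exI[of _ c], rule exI[of _ K], rule exI[of _ "is"], rule exI[of _ \<epsilon>])
         (simp add: h c K \<epsilon>)
  qed
  moreover have "h \<in> ?B"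
  proof -
    have "iter_partial is (\<lambda>y. h c (coord_inv c y) - h c (coord_inv c y)) = (\<lambda>_. 0)"
      by (induction "is") (simp_all add: iter_partial_Cons partial_deriv_const del: iter_partial.simps(2))
    then show ?thesis using h \<epsilon> by simp
  qed
  ultimately show ?thesis unfolding eventually_nhdsin by blast
qed

lemma eventually_nhdsin_sym_tensors:
  assumes "h \<in> sym_tensors A"
  shows "\<forall>\<^sub>F k in nhdsin (smooth_topology A) h. k \<in> sym_tensors A"
proof -
  obtain c where "c \<in> A" by (rule charts_cover)
  from eventually_nhdsin_basis[OF assms this, of "{}" 1] show ?thesis by simp
qed

text \<open>The topology is generated by neighbourhoods in which one iterated partial derivative is uniformly
  close to that of \<open>h\<close> on one compact set.\<close>

lemma smooth_limit_nhdsin: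
  assumes h: "h \<in> sym_tensors A" and c: "c \<in> A" and K: "compact K" "K \<subseteq> img c"
  shows "smooth_limit (img c) K n (nhdsin (smooth_topology A) h)
    (\<lambda>k y. k c (coord_inv c y) $ i $ j) (\<lambda>y. h c (coord_inv c y) $ i $ j)"
proof (rule smooth_limitI)
  show "\<forall>\<^sub>F k in nhdsin (smooth_topology A) h. smooth_on (img c) (\<lambda>y. k c (coord_inv c y) $ i $ j)"
    using eventually_nhdsin_sym_tensors[OF h] by eventually_elim (rule sym_tensor_entry_smooth[OF _ c])
  show hs: "smooth_on (img c) (\<lambda>y. h c (coord_inv c y) $ i $ j)" by (rule sym_tensor_entry_smooth[OF h c])
  fix "is"
  show "uniform_limit K (\<lambda>k. iter_partial is (\<lambda>y. k c (coord_inv c y) $ i $ j))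
      (iter_partial is (\<lambda>y. h c (coord_inv c y) $ i $ j)) (nhdsin (smooth_topology A) h)"
  proof (rule uniform_limitI)
    fix e :: real assume "e > 0"
    from eventually_nhdsin_basis[OF h c K this, of "is"]
    show "\<forall>\<^sub>F k in nhdsin (smooth_topology A) h. \<forall>y\<in>K. dist (iter_partial is (\<lambda>y. k c (coord_inv c y) $ i $ j) y)
        (iter_partial is (\<lambda>y. h c (coord_inv c y) $ i $ j) y) < e"
    proof eventually_elim
      case (elim k)
      show ?case
      proof
        fix y assume y: "y \<in> K"
        then have yU: "y \<in> img c" using K(2) by blast
        let ?M = "\<lambda>y. k c (coord_inv c y) - h c (coord_inv c y)"
        have ks: "smooth_on (img c) (\<lambda>y. k c (coord_inv c y) $ i $ j)"
          using elim by (intro sym_tensor_entry_smooth c) simp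
        have M: "smooth_on (img c) ?M"
          using elim by (intro smooth_on_diff chart(2) c sym_tensorsD(4) h) simp
        have "iter_partial is (\<lambda>y. k c (coord_inv c y) $ i $ j) y - iter_partial is (\<lambda>y. h c (coord_inv c y) $ i $ j) y
            = iter_partial is (\<lambda>y. k c (coord_inv c y) $ i $ j + - 1 * h c (coord_inv c y) $ i $ j) y"
          using iter_partial_add_scaled[OF chart(2)[OF c] ks hs yU, of "is" "- 1"] by simp
        also have "\<dots> = iter_partial is (\<lambda>y. ?M y $ i $ j) y" by simp
        also have "\<dots> = iter_partial is ?M y $ i $ j"
          by (rule iter_partial_entry[OF chart(2)[OF c] M yU])
        finally have "\<bar>iter_partial is (\<lambda>y. k c (coord_inv c y) $ i $ j) y -
            iter_partial is (\<lambda>y. h c (coord_inv c y) $ i $ j) y\<bar> \<le> norm (iter_partial is ?M y $ i)"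
          using component_le_norm_cart[of "iter_partial is ?M y $ i" j] by simp
        also have "\<dots> \<le> norm (iter_partial is ?M y)" by (rule Finite_Cartesian_Product.norm_nth_le)
        also have "\<dots> < e" using elim y by blast
        finally show "dist (iter_partial is (\<lambda>y. k c (coord_inv c y) $ i $ j) y)
            (iter_partial is (\<lambda>y. h c (coord_inv c y) $ i $ j) y) < e"
          by (simp add: dist_real_def)
      qed
    qed
  qed
qed

text \<open>The filter \<open>t \<rightarrow> 0\<close>, \<open>k \<rightarrow> h\<close> of the functional derivative in direction \<open>h\<close>; it runs over the pairs
  \<open>(t, k)\<close> for which the perturbed tensor is \<open>g + t k\<close>.\<close>

definition variation_filter :: "('m, 'n) tensor2 \<Rightarrow> (real \<times> ('m, 'n) tensor2) filter" where
  "variation_filter h = at 0 \<times>\<^sub>F nhdsin (smooth_topology A) h"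

definition perturb :: "('m, 'n) tensor2 \<Rightarrow> real \<times> ('m, 'n) tensor2 \<Rightarrow> ('m, 'n) tensor2" where
  "perturb g p = tensor_add g (tensor_scale (\<lambda>_. fst p) (snd p))"

lemma perturb_apply: "perturb g p c x = g c x + fst p *\<^sub>R snd p c x"
  by (simp add: perturb_def tensor_add_def tensor_scale_def)

lemma eventually_variation_snd:
  "\<forall>\<^sub>F k in nhdsin (smooth_topology A) h. P k \<Longrightarrow> \<forall>\<^sub>F p in variation_filter h. P (snd p)"
  unfolding variation_filter_def by (rule eventually_compose_filterlim[OF _ filterlim_snd])

lemma smooth_limit_variation:
  assumes h: "h \<in> sym_tensors A" and c: "c \<in> A" and K: "compact K" "K \<subseteq> img c"
  shows "smooth_limit (img c) K n (variation_filter h)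
    (\<lambda>p y. snd p c (coord_inv c y) $ i $ j) (\<lambda>y. h c (coord_inv c y) $ i $ j)"
proof (rule smooth_limitI)
  note lim = smooth_limit_nhdsin[OF h c K]
  show "\<forall>\<^sub>F p in variation_filter h. smooth_on (img c) (\<lambda>y. snd p c (coord_inv c y) $ i $ j)"
    by (rule eventually_variation_snd[OF smooth_limitD(1)[OF lim]])
  show "smooth_on (img c) (\<lambda>y. h c (coord_inv c y) $ i $ j)" by (rule smooth_limitD(2)[OF lim])
  fix "is"
  show "uniform_limit K (\<lambda>p. iter_partial is (\<lambda>y. snd p c (coord_inv c y) $ i $ j))
      (iter_partial is (\<lambda>y. h c (coord_inv c y) $ i $ j)) (variation_filter h)"
    by (rule uniform_limitI, rule eventually_variation_snd,
        rule uniform_limitD[OF smooth_limit_iter_partial[OF lim]])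
qed

lemma smooth_difference_variation:
  assumes c: "c \<in> A" and K: "compact K" "K \<subseteq> img c"
  shows "smooth_difference (img c) K (variation_filter h) fst"
proof
  have "filterlim fst (at 0) (variation_filter h)"
    unfolding variation_filter_def by (rule filterlim_fst)
  then show "(fst \<longlongrightarrow> (0::real)) (variation_filter h)" "\<forall>\<^sub>F p in variation_filter h. fst p \<noteq> 0"
    by (simp_all add: filterlim_at)
qed (use c K chart(2) in auto)

lemma tensor_add_sym_tensor:
  assumes "h \<in> sym_tensors A" "k \<in> sym_tensors A"
  shows "tensor_add h k \<in> sym_tensors A"
  unfolding sym_tensors_def mem_Collect_eq
proof (intro conjI allI ballI impI)
  show "tensor_add h k c x = 0" if "c \<notin> A \<or> x \<notin> dom_of c" for c x
    using sym_tensorsD(1)[OF assms(1) that] sym_tensorsD(1)[OF assms(2) that] by (simp add: tensor_add_def)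
  show "transpose (tensor_add h k c x) = tensor_add h k c x" if "c \<in> A" "x \<in> dom_of c" for c x
    using sym_tensorsD(2)[OF assms(1) that] sym_tensorsD(2)[OF assms(2) that]
    by (simp add: tensor_add_def transpose_def vec_eq_iff)
  show "tensor_add h k c x = transpose (jacobian c c' id x) ** tensor_add h k c' x ** jacobian c c' id x"
    if "c \<in> A" "c' \<in> A" "x \<in> dom_of c \<inter> dom_of c'" for c c' x
  proof -
    have "(B + C) ** J = B ** J + C ** J" for B C J :: "real^'n^'n"
      by (simp add: vec_eq_iff matrix_matrix_mult_def sum.distrib distrib_right)
    then show ?thesis
      using sym_tensorsD(3)[OF assms(1) that(1,2), of x] sym_tensorsD(3)[OF assms(2) that(1,2), of x] that(3)
      by (simp add: tensor_add_def matrix_add_ldistrib)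
  qed
  show "smooth_on (img c) (tensor_add h k c \<circ> coord_inv c)" if "c \<in> A" for c
    unfolding tensor_add_def o_def
    by (intro smooth_on_add chart(2) that assms sym_tensorsD(4))
qed

lemma tensor_const_scale_sym_tensor: "h \<in> sym_tensors A \<Longrightarrow> tensor_scale (\<lambda>_. r) h \<in> sym_tensors A"
  by (rule tensor_scale_sym_tensor[OF smooth_function_const])

lemma perturb_sym_tensor: "g \<in> sym_tensors A \<Longrightarrow> snd p \<in> sym_tensors A \<Longrightarrow> perturb g p \<in> sym_tensors A"
  unfolding perturb_def by (intro tensor_add_sym_tensor tensor_const_scale_sym_tensor)

lemma quadratic_form_le:
  fixes M :: "real^'k^'k"
  assumes "\<And>i j. \<bar>M $ i $ j\<bar> \<le> e"
  shows "\<bar>v \<bullet> (M *v v)\<bar> \<le> (real CARD('k) * real CARD('k) * e) * (v \<bullet> v)"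
proof -
  have "v \<bullet> (M *v v) = (\<Sum>i\<in>UNIV. \<Sum>j\<in>UNIV. v $ i * (M $ i $ j * v $ j))"
    by (simp add: inner_vec_def matrix_vector_mult_def sum_distrib_left)
  also have "\<bar>\<dots>\<bar> \<le> (\<Sum>i\<in>UNIV. \<bar>\<Sum>j\<in>UNIV. v $ i * (M $ i $ j * v $ j)\<bar>)" by (rule sum_abs)
  also have "\<dots> \<le> (\<Sum>i\<in>UNIV. \<Sum>j\<in>UNIV. \<bar>v $ i * (M $ i $ j * v $ j)\<bar>)" by (intro sum_mono sum_abs)
  also have "\<dots> \<le> (\<Sum>i\<in>(UNIV :: 'k set). \<Sum>j\<in>(UNIV :: 'k set). norm v * (e * norm v))"
    by (intro sum_mono, unfold abs_mult)
       (intro mult_mono component_le_norm_cart assms; simp add: order_trans[OF abs_ge_zero assms])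
  also have "\<dots> = (real CARD('k) * real CARD('k) * e) * (v \<bullet> v)"
    by (simp add: dot_square_norm power2_eq_square)
  finally show ?thesis .
qed

text \<open>The bound is the minimum of the quadratic forms over the compact set of all pairs of a point of \<open>K\<close>
  and a unit vector.\<close>

lemma metric_lower_bound:
  assumes g: "g \<in> metrics A" and c: "c \<in> A" and K: "compact K" "K \<subseteq> img c"
  obtains \<delta> where "\<delta> > 0" "\<And>y v. y \<in> K \<Longrightarrow> v \<bullet> (g c (coord_inv c y) *v v) \<ge> \<delta> * (v \<bullet> v)"
proof (cases "K = {}")
  case True
  then show ?thesis using that[of 1] by simp
next
  case False
  define q where "q z = snd z \<bullet> (g c (coord_inv c (fst z)) *v snd z)" for z :: "(real^'n) \<times> (real^'n)"
  have cg: "continuous_on K (\<lambda>y. g c (coord_inv c y) $ i $ j)" for i j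
    by (rule continuous_on_subset[OF smooth_on_continuous[OF
            sym_tensor_entry_smooth[OF metrics_sym_tensors[OF g] c]] K(2)])
  have qs: "q z = (\<Sum>i\<in>UNIV. \<Sum>j\<in>UNIV. snd z $ i * (g c (coord_inv c (fst z)) $ i $ j * snd z $ j))" for z
    by (simp add: q_def inner_vec_def matrix_vector_mult_def sum_distrib_left)
  have 1: "continuous_on (K \<times> sphere 0 1) (\<lambda>z. g c (coord_inv c (fst z)) $ i $ j)" for i j
    by (rule continuous_on_compose2[OF cg continuous_on_fst[OF continuous_on_id]]) auto
  have 2: "continuous_on (K \<times> sphere 0 1) (\<lambda>z. snd z $ i)" for i
    by (intro continuous_on_component continuous_on_snd continuous_on_id)
  have "continuous_on (K \<times> sphere 0 1) q"
    unfolding qs by (intro continuous_on_sum continuous_on_mult 1 2)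
  moreover have "compact (K \<times> sphere (0 :: real^'n) 1)" by (intro compact_Times K compact_sphere)
  moreover have "K \<times> sphere (0 :: real^'n) 1 \<noteq> {}"
  proof -
    have "(axis i 1 :: real^'n) \<in> sphere 0 1" for i by simp
    then show ?thesis using False by blast
  qed
  ultimately obtain z where z: "z \<in> K \<times> sphere 0 1" "\<forall>w\<in>K \<times> sphere 0 1. q z \<le> q w"
    using continuous_attains_inf by blast
  show ?thesis
  proof (rule that[of "q z"])
    have "snd z \<noteq> 0" using z(1) by (auto simp: mem_Times_iff)
    then show "q z > 0"
      using metric_positive_definite[OF g c chart(5)[OF c]] z(1) K(2)
      unfolding q_def positive_definite_def by (auto simp: mem_Times_iff)
    fix y v assume y: "y \<in> K"
    show "v \<bullet> (g c (coord_inv c y) *v v) \<ge> q z * (v \<bullet> v)"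
    proof (cases "v = 0")
      case False
      define u where "u = v /\<^sub>R norm v"
      have u: "v = norm v *\<^sub>R u" "u \<in> sphere 0 1" using False by (simp_all add: u_def)
      have "q z \<le> q (y, u)" using z(2) y u(2) by blast
      then have "q z * (norm v)\<^sup>2 \<le> q (y, u) * (norm v)\<^sup>2" by (intro mult_right_mono) simp_all
      also have "\<dots> = (norm v *\<^sub>R u) \<bullet> (g c (coord_inv c y) *v (norm v *\<^sub>R u))"
        by (simp add: q_def matrix_vector_mult_scaleR power2_eq_square)
      also have "\<dots> = v \<bullet> (g c (coord_inv c y) *v v)" by (simp only: u(1)[symmetric])
      finally show ?thesis by (simp add: dot_square_norm)
    qed simp
  qed
qed

text \<open>Being a metric is an open condition, since the manifold is covered by finitely many compact
  subsets of charts.\<close>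

lemma eventually_perturb_metric:
  assumes g: "g \<in> metrics A" and h: "h \<in> sym_tensors A"
  shows "\<forall>\<^sub>F p in variation_filter h. perturb g p \<in> metrics A"
proof -
  note gs = metrics_sym_tensors[OF g]
  obtain I :: "'m set" and cs K and \<psi> :: "'m \<Rightarrow> 'm \<Rightarrow> real" where
    I: "finite I" and cs: "\<And>a. cs a \<in> A" and K: "\<And>a. compact (K a)" "\<And>a. K a \<subseteq> img (cs a)"
    and \<psi>: "\<And>a x. x \<notin> coord_inv (cs a) ` K a \<Longrightarrow> \<psi> a x = 0" "\<And>x. (\<Sum>a\<in>I. \<psi> a x) = 1"
    by (rule partition_of_unity) blast
  have local: "\<forall>\<^sub>F p in variation_filter h. \<forall>y\<in>K a. positive_definite (perturb g p (cs a) (coord_inv (cs a) y))" for a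
  proof -
    let ?c = "cs a"
    interpret smooth_difference "img ?c" "K a" "variation_filter h" fst
      by (rule smooth_difference_variation[OF cs K])
    obtain \<delta> where \<delta>: "\<delta> > 0" "\<And>y v. y \<in> K a \<Longrightarrow> v \<bullet> (g ?c (coord_inv ?c y) *v v) \<ge> \<delta> * (v \<bullet> v)"
      by (rule metric_lower_bound[OF g cs K]) blast
    \<comment> \<open>Changing all \<open>n\<^sup>2\<close> entries by at most \<open>\<epsilon>\<close> changes the quadratic form by at most \<open>\<delta> / 2\<close>.\<close>
    define \<epsilon> where "\<epsilon> = \<delta> / (2 * real CARD('n) * real CARD('n))"
    have \<epsilon>: "\<epsilon> > 0" "real CARD('n) * real CARD('n) * \<epsilon> = \<delta> / 2" using \<delta>(1) by (simp_all add: \<epsilon>_def)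
    have "\<forall>\<^sub>F p in variation_filter h. \<forall>y\<in>K a.
        dist (g ?c (coord_inv ?c y) $ i $ j + fst p * snd p ?c (coord_inv ?c y) $ i $ j) (g ?c (coord_inv ?c y) $ i $ j) < \<epsilon>" for i j
      by (rule uniform_limitD[OF smooth_limitD(3)[OF smooth_limit_perturbation[OF
              sym_tensor_entry_smooth[OF gs cs] smooth_limit_variation[OF h cs K, where n = 0]]] \<epsilon>(1)])
    then have "\<forall>\<^sub>F p in variation_filter h. \<forall>i j. \<forall>y\<in>K a.
        dist (g ?c (coord_inv ?c y) $ i $ j + fst p * snd p ?c (coord_inv ?c y) $ i $ j) (g ?c (coord_inv ?c y) $ i $ j) < \<epsilon>"
      by (intro eventually_all_finite)
    then show ?thesis
    proof eventually_elim
      case (elim p)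
      show ?case
      proof
        fix y assume y: "y \<in> K a"
        let ?G = "g ?c (coord_inv ?c y)" and ?k = "fst p *\<^sub>R snd p ?c (coord_inv ?c y)"
        have "\<bar>?k $ i $ j\<bar> \<le> \<epsilon>" for i j
          using elim y by (auto simp: dist_real_def intro: less_imp_le)
        from quadratic_form_le[OF this] have q: "\<bar>v \<bullet> (?k *v v)\<bar> \<le> \<delta> / 2 * (v \<bullet> v)" for v
          by (simp add: \<epsilon>(2))
        show "positive_definite (perturb g p ?c (coord_inv ?c y))"
          unfolding positive_definite_def
        proof (intro allI impI)
          fix v :: "real^'n" assume "v \<noteq> 0"
          then have v: "v \<bullet> v > 0" by simp
          have "v \<bullet> (perturb g p ?c (coord_inv ?c y) *v v) = v \<bullet> (?G *v v) + v \<bullet> (?k *v v)"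
            by (simp add: perturb_apply matrix_vector_mult_add_rdistrib inner_add_right)
          moreover have "v \<bullet> (?G *v v) \<ge> \<delta> * (v \<bullet> v)" by (rule \<delta>(2)[OF y])
          moreover have "\<delta> * (v \<bullet> v) > 0" using \<delta>(1) v by simp
          ultimately show "v \<bullet> (perturb g p ?c (coord_inv ?c y) *v v) > 0"
            using q[of v] by (simp add: abs_le_iff)
        qed
      qed
    qed
  qed
  have "\<forall>\<^sub>F p in variation_filter h. \<forall>a\<in>I. \<forall>y\<in>K a. positive_definite (perturb g p (cs a) (coord_inv (cs a) y))"
    using I local by (simp add: eventually_ball_finite)
  with eventually_variation_snd[OF eventually_nhdsin_sym_tensors[OF h]]
  show ?thesis
  proof eventually_elim
    case (elim p)
    have s: "perturb g p \<in> sym_tensors A" by (rule perturb_sym_tensor[OF gs elim(1)])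
    have "v \<bullet> (perturb g p c x *v v) > 0" if c: "c \<in> A" "x \<in> dom_of c" and v: "v \<noteq> 0" for c x v
    proof -
      have "\<exists>a\<in>I. \<psi> a x \<noteq> 0" using \<psi>(2)[of x] by (metis sum.neutral zero_neq_one)
      then obtain a where a: "a \<in> I" "x \<in> coord_inv (cs a) ` K a" using \<psi>(1) by blast
      then have pd: "positive_definite (perturb g p (cs a) x)" using elim(2) by blast
      have x: "x \<in> dom_of (cs a)" using a(2) K(2) chart(5)[OF cs] by blast
      define J where "J = jacobian c (cs a) id x"
      have "jacobian (cs a) c id x ** J = mat 1"
        unfolding J_def by (rule jacobian_id_inverse[OF c(1) cs c(2) x])
      then have "J *v v \<noteq> 0"
        using v by (metis matrix_vector_mul_assoc matrix_vector_mul_lid matrix_vector_mult_0_right)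
      then have "(J *v v) \<bullet> (perturb g p (cs a) x *v (J *v v)) > 0"
        using pd by (simp add: positive_definite_def)
      also have "\<dots> = (v v* transpose J) \<bullet> (perturb g p (cs a) x *v (J *v v))"
        by (simp only: vector_transpose_matrix)
      also have "\<dots> = v \<bullet> (transpose J *v (perturb g p (cs a) x *v (J *v v)))"
        by (rule dot_lmul_matrix)
      also have "\<dots> = v \<bullet> (perturb g p c x *v v)"
        by (simp only: sym_tensorsD(3)[OF s c(1) cs c(2) x] J_def[symmetric] matrix_vector_mul_assoc
            matrix_mul_assoc)
      finally show ?thesis .
    qed
    then show ?case using s by (simp add: metrics_def)
  qed
qed

section \<open>Linearisation of expressions in the jets of the metric\<close>

text \<open>\<open>\<Psi>\<close> is a scalar expression in a metric, written in the chart \<open>c\<close>. Its difference quotients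
  at \<open>g\<close> converge uniformly on \<open>K\<close>, and the limit is a linear differential operator in the direction
  of the variation.\<close>

definition linearizes ::
    "('m, 'n) tensor2 \<Rightarrow> ('m, 'n) chart \<Rightarrow> (real^'n) set \<Rightarrow> (('m, 'n) tensor2 \<Rightarrow> real^'n \<Rightarrow> real) \<Rightarrow>
     ((real^'n \<Rightarrow> real^'n^'n) \<Rightarrow> real^'n \<Rightarrow> real) \<Rightarrow> bool" where
  "linearizes g c K \<Psi> D \<longleftrightarrow> smooth_on (img c) (\<Psi> g) \<and> has_adjoint (img c) D \<and>
     (\<forall>h\<in>sym_tensors A. smooth_difference.rate K (variation_filter h) fst
        (\<lambda>p. \<Psi> (perturb g p)) (\<Psi> g) (D (\<lambda>y. h c (coord_inv c y))))"

definition linearizable ::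
    "('m, 'n) tensor2 \<Rightarrow> ('m, 'n) chart \<Rightarrow> (real^'n) set \<Rightarrow> (('m, 'n) tensor2 \<Rightarrow> real^'n \<Rightarrow> real) \<Rightarrow> bool" where
  "linearizable g c K \<Psi> \<longleftrightarrow> (\<exists>D. linearizes g c K \<Psi> D)"

context
  fixes g :: "('m, 'n) tensor2" and c :: "('m, 'n) chart" and K :: "(real^'n) set"
  assumes g: "g \<in> metrics A" and c: "c \<in> A" and K: "compact K" "K \<subseteq> img c"
begin

lemma operator_bounded:
  assumes "has_adjoint (img c) D" "h \<in> sym_tensors A"
  shows "bounded (D (\<lambda>y. h c (coord_inv c y)) ` K)"
proof -
  interpret smooth_difference "img c" K "variation_filter h" fst
    by (rule smooth_difference_variation[OF c K])
  have "smooth_on (img c) (D (\<lambda>y. h c (coord_inv c y)))"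
    using assms(1) sym_tensorsD(4)[OF assms(2) c] by (simp add: has_adjoint_def)
  then show ?thesis by (rule bounded_on_K)
qed

lemma linearizes_cong:
  assumes "linearizes g c K \<Psi> D" "\<And>g y. y \<in> img c \<Longrightarrow> \<Psi> g y = \<Psi>' g y"
  shows "linearizes g c K \<Psi>' D"
  unfolding linearizes_def
proof (intro conjI ballI)
  show "smooth_on (img c) (\<Psi>' g)"
    using assms(1) smooth_on_cong[OF chart(2)[OF c] assms(2)] by (simp add: linearizes_def)
  show "has_adjoint (img c) D" using assms(1) by (simp add: linearizes_def)
  fix h assume h: "h \<in> sym_tensors A"
  interpret smooth_difference "img c" K "variation_filter h" fst
    by (rule smooth_difference_variation[OF c K])
  have r: "rate (\<lambda>p. \<Psi> (perturb g p)) (\<Psi> g) (D (\<lambda>y. h c (coord_inv c y)))"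
    using assms(1) h by (simp add: linearizes_def)
  show "rate (\<lambda>p. \<Psi>' (perturb g p)) (\<Psi>' g) (D (\<lambda>y. h c (coord_inv c y)))"
    by (rule rate_cong[OF r]) (use assms(2) K(2) in \<open>auto intro!: always_eventually\<close>)
qed

lemma linearizes_const: "linearizes g c K (\<lambda>_ _. r) (\<lambda>H y. 0)"
  unfolding linearizes_def
proof (intro conjI ballI smooth_on_const has_adjoint_zero)
  fix h assume "h \<in> sym_tensors A"
  interpret smooth_difference "img c" K "variation_filter h" fst
    by (rule smooth_difference_variation[OF c K])
  show "rate (\<lambda>p _. r) (\<lambda>_. r) (\<lambda>y. 0)" by (rule rate_const)
qed

lemma linearizes_add:
  assumes "linearizes g c K \<Psi> D" "linearizes g c K \<Psi>' D'"
  shows "linearizes g c K (\<lambda>g y. \<Psi> g y + \<Psi>' g y) (\<lambda>H y. D H y + D' H y)"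
  unfolding linearizes_def
proof (intro conjI ballI)
  show "smooth_on (img c) (\<lambda>y. \<Psi> g y + \<Psi>' g y)"
    using assms by (intro smooth_on_add chart(2) c) (simp_all add: linearizes_def)
  show "has_adjoint (img c) (\<lambda>H y. D H y + D' H y)"
    using assms by (intro has_adjoint_add chart(2) c) (simp_all add: linearizes_def)
  fix h assume h: "h \<in> sym_tensors A"
  interpret smooth_difference "img c" K "variation_filter h" fst
    by (rule smooth_difference_variation[OF c K])
  show "rate (\<lambda>p y. \<Psi> (perturb g p) y + \<Psi>' (perturb g p) y) (\<lambda>y. \<Psi> g y + \<Psi>' g y)
      (\<lambda>y. D (\<lambda>y. h c (coord_inv c y)) y + D' (\<lambda>y. h c (coord_inv c y)) y)"
    using assms h by (intro rate_add) (simp_all add: linearizes_def)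
qed

lemma linearizes_mult:
  assumes "linearizes g c K \<Psi> D" "linearizes g c K \<Psi>' D'"
  shows "linearizes g c K (\<lambda>g y. \<Psi> g y * \<Psi>' g y) (\<lambda>H y. \<Psi>' g y * D H y + \<Psi> g y * D' H y)"
  unfolding linearizes_def
proof (intro conjI ballI)
  have s: "smooth_on (img c) (\<Psi> g)" "smooth_on (img c) (\<Psi>' g)"
    and D: "has_adjoint (img c) D" "has_adjoint (img c) D'"
    using assms by (simp_all add: linearizes_def)
  show "smooth_on (img c) (\<lambda>y. \<Psi> g y * \<Psi>' g y)"
    by (rule smooth_on_mult[OF chart(2)[OF c] s])
  show "has_adjoint (img c) (\<lambda>H y. \<Psi>' g y * D H y + \<Psi> g y * D' H y)"
    by (rule has_adjoint_add[OF chart(2)[OF c] has_adjoint_mult[OF chart(2)[OF c] D(1) s(2)]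
          has_adjoint_mult[OF chart(2)[OF c] D(2) s(1)]])
  fix h assume h: "h \<in> sym_tensors A"
  interpret smooth_difference "img c" K "variation_filter h" fst
    by (rule smooth_difference_variation[OF c K])
  have r: "rate (\<lambda>p. \<Psi> (perturb g p)) (\<Psi> g) (D (\<lambda>y. h c (coord_inv c y)))"
    "rate (\<lambda>p. \<Psi>' (perturb g p)) (\<Psi>' g) (D' (\<lambda>y. h c (coord_inv c y)))"
    using assms h by (simp_all add: linearizes_def)
  from rate_mult[OF r operator_bounded[OF D(1) h] operator_bounded[OF D(2) h] bounded_on_K[OF s(1)] bounded_on_K[OF s(2)]]
  show "rate (\<lambda>p y. \<Psi> (perturb g p) y * \<Psi>' (perturb g p) y) (\<lambda>y. \<Psi> g y * \<Psi>' g y)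
      (\<lambda>y. \<Psi>' g y * D (\<lambda>y. h c (coord_inv c y)) y + \<Psi> g y * D' (\<lambda>y. h c (coord_inv c y)) y)"
    by (simp only: mult.commute[of "D _ _"])
qed

lemma linearizes_sqrt:
  assumes "linearizes g c K \<Psi> D" "\<And>y. y \<in> img c \<Longrightarrow> \<Psi> g y > 0"
  shows "linearizes g c K (\<lambda>g y. sqrt (\<Psi> g y)) (\<lambda>H y. inverse (2 * sqrt (\<Psi> g y)) * D H y)"
  unfolding linearizes_def
proof (intro conjI ballI)
  have s: "smooth_on (img c) (\<Psi> g)" and D: "has_adjoint (img c) D"
    using assms(1) by (simp_all add: linearizes_def)
  show sq: "smooth_on (img c) (\<lambda>y. sqrt (\<Psi> g y))"
    by (rule smooth_on_sqrt[OF chart(2)[OF c] s assms(2)])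
  have "2 * sqrt (\<Psi> g y) \<noteq> 0" if "y \<in> img c" for y using assms(2)[OF that] by simp
  from smooth_on_inverse[OF chart(2)[OF c] smooth_on_mult[OF chart(2)[OF c] smooth_on_const sq] this]
  show "has_adjoint (img c) (\<lambda>H y. inverse (2 * sqrt (\<Psi> g y)) * D H y)"
    by (rule has_adjoint_mult[OF chart(2)[OF c] D])
  fix h assume h: "h \<in> sym_tensors A"
  interpret smooth_difference "img c" K "variation_filter h" fst
    by (rule smooth_difference_variation[OF c K])
  have r: "rate (\<lambda>p. \<Psi> (perturb g p)) (\<Psi> g) (D (\<lambda>y. h c (coord_inv c y)))"
    using assms(1) h by (simp add: linearizes_def)
  show "rate (\<lambda>p y. sqrt (\<Psi> (perturb g p) y)) (\<lambda>y. sqrt (\<Psi> g y))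
      (\<lambda>y. inverse (2 * sqrt (\<Psi> g y)) * D (\<lambda>y. h c (coord_inv c y)) y)"
    by (rule rate_sqrt[OF r operator_bounded[OF D h] s assms(2)])
qed

lemma linearizable_const: "linearizable g c K (\<lambda>_ _. r)"
  unfolding linearizable_def using linearizes_const by blast

lemma linearizable_add:
  "linearizable g c K \<Psi> \<Longrightarrow> linearizable g c K \<Psi>' \<Longrightarrow> linearizable g c K (\<lambda>g y. \<Psi> g y + \<Psi>' g y)"
  unfolding linearizable_def using linearizes_add by blast

lemma linearizable_mult:
  "linearizable g c K \<Psi> \<Longrightarrow> linearizable g c K \<Psi>' \<Longrightarrow> linearizable g c K (\<lambda>g y. \<Psi> g y * \<Psi>' g y)"
  unfolding linearizable_def using linearizes_mult by blast

lemma linearizable_sum: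
  assumes "\<And>i. i \<in> I \<Longrightarrow> linearizable g c K (\<Psi> i)"
  shows "linearizable g c K (\<lambda>g y. \<Sum>i\<in>I. \<Psi> i g y)"
  using assms
proof (induction I rule: infinite_finite_induct)
  case (insert i I)
  then show ?case by (simp add: linearizable_add)
qed (simp_all add: linearizable_const)

lemma linearizable_prod:
  assumes "\<And>i. i \<in> I \<Longrightarrow> linearizable g c K (\<Psi> i)"
  shows "linearizable g c K (\<lambda>g y. \<Prod>i\<in>I. \<Psi> i g y)"
  using assms
proof (induction I rule: infinite_finite_induct)
  case (insert i I)
  then show ?case by (simp add: linearizable_mult)
qed (simp_all add: linearizable_const)

lemma linearizable_power:
  assumes "linearizable g c K \<Psi>"
  shows "linearizable g c K (\<lambda>g y. \<Psi> g y ^ m)"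
proof (induction m)
  case (Suc m)
  then show ?case using linearizable_mult[OF assms] by simp
qed (simp add: linearizable_const)

lemma linearizable_metric_jet:
  "linearizable g c K (\<lambda>g. iter_partial is (\<lambda>y. g c (coord_inv c y) $ i $ j))"
  unfolding linearizable_def
proof (rule exI, unfold linearizes_def, intro conjI ballI)
  note gs = sym_tensor_entry_smooth[OF metrics_sym_tensors[OF g] c]
  show "smooth_on (img c) (iter_partial is (\<lambda>y. g c (coord_inv c y) $ i $ j))"
    by (rule smooth_on_iter_partial[OF gs])
  show "has_adjoint (img c) (\<lambda>H. iter_partial is (\<lambda>y. H y $ i $ j))"
    by (rule has_adjoint_iter_partial[OF chart(2)[OF c] has_adjoint_entry[OF chart(2)[OF c]]])
  fix h assume h: "h \<in> sym_tensors A"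
  interpret smooth_difference "img c" K "variation_filter h" fst
    by (rule smooth_difference_variation[OF c K])
  show "rate (\<lambda>p. iter_partial is (\<lambda>y. perturb g p c (coord_inv c y) $ i $ j))
      (iter_partial is (\<lambda>y. g c (coord_inv c y) $ i $ j)) (iter_partial is (\<lambda>y. h c (coord_inv c y) $ i $ j))"
    by (rule rate_iter_partial[OF gs smooth_limit_variation[OF h c K]]) (simp add: perturb_apply)
qed

lemma linearizable_inverse_jet:
  "linearizable g c K (\<lambda>g. iter_partial is (\<lambda>y. matrix_inv (g c (coord_inv c y)) $ i $ j))"
  unfolding linearizable_def
proof (rule exI, unfold linearizes_def, intro conjI ballI)
  let ?M = "\<lambda>y. matrix_inv (g c (coord_inv c y))"
  note gs = sym_tensor_entry_smooth[OF metrics_sym_tensors[OF g] c]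
  have nz: "det (g c (coord_inv c y)) \<noteq> 0" if "y \<in> img c" for y
    by (rule positive_definite_det_nz[OF metric_positive_definite[OF g c chart(5)[OF c that]]])
  note inv = smooth_on_matrix_inv[OF chart(2)[OF c] gs nz]
  show "smooth_on (img c) (iter_partial is (\<lambda>y. ?M y $ i $ j))"
    by (rule smooth_on_iter_partial[OF inv])
  have "has_adjoint (img c) (\<lambda>H y. \<Sum>b\<in>UNIV. \<Sum>a\<in>UNIV. (- 1 * ?M y $ i $ a * ?M y $ b $ j) * H y $ a $ b)"
    by (rule has_adjoint_sum[OF chart(2)[OF c]], rule has_adjoint_sum[OF chart(2)[OF c]],
        rule has_adjoint_mult[OF chart(2)[OF c] has_adjoint_entry[OF chart(2)[OF c]]],
        rule smooth_on_mult[OF chart(2)[OF c] smooth_on_mult[OF chart(2)[OF c] smooth_on_const inv] inv])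
  then show "has_adjoint (img c) (\<lambda>H. iter_partial is
      (\<lambda>y. \<Sum>b\<in>UNIV. \<Sum>a\<in>UNIV. (- 1 * ?M y $ i $ a * ?M y $ b $ j) * H y $ a $ b))"
    by (rule has_adjoint_iter_partial[OF chart(2)[OF c]])
  fix h assume h: "h \<in> sym_tensors A"
  interpret smooth_difference "img c" K "variation_filter h" fst
    by (rule smooth_difference_variation[OF c K])
  have "\<forall>\<^sub>F p in variation_filter h. \<forall>y\<in>img c. det (g c (coord_inv c y) + fst p *\<^sub>R snd p c (coord_inv c y)) \<noteq> 0"
    using eventually_perturb_metric[OF g h]
  proof eventually_elim
    case (elim p)
    show ?case
      using positive_definite_det_nz[OF metric_positive_definite[OF elim c chart(5)[OF c]]]
      by (simp add: perturb_apply)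
  qed
  from rate_iter_partial_matrix_inv[where G = "\<lambda>y. g c (coord_inv c y)" and
      k = "\<lambda>p y. snd p c (coord_inv c y)" and H = "\<lambda>y. h c (coord_inv c y)",
      OF gs smooth_limit_variation[OF h c K] nz this]
  show "rate (\<lambda>p. iter_partial is (\<lambda>y. matrix_inv (perturb g p c (coord_inv c y)) $ i $ j))
      (iter_partial is (\<lambda>y. ?M y $ i $ j))
      (iter_partial is (\<lambda>y. \<Sum>b\<in>UNIV. \<Sum>a\<in>UNIV.
        (- 1 * ?M y $ i $ a * ?M y $ b $ j) * h c (coord_inv c y) $ a $ b))"
    unfolding perturb_apply .
qed

lemma linearizable_cong:
  "linearizable g c K \<Psi> \<Longrightarrow> (\<And>g y. y \<in> img c \<Longrightarrow> \<Psi> g y = \<Psi>' g y) \<Longrightarrow> linearizable g c K \<Psi>'"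
  unfolding linearizable_def using linearizes_cong by blast

lemma linearizable_jet_value: "linearizable g c K (\<lambda>g y. jet_value g c (coord_inv c y) v)"
proof (cases v)
  case (Metric_Jet "is" i j)
  show ?thesis
    by (rule linearizable_cong[OF linearizable_metric_jet[of "is" i j]])
       (simp add: Metric_Jet chart(4)[OF c] del: iter_partial.simps)
next
  case (Inverse_Jet "is" i j)
  show ?thesis
    by (rule linearizable_cong[OF linearizable_inverse_jet[of "is" i j]])
       (simp add: Inverse_Jet chart(4)[OF c] del: iter_partial.simps)
qed

text \<open>Jet variables are linearizable, by \<open>rate_iter_partial\<close> and \<open>rate_iter_partial_matrix_inv\<close>, and
  linearizable expressions are closed under sums and products.\<close>

lemma linearizable_eval_mpoly:
  "linearizable g c K (\<lambda>g y. eval_mpoly (jet_value g c (coord_inv c y)) P)"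
  unfolding eval_mpoly_def
  by (intro linearizable_sum linearizable_mult linearizable_const linearizable_prod linearizable_power
      linearizable_jet_value)

lemma linearizable_vol: "linearizable g c K (\<lambda>g y. vol g c y)"
proof -
  have "linearizable g c K (\<lambda>g y. det (g c (coord_inv c y)))"
    unfolding det_def using linearizable_metric_jet[of "[]"]
    by (intro linearizable_sum linearizable_mult linearizable_const linearizable_prod) simp
  then obtain D where "linearizes g c K (\<lambda>g y. det (g c (coord_inv c y))) D"
    unfolding linearizable_def by blast
  from linearizes_sqrt[OF this positive_definite_det_pos[OF metric_positive_definite[OF g c chart(5)[OF c]]]]
  show ?thesis unfolding linearizable_def vol_def by blast
qed

end

end

section \<open>Functionals given by integration against a compactly supported kernel\<close>

lemma tendsto_integral_compact:
  fixes f :: "'p \<Rightarrow> real^'n::finite \<Rightarrow> real"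
  assumes K: "compact K" and lim: "uniform_limit K f l F"
    and f: "\<forall>\<^sub>F p in F. continuous_on K (f p)" and l: "continuous_on K l"
  shows "((\<lambda>p. \<integral>y. indicator K y * f p y \<partial>lborel) \<longlongrightarrow> (\<integral>y. indicator K y * l y \<partial>lborel)) F"
proof (rule tendstoI)
  fix e :: real assume e: "e > 0"
  define m where "m = (\<integral>y. indicator K y * (1::real) \<partial>(lborel :: (real^'n) measure))"
  have int: "integrable lborel (\<lambda>y. indicator K y * g y)" if "continuous_on K g" for g :: "real^'n \<Rightarrow> real"
    using borel_integrable_compact[OF K that] by simp
  have m: "m \<ge> 0" unfolding m_def by (rule Bochner_Integration.integral_nonneg) simp
  \<comment> \<open>\<open>m + 1\<close> instead of \<open>m\<close>, since \<open>K\<close> may be a null set\<close>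
  define d where "d = e / (m + 1)"
  have d: "d > 0" "d * m < e" using e m by (simp_all add: d_def field_simps)
  from uniform_limitD[OF lim d(1)] f
  show "\<forall>\<^sub>F p in F. dist (\<integral>y. indicator K y * f p y \<partial>lborel) (\<integral>y. indicator K y * l y \<partial>lborel) < e"
  proof eventually_elim
    case (elim p)
    have "\<bar>(\<integral>y. indicator K y * f p y \<partial>lborel) - (\<integral>y. indicator K y * l y \<partial>lborel)\<bar> =
        \<bar>\<integral>y. indicator K y * f p y - indicator K y * l y \<partial>lborel\<bar>"
      by (simp add: Bochner_Integration.integral_diff[OF int[OF elim(2)] int[OF l]])
    also have "\<dots> \<le> (\<integral>y. \<bar>indicator K y * f p y - indicator K y * l y\<bar> \<partial>lborel)"
      by (rule integral_abs_bound)
    also have "\<dots> \<le> (\<integral>y. d * (indicator K y * 1) \<partial>lborel)"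
    proof (rule integral_mono)
      show "integrable lborel (\<lambda>y. \<bar>indicator K y * f p y - indicator K y * l y\<bar>)"
        by (intro integrable_abs Bochner_Integration.integrable_diff int elim l)
      show "integrable lborel (\<lambda>y :: real^'n. d * (indicator K y * 1))"
        by (intro integrable_mult_right int continuous_on_const)
      show "\<bar>indicator K y * f p y - indicator K y * l y\<bar> \<le> d * (indicator K y * 1)" for y
        using elim(1) by (cases "y \<in> K") (auto simp: dist_real_def intro: less_imp_le)
    qed
    also have "\<dots> = d * m" by (simp add: m_def)
    finally show ?case using d(2) by (simp add: dist_real_def)
  qed
qed

context closed_manifold
begin

definition kernel_functional ::
    "('m, 'n) chart \<Rightarrow> ('n \<Rightarrow> 'n \<Rightarrow> real^'n \<Rightarrow> real) \<Rightarrow> ('m, 'n) tensor2 \<Rightarrow> real" where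
  "kernel_functional c e h =
     (\<integral>y. (\<Sum>i\<in>UNIV. \<Sum>j\<in>UNIV. e i j y * h c (coord_inv c y) $ i $ j) \<partial>lborel)"

context
  fixes c :: "('m, 'n) chart" and e :: "'n \<Rightarrow> 'n \<Rightarrow> real^'n \<Rightarrow> real"
  assumes c: "c \<in> A" and e: "\<And>i j. compactly_supported (img c) (e i j)"
begin

lemma kernel_entry_integrable:
  "h \<in> sym_tensors A \<Longrightarrow> integrable lborel (\<lambda>y. e i j y * h c (coord_inv c y) $ i $ j)"
  by (intro compactly_supported_integrable[OF chart(2)[OF c]]
      compactly_supported_mult[OF chart(2)[OF c]] e sym_tensor_entry_smooth[OF _ c])

lemma kernel_functional_eq:
  assumes "h \<in> sym_tensors A"
  shows "kernel_functional c e h =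
    (\<Sum>i\<in>UNIV. \<Sum>j\<in>UNIV. \<integral>y. e i j y * h c (coord_inv c y) $ i $ j \<partial>lborel)"
  unfolding kernel_functional_def
  by (simp add: Bochner_Integration.integral_sum Bochner_Integration.integrable_sum kernel_entry_integrable assms)

lemma kernel_functional_add:
  assumes "h \<in> sym_tensors A" "k \<in> sym_tensors A"
  shows "kernel_functional c e (tensor_add h k) = kernel_functional c e h + kernel_functional c e k"
proof -
  have "(\<integral>y. e i j y * tensor_add h k c (coord_inv c y) $ i $ j \<partial>lborel) =
      (\<integral>y. e i j y * h c (coord_inv c y) $ i $ j \<partial>lborel) +
      (\<integral>y. e i j y * k c (coord_inv c y) $ i $ j \<partial>lborel)" for i j
    using Bochner_Integration.integral_add[OF kernel_entry_integrable[OF assms(1)] kernel_entry_integrable[OF assms(2)]]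
    by (simp add: tensor_add_def distrib_left)
  then show ?thesis
    by (simp add: kernel_functional_eq assms tensor_add_sym_tensor sum.distrib)
qed

lemma kernel_functional_scale:
  assumes "h \<in> sym_tensors A"
  shows "kernel_functional c e (tensor_scale (\<lambda>_. r) h) = r * kernel_functional c e h"
proof -
  have "(\<Sum>i\<in>UNIV. \<Sum>j\<in>UNIV. e i j y * tensor_scale (\<lambda>_. r) h c (coord_inv c y) $ i $ j) =
      r * (\<Sum>i\<in>UNIV. \<Sum>j\<in>UNIV. e i j y * h c (coord_inv c y) $ i $ j)" for y
    by (simp add: tensor_scale_def sum_distrib_left mult_ac)
  then show ?thesis by (simp add: kernel_functional_def)
qed

lemma kernel_functional_tendsto:
  assumes h: "h \<in> sym_tensors A"
  shows "(kernel_functional c e \<longlongrightarrow> kernel_functional c e h) (nhdsin (smooth_topology A) h)"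
proof -
  have "((\<lambda>k. \<integral>y. e i j y * k c (coord_inv c y) $ i $ j \<partial>lborel) \<longlongrightarrow>
      (\<integral>y. e i j y * h c (coord_inv c y) $ i $ j \<partial>lborel)) (nhdsin (smooth_topology A) h)" for i j
  proof -
    obtain K where K: "smooth_on (img c) (e i j)" "compact K" "K \<subseteq> img c" "\<And>y. y \<notin> K \<Longrightarrow> e i j y = 0"
      using e[of i j] unfolding compactly_supported_def by blast
    interpret smooth_convergence "img c" K "nhdsin (smooth_topology A) h"
      by standard (use K chart(2)[OF c] in auto)
    note lim = smooth_limit_mult[OF smooth_limit_self[OF K(1), of 0] smooth_limit_nhdsin[OF h c K(2,3), of 0 i j]]
    have cont: "continuous_on K f" if "smooth_on (img c) f" for f :: "real^'n \<Rightarrow> real"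
      by (rule continuous_on_subset[OF smooth_on_continuous[OF that] K(3)])
    have "((\<lambda>k. \<integral>y. indicator K y * (e i j y * k c (coord_inv c y) $ i $ j) \<partial>lborel) \<longlongrightarrow>
      (\<integral>y. indicator K y * (e i j y * h c (coord_inv c y) $ i $ j) \<partial>lborel)) (nhdsin (smooth_topology A) h)"
    proof (rule tendsto_integral_compact[OF K(2) smooth_limitD(3)[OF lim] _ cont[OF smooth_limitD(2)[OF lim]]])
      show "\<forall>\<^sub>F p in nhdsin (smooth_topology A) h. continuous_on K (\<lambda>y. e i j y * p c (coord_inv c y) $ i $ j)"
        using smooth_limitD(1)[OF lim] by eventually_elim (rule cont)
    qed
    moreover have "indicator K y * (e i j y * k c (coord_inv c y) $ i $ j) = e i j y * k c (coord_inv c y) $ i $ j"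
      for k y using K(4)[of y] by (cases "y \<in> K") simp_all
    ultimately show ?thesis by simp
  qed
  then have "((\<lambda>k. \<Sum>i\<in>UNIV. \<Sum>j\<in>UNIV. \<integral>y. e i j y * k c (coord_inv c y) $ i $ j \<partial>lborel) \<longlongrightarrow>
      kernel_functional c e h) (nhdsin (smooth_topology A) h)"
    unfolding kernel_functional_eq[OF h] by (intro tendsto_sum)
  then show ?thesis
  proof (rule Lim_transform_eventually)
    show "\<forall>\<^sub>F k in nhdsin (smooth_topology A) h.
        (\<Sum>i\<in>UNIV. \<Sum>j\<in>UNIV. \<integral>y. e i j y * k c (coord_inv c y) $ i $ j \<partial>lborel) = kernel_functional c e k"
      using eventually_nhdsin_sym_tensors[OF h] by eventually_elim (rule kernel_functional_eq[symmetric])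
  qed
qed

end

section \<open>The tensor representing a kernel functional\<close>

text \<open>The pairing of \<open>h\<close> and \<open>b\<close> at a point, where \<open>N\<close> is the inverse of the metric. As a trace it is
  visibly invariant under changes of coordinates.\<close>

definition contract :: "real^'k^'k \<Rightarrow> real^'k^'k \<Rightarrow> real^'k^'k \<Rightarrow> real" where
  "contract N h b = (\<Sum>i\<in>UNIV. \<Sum>j\<in>UNIV. \<Sum>k\<in>UNIV. \<Sum>l\<in>UNIV. N $ i $ k * N $ j $ l * h $ i $ j * b $ k $ l)"

lemma contract_eq_trace: "contract N h b = trace (transpose N ** h ** N ** transpose b)"
proof -
  have "trace (transpose N ** h ** N ** transpose b) =
      (\<Sum>k\<in>UNIV. \<Sum>l\<in>UNIV. \<Sum>j\<in>UNIV. \<Sum>i\<in>UNIV. N $ i $ k * N $ j $ l * h $ i $ j * b $ k $ l)"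
    by (simp add: trace_def matrix_matrix_mult_def transpose_def sum_distrib_right sum_distrib_left mult_ac)
  also have "\<dots> = (\<Sum>k\<in>UNIV. \<Sum>j\<in>UNIV. \<Sum>i\<in>UNIV. \<Sum>l\<in>UNIV. N $ i $ k * N $ j $ l * h $ i $ j * b $ k $ l)"
    by (rule sum.cong[OF refl], subst sum.swap, rule sum.cong[OF refl], rule sum.swap)
  also have "\<dots> = (\<Sum>j\<in>UNIV. \<Sum>i\<in>UNIV. \<Sum>k\<in>UNIV. \<Sum>l\<in>UNIV. N $ i $ k * N $ j $ l * h $ i $ j * b $ k $ l)"
    by (subst sum.swap, rule sum.cong[OF refl], rule sum.swap)
  also have "\<dots> = contract N h b" unfolding contract_def by (rule sum.swap)
  finally show ?thesis ..
qed

lemma matrix_inv_unique: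
  fixes G N :: "real^'k^'k"
  assumes "G ** N = mat 1"
  shows "matrix_inv G = N"
proof -
  have "det G \<noteq> 0" using assms by (metis det_I det_mul mult_zero_left zero_neq_one)
  then have "matrix_inv G ** (G ** N) = N"
    by (simp add: matrix_mul_assoc matrix_inv_mult(2))
  then show ?thesis using assms by simp
qed

text \<open>The product under the trace is conjugated by \<open>J\<close>.\<close>

lemma contract_change:
  fixes J J' G h b :: "real^'k^'k"
  assumes J: "J' ** J = mat 1" "J ** J' = mat 1" and G: "det G \<noteq> 0"
  shows "contract (matrix_inv (transpose J ** G ** J)) (transpose J ** h ** J) (transpose J ** b ** J) =
    contract (matrix_inv G) h b"
proof -
  define N where "N = matrix_inv G"
  have T: "transpose J' ** transpose J = mat 1" "transpose J ** transpose J' = mat 1"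
    using J by (simp_all add: matrix_transpose_mul[symmetric] transpose_mat)
  have "(transpose J ** G ** J) ** (J' ** N ** transpose J') =
      transpose J ** (G ** (J ** J') ** N) ** transpose J'"
    by (simp only: matrix_mul_assoc)
  also have "\<dots> = mat 1" by (simp add: J N_def matrix_inv_mult(1)[OF G] T)
  finally have inv: "matrix_inv (transpose J ** G ** J) = J' ** N ** transpose J'"
    by (rule matrix_inv_unique)
  have "transpose (J' ** N ** transpose J') ** (transpose J ** h ** J) ** (J' ** N ** transpose J') **
      transpose (transpose J ** b ** J) =
      J' ** (transpose N ** (transpose J' ** transpose J) ** h ** (J ** J') ** N ** (transpose J' ** transpose J) **
      transpose b ** J)"
    by (simp only: matrix_transpose_mul transpose_transpose matrix_mul_assoc)
  also have "\<dots> = J' ** ((transpose N ** h ** N ** transpose b) ** J)"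
    by (simp only: J T matrix_mul_rid matrix_mul_lid matrix_mul_assoc)
  finally have "contract (matrix_inv (transpose J ** G ** J)) (transpose J ** h ** J) (transpose J ** b ** J) =
      trace (J' ** ((transpose N ** h ** N ** transpose b) ** J))"
    by (simp only: contract_eq_trace inv)
  also have "\<dots> = trace ((transpose N ** h ** N ** transpose b) ** (J ** J'))"
    by (subst trace_mul_sym) (simp only: matrix_mul_assoc)
  finally show ?thesis by (simp add: J contract_eq_trace N_def)
qed

lemma pairing_eq_contract:
  assumes g: "g \<in> metrics A" and h: "h \<in> sym_tensors A" and b: "b \<in> sym_tensors A" and c: "c \<in> A" "x \<in> dom_of c"
  shows "pairing A g h b x = contract (matrix_inv (g c x)) (h c x) (b c x)"
proof -
  define c0 where "c0 = (SOME c. c \<in> A \<and> x \<in> dom_of c)"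
  have c0: "c0 \<in> A \<and> x \<in> dom_of c0" unfolding c0_def by (rule someI_ex) (use c in blast)
  have "pairing A g h b x = contract (matrix_inv (g c0 x)) (h c0 x) (b c0 x)"
    by (simp add: pairing_def Let_def c0_def[symmetric] contract_def)
  also have "\<dots> = contract (matrix_inv (transpose (jacobian c c0 id x) ** g c0 x ** jacobian c c0 id x))
      (transpose (jacobian c c0 id x) ** h c0 x ** jacobian c c0 id x)
      (transpose (jacobian c c0 id x) ** b c0 x ** jacobian c c0 id x)"
    by (rule contract_change[symmetric, OF
          jacobian_id_inverse[OF c(1) conjunct1[OF c0] c(2) conjunct2[OF c0]]
          jacobian_id_inverse[OF conjunct1[OF c0] c(1) conjunct2[OF c0] c(2)]
          positive_definite_det_nz[OF metric_positive_definite[OF g conjunct1[OF c0] conjunct2[OF c0]]]])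
  also have "\<dots> = contract (matrix_inv (g c x)) (h c x) (b c x)"
    using sym_tensorsD(3)[OF metrics_sym_tensors[OF g] c(1) conjunct1[OF c0] c(2) conjunct2[OF c0]]
      sym_tensorsD(3)[OF h c(1) conjunct1[OF c0] c(2) conjunct2[OF c0]]
      sym_tensorsD(3)[OF b c(1) conjunct1[OF c0] c(2) conjunct2[OF c0]]
    by simp
  finally show ?thesis .
qed

text \<open>Lowering both indices of \<open>E\<close> with \<open>G\<close> undoes the contraction with the inverse of \<open>G\<close>.\<close>

lemma contract_lowered:
  fixes G h E :: "real^'k^'k"
  assumes "det G \<noteq> 0" "transpose G = G" "transpose E = E"
  shows "contract (matrix_inv G) h (r *\<^sub>R (G ** E ** G)) = r * (\<Sum>i\<in>UNIV. \<Sum>j\<in>UNIV. E $ i $ j * h $ i $ j)"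
proof -
  define N where "N = matrix_inv G"
  have N: "G ** N = mat 1" "N ** G = mat 1" using matrix_inv_mult[OF assms(1)] by (simp_all add: N_def)
  have "G ** transpose N = mat 1"
    using arg_cong[OF N(2), of transpose] by (simp add: matrix_transpose_mul assms(2) transpose_mat)
  then have Ns: "transpose N = N" using matrix_inv_unique by (metis N_def)
  have "transpose N ** h ** N ** transpose (G ** E ** G) = N ** (h ** (N ** G) ** E ** G)"
    by (simp only: Ns matrix_transpose_mul assms matrix_mul_assoc)
  also have "\<dots> = N ** (h ** E ** G)" by (simp only: N matrix_mul_rid)
  finally have "trace (transpose N ** h ** N ** transpose (G ** E ** G)) = trace (h ** E ** (G ** N))"
    by (simp only:) (subst trace_mul_sym, simp only: matrix_mul_assoc)
  also have "\<dots> = trace (h ** E)" by (simp only: N matrix_mul_rid)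
  also have "\<dots> = (\<Sum>i\<in>UNIV. \<Sum>j\<in>UNIV. E $ j $ i * h $ i $ j)"
    by (simp add: trace_def matrix_matrix_mult_def mult.commute)
  also have "\<dots> = (\<Sum>i\<in>UNIV. \<Sum>j\<in>UNIV. E $ i $ j * h $ i $ j)"
  proof -
    have "E $ j $ i = E $ i $ j" for i j
      using arg_cong[OF assms(3), of "\<lambda>M. M $ i $ j"] by (simp add: transpose_def)
    then show ?thesis by simp
  qed
  finally have "contract N h (G ** E ** G) = (\<Sum>i\<in>UNIV. \<Sum>j\<in>UNIV. E $ i $ j * h $ i $ j)"
    by (simp only: contract_eq_trace)
  moreover have "contract N h (r *\<^sub>R b) = r * contract N h b" for b
    by (simp add: contract_def sum_distrib_left mult_ac)
  ultimately show ?thesis by (simp add: N_def)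
qed

text \<open>Integrability is included so that representing tensors of two functionals can be added.\<close>

definition represents ::
    "('m, 'n) tensor2 \<Rightarrow> ('m, 'n) tensor2 \<Rightarrow> (('m, 'n) tensor2 \<Rightarrow> real) \<Rightarrow> bool" where
  "represents g B L \<longleftrightarrow> B \<in> sym_tensors A \<and> (\<forall>h\<in>sym_tensors A.
     integrable (riemannian_measure A g) (pairing A g h B) \<and>
     L h = (\<integral>x. pairing A g h B x \<partial>riemannian_measure A g))"

text \<open>Lowering the indices of the kernel and dividing by the volume density gives a tensor field with
  compact support in the chart, which extends by zero.\<close>

lemma kernel_functional_represented:
  assumes g: "g \<in> metrics A" and c: "c \<in> A" and e: "\<And>i j. compactly_supported (img c) (e i j)"
  shows "\<exists>B. represents g B (kernel_functional c e)"
proof -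
  note gs = metrics_sym_tensors[OF g]
  note U = chart(2)[OF c]
  have "\<forall>p. \<exists>K. compact K \<and> K \<subseteq> img c \<and> (\<forall>y. y \<notin> K \<longrightarrow> e (fst p) (snd p) y = 0)"
    using e unfolding compactly_supported_def by blast
  from choice[OF this] obtain K0 where K0: "\<forall>p. compact (K0 p) \<and> K0 p \<subseteq> img c \<and>
      (\<forall>y. y \<notin> K0 p \<longrightarrow> e (fst p) (snd p) y = 0)" by blast
  define K where "K = (\<Union>p. K0 p)"
  have K: "compact K" "K \<subseteq> img c" "\<And>i j y. y \<notin> K \<Longrightarrow> e i j y = 0"
  proof -
    show "compact K" unfolding K_def using K0 by (intro compact_UN) auto
    show "K \<subseteq> img c" unfolding K_def using K0 by blast
    show "e i j y = 0" if "y \<notin> K" for i j y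
    proof -
      have "y \<notin> K0 (i, j)" using that unfolding K_def by blast
      then show ?thesis using spec[OF K0, of "(i, j)"] by simp
    qed
  qed
  have es: "smooth_on (img c) (e i j)" for i j using e by (simp add: compactly_supported_def)
  \<comment> \<open>Against symmetric tensors only the symmetric part of the kernel counts.\<close>
  define E where "E y = (\<chi> i j. (e i j y + e j i y) / 2)" for y
  define G where "G y = g c (coord_inv c y)" for y
  define b where "b y = inverse (vol g c y) *\<^sub>R (G y ** E y ** G y)" for y
  have pd: "positive_definite (G y)" if "y \<in> img c" for y
    unfolding G_def by (rule metric_positive_definite[OF g c chart(5)[OF c that]])
  have Gs: "transpose (G y) = G y" if "y \<in> img c" for y
    unfolding G_def by (rule sym_tensorsD(2)[OF gs c chart(5)[OF c that]])
  have Es: "transpose (E y) = E y" for y by (simp add: E_def transpose_def add.commute)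
  have volpos: "vol g c y > 0" if "y \<in> img c" for y
    using positive_definite_det_pos[OF pd[OF that]] by (simp add: vol_def G_def)
  have vols: "smooth_on (img c) (vol g c)"
    unfolding vol_def
    by (rule smooth_on_sqrt[OF U smooth_on_det[OF U sym_tensor_entry_smooth[OF gs c]]])
       (use positive_definite_det_pos[OF pd] in \<open>simp add: G_def\<close>)
  have invvol: "smooth_on (img c) (\<lambda>y. inverse (vol g c y))"
    by (rule smooth_on_inverse[OF U vols]) (use volpos in fastforce)
  have bs: "smooth_on (img c) b"
  proof -
    have Ge: "smooth_on (img c) (\<lambda>y. G y $ i $ j)" for i j
      unfolding G_def by (rule sym_tensor_entry_smooth[OF gs c])
    have Ee: "smooth_on (img c) (\<lambda>y. E y $ i $ j)" for i j
      using smooth_on_mult[OF U smooth_on_const[of _ "1 / 2"] smooth_on_add[OF U es[of i j] es[of j i]]]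
      by (simp add: E_def)
    have "smooth_on (img c) (\<lambda>y. \<Sum>k\<in>UNIV. (\<Sum>l\<in>UNIV. G y $ i $ l * E y $ l $ k) * G y $ k $ j)" for i j
      by (rule smooth_on_sum[OF U], rule smooth_on_mult[OF U _ Ge], rule smooth_on_sum[OF U],
          rule smooth_on_mult[OF U Ge Ee])
    then have "smooth_on (img c) (\<lambda>y. G y ** E y ** G y)"
      using U by (simp add: smooth_on_vec_iff matrix_matrix_mult_def)
    from smooth_on_scaleR[OF U invvol this] show ?thesis by (simp add: b_def[abs_def])
  qed
  have b0: "b y = 0" if "y \<notin> K" for y
  proof -
    have "E y = 0" using K(3)[OF that] by (simp add: E_def vec_eq_iff)
    then show ?thesis by (simp add: b_def)
  qed
  have bsym: "transpose (b y) = b y" if "y \<in> img c" for y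
    unfolding b_def
    by (simp add: transpose_scalar matrix_transpose_mul Gs[OF that] Es matrix_mul_assoc)
  define B where "B c' x = (if c' \<in> A \<and> x \<in> dom_of c' \<and> x \<in> dom_of c then
      transpose (jacobian c' c id x) ** b (coord c x) ** jacobian c' c id x else 0)" for c' x
  have B: "B \<in> sym_tensors A"
    unfolding sym_tensors_def mem_Collect_eq
  proof (intro conjI allI ballI impI)
    show "B c' x = 0" if "c' \<notin> A \<or> x \<notin> dom_of c'" for c' x using that by (auto simp: B_def)
    show "transpose (B c' x) = B c' x" if "c' \<in> A" "x \<in> dom_of c'" for c' x
      by (simp add: B_def matrix_transpose_mul matrix_mul_assoc bsym transpose_def[of 0] zero_vec_def[symmetric])
    show "B c' x = transpose (jacobian c' c'' id x) ** B c'' x ** jacobian c' c'' id x"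
      if "c' \<in> A" "c'' \<in> A" "x \<in> dom_of c' \<inter> dom_of c''" for c' c'' x
    proof (cases "x \<in> dom_of c")
      case True
      have "jacobian c' c id x = jacobian c'' c id x ** jacobian c' c'' id x"
        using jacobian_compose[OF smooth_map_id smooth_map_id that(1,2) c, of x] that(3) True
        by (simp add: id_def)
      then show ?thesis using that True by (simp add: B_def congruence_mult)
    qed (simp add: B_def)
    show "smooth_on (img c') (B c' \<circ> coord_inv c')" if c': "c' \<in> A" for c'
    proof -
      note W = expr_dom(1)[OF smooth_map_id c' c]
      have "smooth_on (expr_dom c' c id) (\<lambda>y. transpose (jacobian c' c id (coord_inv c' y)) **
          b (coord c (id (coord_inv c' y))) ** jacobian c' c id (coord_inv c' y))"
        by (rule smooth_on_transported[OF smooth_map_id c' c bs])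
      also have "?this \<longleftrightarrow> smooth_on (expr_dom c' c id) (B c' \<circ> coord_inv c')"
        by (rule smooth_on_cong[OF W]) (auto simp: expr_dom_def B_def chart(3)[OF c'] c')
      finally have 1: "smooth_on (expr_dom c' c id) (B c' \<circ> coord_inv c')" .
      have "smooth_on (coord c' ` (dom_of c' - coord_inv c ` K)) (\<lambda>y. 0 :: real^'n^'n)"
        by (rule smooth_on_const)
      also have "?this \<longleftrightarrow> smooth_on (coord c' ` (dom_of c' - coord_inv c ` K)) (B c' \<circ> coord_inv c')"
      proof (rule smooth_on_cong[OF coord_image_diff_compact(1)[OF c c' K(1,2)]])
        fix y assume "y \<in> coord c' ` (dom_of c' - coord_inv c ` K)"
        then obtain x where x: "x \<in> dom_of c'" "x \<notin> coord_inv c ` K" "y = coord c' x" by auto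
        have "b (coord c x) = 0" if "x \<in> dom_of c"
        proof (rule b0)
          show "coord c x \<notin> K" using x(2) chart(3)[OF c that] by (metis image_eqI)
        qed
        then show "0 = (B c' \<circ> coord_inv c') y" using x chart(3)[OF c' x(1)] by (simp add: B_def)
      qed
      finally show ?thesis
        unfolding coord_image_diff_compact(2)[OF c c' K(1,2)] using 1 by (intro smooth_on_Un)
    qed
  qed
  have "integrable (riemannian_measure A g) (pairing A g h B) \<and>
      kernel_functional c e h = (\<integral>x. pairing A g h B x \<partial>riemannian_measure A g)" if h: "h \<in> sym_tensors A" for h
  proof -
    define H where "H y = h c (coord_inv c y)" for y
    define u where "u y = inverse (vol g c y) * (\<Sum>i\<in>UNIV. \<Sum>j\<in>UNIV. E y $ i $ j * H y $ i $ j)" for y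
    define f where "f x = (if x \<in> dom_of c then u (coord c x) else 0)" for x
    have Hs: "H y $ i $ j = H y $ j $ i" if "y \<in> img c" for y i j
      using arg_cong[OF sym_tensorsD(2)[OF h c chart(5)[OF c that]], of "\<lambda>M. M $ j $ i"]
      by (simp add: H_def transpose_def)
    have pair: "pairing A g h B x = f x" for x
    proof (cases "x \<in> dom_of c")
      case True
      have "pairing A g h B x = contract (matrix_inv (g c x)) (h c x) (B c x)"
        by (rule pairing_eq_contract[OF g h B c True])
      also have "B c x = b (coord c x)"
        using True c by (simp add: B_def jacobian_id_self transpose_mat)
      also have "contract (matrix_inv (g c x)) (h c x) (b (coord c x)) = u (coord c x)"
        using contract_lowered[OF positive_definite_det_nz[OF pd[OF imageI[OF True]]] Gs[OF imageI[OF True]] Es] True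
        unfolding b_def u_def by (simp add: G_def H_def chart(3)[OF c])
      finally show ?thesis using True by (simp add: f_def)
    next
      case False
      have "B c' x = 0" for c' using False by (simp add: B_def)
      then show ?thesis using False by (simp add: f_def pairing_def Let_def)
    qed
    have us: "smooth_on (img c) u"
    proof -
      have "smooth_on (img c) (\<lambda>y. E y $ i $ j)" for i j
        using smooth_on_mult[OF U smooth_on_const[of _ "1 / 2"] smooth_on_add[OF U es[of i j] es[of j i]]]
        by (simp add: E_def)
      from smooth_on_mult[OF U this sym_tensor_entry_smooth[OF h c]]
      have "smooth_on (img c) (\<lambda>y. \<Sum>i\<in>UNIV. \<Sum>j\<in>UNIV. E y $ i $ j * H y $ i $ j)"
        unfolding H_def by (intro smooth_on_sum U)
      from smooth_on_mult[OF U invvol this] show ?thesis by (simp add: u_def[abs_def])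
    qed
    have u0: "u y = 0" if "y \<notin> K" for y
      using K(3)[OF that] by (simp add: u_def E_def)
    have "f \<in> smooth_functions A"
      unfolding f_def by (rule smooth_function_extension[OF c K(1,2) us u0])
    then have fc: "continuous_on UNIV f" by (rule smooth_function_continuous)
    have f0: "f x = 0" if "x \<notin> coord_inv c ` K" for x
    proof (cases "x \<in> dom_of c")
      case True
      have "coord c x \<notin> K" using that chart(3)[OF c True] by (metis image_eqI)
      then show ?thesis by (simp add: f_def u0)
    qed (simp add: f_def)
    note int = integrable_supported_in_chart[OF g c fc K(1,2) f0]
    have "(\<integral>x. f x \<partial>riemannian_measure A g) = (\<integral>y. indicator K y * (f (coord_inv c y) * vol g c y) \<partial>lborel)"
      by (rule int(2))
    also have "\<dots> = (\<integral>y. (\<Sum>i\<in>UNIV. \<Sum>j\<in>UNIV. E y $ i $ j * H y $ i $ j) \<partial>lborel)"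
    proof (rule Bochner_Integration.integral_cong[OF refl])
      fix y
      show "indicator K y * (f (coord_inv c y) * vol g c y) = (\<Sum>i\<in>UNIV. \<Sum>j\<in>UNIV. E y $ i $ j * H y $ i $ j)"
      proof (cases "y \<in> K")
        case True
        then have y: "y \<in> img c" using K(2) by blast
        then show ?thesis
          using True volpos[OF y] by (simp add: f_def chart(4,5)[OF c y] u_def)
      next
        case False
        then show ?thesis using K(3)[OF False] by (simp add: E_def)
      qed
    qed
    also have "\<dots> = (\<integral>y. (\<Sum>i\<in>UNIV. \<Sum>j\<in>UNIV. e i j y * H y $ i $ j) \<partial>lborel)"
    proof (rule Bochner_Integration.integral_cong[OF refl])
      fix y
      show "(\<Sum>i\<in>UNIV. \<Sum>j\<in>UNIV. E y $ i $ j * H y $ i $ j) = (\<Sum>i\<in>UNIV. \<Sum>j\<in>UNIV. e i j y * H y $ i $ j)"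
      proof (cases "y \<in> K")
        case True
        then have y: "y \<in> img c" using K(2) by blast
        have "(\<Sum>i\<in>UNIV. \<Sum>j\<in>UNIV. e j i y * H y $ i $ j) = (\<Sum>i\<in>UNIV. \<Sum>j\<in>UNIV. e j i y * H y $ j $ i)"
          by (intro sum.cong refl) (metis Hs[OF y])
        also have "\<dots> = (\<Sum>i\<in>UNIV. \<Sum>j\<in>UNIV. e i j y * H y $ i $ j)" by (rule sum.swap)
        finally have sw: "(\<Sum>i\<in>UNIV. \<Sum>j\<in>UNIV. e j i y * H y $ i $ j) = (\<Sum>i\<in>UNIV. \<Sum>j\<in>UNIV. e i j y * H y $ i $ j)" .
        have "(\<Sum>i\<in>UNIV. \<Sum>j\<in>UNIV. E y $ i $ j * H y $ i $ j) =
            (\<Sum>i\<in>UNIV. \<Sum>j\<in>UNIV. e i j y * H y $ i $ j + e j i y * H y $ i $ j) / 2"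
          unfolding sum_divide_distrib
          by (intro sum.cong refl) (simp add: E_def distrib_right)
        then show ?thesis by (simp add: sum.distrib sw)
      next
        case False
        then show ?thesis using K(3)[OF False] by (simp add: E_def)
      qed
    qed
    finally have "(\<integral>x. f x \<partial>riemannian_measure A g) = kernel_functional c e h"
      by (simp add: kernel_functional_def H_def)
    then show ?thesis using int(1) by (simp add: pair[abs_def])
  qed
  then show ?thesis using B unfolding represents_def by blast
qed

lemma represents_sum:
  assumes "finite I" "\<And>a. a \<in> I \<Longrightarrow> \<exists>B. represents g B (L a)"
  shows "\<exists>B. represents g B (\<lambda>h. \<Sum>a\<in>I. L a h)"
  using assms
proof (induction I)
  case empty
  have z: "(\<lambda>c x. 0) \<in> sym_tensors A"
    unfolding sym_tensors_def by (auto simp: o_def smooth_on_const transpose_def vec_eq_iff)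
  have "pairing A g h (\<lambda>c x. 0) = (\<lambda>x. 0)" for h by (simp add: pairing_def Let_def fun_eq_iff)
  then have "represents g (\<lambda>c x. 0) (\<lambda>h. 0)" using z by (simp add: represents_def)
  then show ?case by auto
next
  case (insert a I)
  obtain B1 where B1: "represents g B1 (L a)" using insert by blast
  obtain B2 where B2: "represents g B2 (\<lambda>h. \<Sum>a\<in>I. L a h)" using insert by blast
  have "pairing A g h (tensor_add B1 B2) = (\<lambda>x. pairing A g h B1 x + pairing A g h B2 x)" for h
    by (simp add: pairing_def Let_def fun_eq_iff tensor_add_def distrib_left sum.distrib)
  then have "represents g (tensor_add B1 B2) (\<lambda>h. L a h + (\<Sum>a\<in>I. L a h))"
    using B1 B2 tensor_add_sym_tensor by (simp add: represents_def)
  then show ?case using insert by auto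
qed

section \<open>The integral of a natural invariant as a functional of the metric\<close>

text \<open>The factor \<open>r\<close> makes the results applicable both to a natural invariant and to its constant
  multiples.\<close>

context
  fixes V :: "('m, 'n) tensor2 \<Rightarrow> 'm \<Rightarrow> real" and r :: real and P :: "'n jet_var real_mpoly"
  assumes V: "\<And>g c x. g \<in> metrics A \<Longrightarrow> c \<in> A \<Longrightarrow> x \<in> dom_of c \<Longrightarrow>
    V g x = r * eval_mpoly (jet_value g c x) P"
begin

definition energy :: "('m, 'n) tensor2 \<Rightarrow> real" where
  "energy g = (\<integral>x. V g x \<partial>riemannian_measure A g)"

lemma invariant_smooth:
  assumes g: "g \<in> metrics A"
  shows "V g \<in> smooth_functions A"
proof (rule smooth_functionsI)
  fix c assume c: "c \<in> A"
  \<comment> \<open>Linearizability includes smoothness on the image of the chart, for any compact set and so for the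
    empty one.\<close>
  have "linearizable g c {} (\<lambda>g y. r * eval_mpoly (jet_value g c (coord_inv c y)) P)"
    by (rule linearizable_mult[OF g c compact_empty empty_subsetI linearizable_const[OF g c compact_empty empty_subsetI]
          linearizable_eval_mpoly[OF g c compact_empty empty_subsetI]])
  then have "smooth_on (img c) (\<lambda>y. r * eval_mpoly (jet_value g c (coord_inv c y)) P)"
    by (auto simp: linearizable_def linearizes_def)
  then show "smooth_on (img c) (\<lambda>y. V g (coord_inv c y))"
    by (rule smooth_on_cong[OF chart(2)[OF c], THEN iffD2, rotated]) (simp add: V[OF g c chart(5)[OF c]])
qed

lemma energy_in_charts:
  assumes g: "g \<in> metrics A" and I: "finite I" and cs: "\<And>a. cs a \<in> A" and K: "\<And>a. compact (K a)" "\<And>a. K a \<subseteq> img (cs a)"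
    and \<psi>: "\<And>a. \<psi> a \<in> smooth_functions A" "\<And>a x. x \<notin> coord_inv (cs a) ` K a \<Longrightarrow> \<psi> a x = 0"
      "\<And>x. (\<Sum>a\<in>I. \<psi> a x) = 1"
  shows "energy g = (\<Sum>a\<in>I. \<integral>y. indicator (K a) y * (\<psi> a (coord_inv (cs a) y) *
    (r * eval_mpoly (jet_value g (cs a) (coord_inv (cs a) y)) P * vol g (cs a) y)) \<partial>lborel)"
proof -
  have c: "continuous_on UNIV (\<lambda>x. \<psi> a x * V g x)" for a
    by (rule smooth_function_continuous[OF smooth_function_mult[OF \<psi>(1) invariant_smooth[OF g]]])
  have s: "\<psi> a x * V g x = 0" if "x \<notin> coord_inv (cs a) ` K a" for a x
    using \<psi>(2)[OF that] by simp
  note int = integrable_supported_in_chart[OF g cs c K s]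
  have "V g x = (\<Sum>a\<in>I. \<psi> a x * V g x)" for x
    by (simp add: sum_distrib_right[symmetric] \<psi>(3))
  then have "energy g = (\<integral>x. (\<Sum>a\<in>I. \<psi> a x * V g x) \<partial>riemannian_measure A g)"
    by (simp add: energy_def)
  also have "\<dots> = (\<Sum>a\<in>I. \<integral>x. \<psi> a x * V g x \<partial>riemannian_measure A g)"
    by (rule Bochner_Integration.integral_sum) (rule int(1))
  also have "\<dots> = (\<Sum>a\<in>I. \<integral>y. indicator (K a) y * (\<psi> a (coord_inv (cs a) y) *
    (r * eval_mpoly (jet_value g (cs a) (coord_inv (cs a) y)) P * vol g (cs a) y)) \<partial>lborel)"
  proof (rule sum.cong[OF refl])
    fix a
    have "(\<integral>x. \<psi> a x * V g x \<partial>riemannian_measure A g) = (\<integral>y. indicator (K a) y *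
        (\<psi> a (coord_inv (cs a) y) * V g (coord_inv (cs a) y) * vol g (cs a) y) \<partial>lborel)" by (rule int(2))
    also have "\<dots> = (\<integral>y. indicator (K a) y * (\<psi> a (coord_inv (cs a) y) *
        (r * eval_mpoly (jet_value g (cs a) (coord_inv (cs a) y)) P * vol g (cs a) y)) \<partial>lborel)"
    proof (rule Bochner_Integration.integral_cong[OF refl])
      fix y
      have "V g (coord_inv (cs a) y) = r * eval_mpoly (jet_value g (cs a) (coord_inv (cs a) y)) P" if "y \<in> K a"
        using that K(2) by (intro V[OF g cs chart(5)[OF cs]]) blast
      then show "indicator (K a) y * (\<psi> a (coord_inv (cs a) y) * V g (coord_inv (cs a) y) * vol g (cs a) y) =
          indicator (K a) y * (\<psi> a (coord_inv (cs a) y) *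
          (r * eval_mpoly (jet_value g (cs a) (coord_inv (cs a) y)) P * vol g (cs a) y))"
        by (cases "y \<in> K a") simp_all
    qed
    finally show "(\<integral>x. \<psi> a x * V g x \<partial>riemannian_measure A g) = (\<integral>y. indicator (K a) y * (\<psi> a (coord_inv (cs a) y) *
        (r * eval_mpoly (jet_value g (cs a) (coord_inv (cs a) y)) P * vol g (cs a) y)) \<partial>lborel)" .
  qed
  finally show ?thesis .
qed

text \<open>In each chart the integrand is linearised under the integral, and integration by parts turns
  the linearisation into a kernel functional.\<close>

lemma energy_derivative:
  assumes g: "g \<in> metrics A"
  shows "\<exists>L B. has_functional_derivative A energy g L \<and> represents g B L"
proof -
  obtain I :: "'m set" and cs K and \<psi> :: "'m \<Rightarrow> 'm \<Rightarrow> real" where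
    I: "finite I" and cs: "\<And>a. cs a \<in> A" and K: "\<And>a. compact (K a)" "\<And>a. K a \<subseteq> img (cs a)"
    and \<psi>: "\<And>a. \<psi> a \<in> smooth_functions A" "\<And>a x. x \<notin> coord_inv (cs a) ` K a \<Longrightarrow> \<psi> a x = 0"
      "\<And>x. (\<Sum>a\<in>I. \<psi> a x) = 1"
    by (rule partition_of_unity) blast
  define \<Phi> where "\<Phi> a g y = r * eval_mpoly (jet_value g (cs a) (coord_inv (cs a) y)) P * vol g (cs a) y" for a g y
  have "linearizable g (cs a) (K a) (\<Phi> a)" for a
    unfolding \<Phi>_def
    by (rule linearizable_mult[OF g cs K linearizable_mult[OF g cs K linearizable_const[OF g cs K]
          linearizable_eval_mpoly[OF g cs K]] linearizable_vol[OF g cs K]])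
  then have "\<forall>a. \<exists>D. linearizes g (cs a) (K a) (\<Phi> a) D" by (simp add: linearizable_def)
  from choice[OF this] obtain D where D: "\<And>a. linearizes g (cs a) (K a) (\<Phi> a) (D a)" by blast
  \<comment> \<open>the partition read in the charts; the indicator makes the support compact also outside the image
    of the chart, where \<open>coord_inv\<close> is arbitrary\<close>
  define f where "f a y = indicator (K a) y * \<psi> a (coord_inv (cs a) y)" for a y
  have f_img: "f a y = \<psi> a (coord_inv (cs a) y)" if "y \<in> img (cs a)" for a y
  proof (cases "y \<in> K a")
    case False
    have "coord_inv (cs a) y \<notin> coord_inv (cs a) ` K a"
    proof
      assume "coord_inv (cs a) y \<in> coord_inv (cs a) ` K a"
      then obtain z where z: "z \<in> K a" "coord_inv (cs a) y = coord_inv (cs a) z" by blast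
      then have "coord (cs a) (coord_inv (cs a) y) = coord (cs a) (coord_inv (cs a) z)" by simp
      then have "y = z" unfolding chart(4)[OF cs that] chart(4)[OF cs subsetD[OF K(2) z(1)]] .
      then show False using z(1) False by blast
    qed
    then show ?thesis by (simp add: f_def \<psi>(2))
  qed (simp add: f_def)
  have fs: "smooth_on (img (cs a)) (f a)" for a
    by (rule smooth_on_cong[OF chart(2)[OF cs], THEN iffD2, OF _ smooth_functionsD[OF \<psi>(1) cs]])
       (rule f_img)
  have fcs: "compactly_supported (img (cs a)) (f a)" for a
    unfolding compactly_supported_def
    by (intro conjI fs exI[of _ "K a"] K allI impI) (simp add: f_def)
  have "\<forall>a. \<exists>e. (\<forall>i j. compactly_supported (img (cs a)) (e i j)) \<and> (\<forall>H. smooth_on (img (cs a)) H \<longrightarrow>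
      (\<integral>y. f a y * D a H y \<partial>lborel) = (\<integral>y. (\<Sum>i\<in>UNIV. \<Sum>j\<in>UNIV. e i j y * H y $ i $ j) \<partial>lborel))"
    using D fcs unfolding linearizes_def has_adjoint_def by blast
  from choice[OF this] obtain e where e: "\<And>a i j. compactly_supported (img (cs a)) (e a i j)"
    "\<And>a H. smooth_on (img (cs a)) H \<Longrightarrow>
      (\<integral>y. f a y * D a H y \<partial>lborel) = (\<integral>y. (\<Sum>i\<in>UNIV. \<Sum>j\<in>UNIV. e a i j y * H y $ i $ j) \<partial>lborel)"
    by blast
  define L where "L h = (\<Sum>a\<in>I. kernel_functional (cs a) (e a) h)" for h
  have Lh: "L h = (\<Sum>a\<in>I. \<integral>y. f a y * D a (\<lambda>y. h (cs a) (coord_inv (cs a) y)) y \<partial>lborel)" if "h \<in> sym_tensors A" for h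
    unfolding L_def kernel_functional_def by (simp add: e(2)[OF sym_tensorsD(4)[OF that cs]])
  have energy_eq: "energy g' = (\<Sum>a\<in>I. \<integral>y. indicator (K a) y * (f a y * \<Phi> a g' y) \<partial>lborel)" if g': "g' \<in> metrics A" for g'
  proof -
    have "indicator (K a) y * (\<psi> a (coord_inv (cs a) y) * \<Phi> a g' y) = indicator (K a) y * (f a y * \<Phi> a g' y)" for a y
      by (simp add: f_def indicator_def)
    moreover have "energy g' = (\<Sum>a\<in>I. \<integral>y. indicator (K a) y * (\<psi> a (coord_inv (cs a) y) * \<Phi> a g' y) \<partial>lborel)"
      unfolding \<Phi>_def by (rule energy_in_charts[OF g' I cs K \<psi>])
    ultimately show ?thesis by (simp only:)
  qed
  have \<Phi>s: "smooth_on (img (cs a)) (\<Phi> a g')" if g': "g' \<in> metrics A" for a g'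
  proof -
    have "linearizable g' (cs a) (K a) (\<Phi> a)"
      unfolding \<Phi>_def
      by (rule linearizable_mult[OF g' cs K linearizable_mult[OF g' cs K linearizable_const[OF g' cs K]
            linearizable_eval_mpoly[OF g' cs K]] linearizable_vol[OF g' cs K]])
    then show ?thesis by (auto simp: linearizable_def linearizes_def)
  qed
  have cont: "continuous_on (K a) u" if "smooth_on (img (cs a)) u" for a and u :: "real^'n \<Rightarrow> real"
    by (rule continuous_on_subset[OF smooth_on_continuous[OF that] K(2)])
  have lim: "((\<lambda>p. (energy (perturb g p) - energy g) / fst p) \<longlongrightarrow> L h) (variation_filter h)"
    if h: "h \<in> sym_tensors A" for h
  proof -
    define dh where "dh a = D a (\<lambda>y. h (cs a) (coord_inv (cs a) y))" for a
    have dhs: "smooth_on (img (cs a)) (dh a)" for a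
      unfolding dh_def using D[of a] sym_tensorsD(4)[OF h cs, of a] by (simp add: linearizes_def has_adjoint_def)
    have piece: "((\<lambda>p. \<integral>y. indicator (K a) y * (f a y * ((\<Phi> a (perturb g p) y - \<Phi> a g y) / fst p)) \<partial>lborel) \<longlongrightarrow>
        (\<integral>y. indicator (K a) y * (f a y * dh a y) \<partial>lborel)) (variation_filter h)" for a
    proof (rule tendsto_integral_compact[OF K(1)])
      interpret smooth_difference "img (cs a)" "K a" "variation_filter h" fst
        by (rule smooth_difference_variation[OF cs K])
      have "rate (\<lambda>p. \<Phi> a (perturb g p)) (\<Phi> a g) (dh a)"
        using D[of a] h unfolding linearizes_def dh_def by blast
      then show "uniform_limit (K a) (\<lambda>p y. f a y * ((\<Phi> a (perturb g p) y - \<Phi> a g y) / fst p))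
          (\<lambda>y. f a y * dh a y) (variation_filter h)"
        unfolding rate_def by (intro uniform_lim_mult[OF uniform_limit_const] bounded_on_K fs dhs)
      show "\<forall>\<^sub>F p in variation_filter h. continuous_on (K a) (\<lambda>y. f a y * ((\<Phi> a (perturb g p) y - \<Phi> a g y) / fst p))"
        using eventually_perturb_metric[OF g h] t_nonzero
      proof eventually_elim
        case (elim p)
        show ?case
          by (intro continuous_on_mult continuous_on_divide continuous_on_diff continuous_on_const
              cont[OF fs] cont[OF \<Phi>s[OF elim(1)]] cont[OF \<Phi>s[OF g]]) (simp add: elim(2))
      qed
      show "continuous_on (K a) (\<lambda>y. f a y * dh a y)"
        by (intro continuous_on_mult cont[OF fs] cont[OF dhs])
    qed
    have fd: "indicator (K a) y * (f a y * dh a y) = f a y * dh a y" for a y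
      by (simp add: f_def indicator_def)
    have "L h = (\<Sum>a\<in>I. \<integral>y. indicator (K a) y * (f a y * dh a y) \<partial>lborel)"
      unfolding fd unfolding dh_def by (rule Lh[OF h])
    then have "((\<lambda>p. \<Sum>a\<in>I. \<integral>y. indicator (K a) y * (f a y * ((\<Phi> a (perturb g p) y - \<Phi> a g y) / fst p)) \<partial>lborel) \<longlongrightarrow>
        L h) (variation_filter h)"
      using piece by (simp only:) (intro tendsto_sum)
    then show ?thesis
    proof (rule Lim_transform_eventually)
      show "\<forall>\<^sub>F p in variation_filter h.
          (\<Sum>a\<in>I. \<integral>y. indicator (K a) y * (f a y * ((\<Phi> a (perturb g p) y - \<Phi> a g y) / fst p)) \<partial>lborel) =
          (energy (perturb g p) - energy g) / fst p"
        using eventually_perturb_metric[OF g h]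
      proof eventually_elim
        case (elim p)
        have int: "integrable lborel (\<lambda>y. indicator (K a) y * (f a y * \<Phi> a g' y))" if "g' \<in> metrics A" for a g'
          using borel_integrable_compact[OF K(1) continuous_on_mult[OF cont[OF fs] cont[OF \<Phi>s[OF that]]]] by simp
        have d: "indicator (K a) y * (f a y * ((\<Phi> a (perturb g p) y - \<Phi> a g y) / fst p)) =
            (indicator (K a) y * (f a y * \<Phi> a (perturb g p) y) - indicator (K a) y * (f a y * \<Phi> a g y)) / fst p" for a y
          by (simp add: right_diff_distrib diff_divide_distrib)
        have q: "(\<integral>y. indicator (K a) y * (f a y * ((\<Phi> a (perturb g p) y - \<Phi> a g y) / fst p)) \<partial>lborel) =
            ((\<integral>y. indicator (K a) y * (f a y * \<Phi> a (perturb g p) y) \<partial>lborel) -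
             (\<integral>y. indicator (K a) y * (f a y * \<Phi> a g y) \<partial>lborel)) / fst p" for a
          by (simp only: d integral_divide_zero Bochner_Integration.integral_diff[OF int[OF elim] int[OF g]])
        show ?case
          unfolding energy_eq[OF elim] energy_eq[OF g] sum_subtractf[symmetric] sum_divide_distrib q
          by (rule refl)
      qed
    qed
  qed
  have "has_functional_derivative A energy g L"
    unfolding has_functional_derivative_def
  proof (intro conjI ballI allI)
    show "L (tensor_add h k) = L h + L k" if "h \<in> sym_tensors A" "k \<in> sym_tensors A" for h k
      by (simp add: L_def kernel_functional_add[OF cs e(1) that] sum.distrib)
    show "L (tensor_scale (\<lambda>_. s) h) = s * L h" if "h \<in> sym_tensors A" for h s
      by (simp add: L_def kernel_functional_scale[OF cs e(1) that] sum_distrib_left)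
    show "continuous_map (smooth_topology A) euclideanreal L"
      unfolding continuous_map_atin limitin_canonical_iff topspace_smooth_topology
    proof
      fix h assume h: "h \<in> sym_tensors A"
      have "(L \<longlongrightarrow> L h) (nhdsin (smooth_topology A) h)"
        unfolding L_def by (intro tendsto_sum kernel_functional_tendsto[OF cs e(1) h])
      then show "(L \<longlongrightarrow> L h) (atin (smooth_topology A) h)"
        by (rule tendsto_mono[rotated]) (simp add: atin_def)
    qed
    show "((\<lambda>(t, k). (energy (tensor_add g (tensor_scale (\<lambda>_. t) k)) - energy g) / t) \<longlongrightarrow> L h)
        (at 0 \<times>\<^sub>F nhdsin (smooth_topology A) h)" if "h \<in> sym_tensors A" for h
      using lim[OF that] by (simp add: perturb_def variation_filter_def case_prod_unfold)
  qed
  moreover have "\<exists>B. represents g B L"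
    unfolding L_def by (rule represents_sum[OF I kernel_functional_represented[OF g cs e(1)]])
  ultimately show ?thesis by blast
qed

text \<open>By \<open>riemannian_measure_pullback\<close> the left-hand side is the integral of \<open>V g \<circ> \<phi>\<close> over an image measure
  under \<open>inv \<phi>\<close>.\<close>

lemma energy_invariant:
  assumes g: "g \<in> metrics A" and \<phi>: "diffeomorphism A \<phi>" and nat: "V g \<circ> \<phi> = V (pullback A \<phi> g)"
  shows "energy (pullback A \<phi> g) = energy g"
proof -
  have bij: "bij \<phi>" and sm: "smooth_map A \<phi>" "smooth_map A (inv \<phi>)"
    using \<phi> by (auto simp: diffeomorphism_def)
  have inv: "inv \<phi> \<in> measurable (riemannian_measure A g) borel"
    using sm(2) metrics_sym_tensors[OF g] borel_measurable_continuous_onI[of "inv \<phi>"]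
    by (simp add: smooth_map_def cong: measurable_cong_sets)
  have Vm: "V g \<circ> \<phi> \<in> borel_measurable borel"
    using sm(1) smooth_function_continuous[OF invariant_smooth[OF g]] unfolding o_def
    by (intro borel_measurable_continuous_onI continuous_on_compose2[of UNIV "V g" UNIV \<phi>]) (auto simp: smooth_map_def)
  have "energy (pullback A \<phi> g) = (\<integral>x. (V g \<circ> \<phi>) x \<partial>distr (riemannian_measure A g) borel (inv \<phi>))"
    by (simp add: energy_def nat riemannian_measure_pullback[OF \<phi> metrics_sym_tensors[OF g]])
  also have "\<dots> = (\<integral>x. (V g \<circ> \<phi>) (inv \<phi> x) \<partial>riemannian_measure A g)"
    by (rule integral_distr[OF inv Vm])
  also have "\<dots> = energy g"
    using bij by (simp add: energy_def bij_is_surj surj_f_inv_f)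
  finally show ?thesis .
qed

end

end

section \<open>Conformal variation of the integral of an invariant\<close>

context closed_manifold
begin

lemma conformal_class_metrics:
  assumes "g\<^sub>0 \<in> metrics A" "g \<in> conformal_class A g\<^sub>0"
  shows "g \<in> metrics A"
  using assms(2) unfolding conformal_class_def
  by (auto intro!: tensor_scale_metric assms(1) smooth_function_exp smooth_function_mult smooth_function_const)

lemma conformal_class_scale:
  assumes "g \<in> conformal_class A g\<^sub>0" "f \<in> smooth_functions A"
  shows "tensor_scale (\<lambda>x. exp (2 * f x)) g \<in> conformal_class A g\<^sub>0"
proof -
  obtain \<Upsilon> where \<Upsilon>: "\<Upsilon> \<in> smooth_functions A" "g = tensor_scale (\<lambda>x. exp (2 * \<Upsilon> x)) g\<^sub>0"
    using assms(1) by (auto simp: conformal_class_def)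
  have "tensor_scale (\<lambda>x. exp (2 * f x)) g = tensor_scale (\<lambda>x. exp (2 * (f x + \<Upsilon> x))) g\<^sub>0"
    by (simp add: \<Upsilon>(2) tensor_scale_def distrib_left exp_add)
  then show ?thesis
    unfolding conformal_class_def using smooth_function_add[OF assms(2) \<Upsilon>(1)]
    by (intro CollectI exI[of _ "\<lambda>x. f x + \<Upsilon> x"] conjI)
qed

lemma integral_constant_scale:
  assumes g: "g \<in> metrics A" and f: "f \<in> borel_measurable borel"
  shows "(\<integral>x. f x \<partial>riemannian_measure A (tensor_scale (\<lambda>_. exp (2 * s)) g)) =
    exp (real CARD('n) * s) * (\<integral>x. f x \<partial>riemannian_measure A g)"
proof -
  have fm: "f \<in> borel_measurable (riemannian_measure A g)"
    using f metrics_sym_tensors[OF g] by (simp cong: measurable_cong_sets)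
  have "exp (2 * s) = (exp s)\<^sup>2" by (simp add: exp_double)
  then have "(\<integral>x. f x \<partial>riemannian_measure A (tensor_scale (\<lambda>_. exp (2 * s)) g)) =
      (\<integral>x. f x \<partial>density (riemannian_measure A g) (\<lambda>_. ennreal (exp s ^ CARD('n))))"
    by (simp add: riemannian_measure_scale[OF g])
  also have "\<dots> = (\<integral>x. exp s ^ CARD('n) *\<^sub>R f x \<partial>riemannian_measure A g)"
    by (rule integral_density[OF fm]) simp_all
  finally show ?thesis by (simp add: exp_of_nat_mult)
qed

text \<open>Differentiating \<open>S\<close> along constant rescalings gives
  \<open>S(exp(2) g) - S(g) = 2 (exp(n+l) - 1) / (n+l) \<integral> V(g) dv\<close>. Both terms on the left have a known conformal
  variation, which yields that of the integral of \<open>V\<close>.\<close>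

lemma conformal_variation_integral:
  assumes g0: "g\<^sub>0 \<in> metrics A" and C: "C = conformal_class A g\<^sub>0"
    and V: "\<And>g. g \<in> metrics A \<Longrightarrow> V g \<in> smooth_functions A"
    and weight: "has_weight A V l" and l: "l \<noteq> - real CARD('n)"
    and S: "has_conformal_variation A C S V"
  shows "has_conformal_variation A C (\<lambda>g. 2 / (real CARD('n) + l) * (\<integral>x. V g x \<partial>riemannian_measure A g)) V"
proof -
  define m where "m = real CARD('n) + l"
  have m: "m \<noteq> 0" using l by (simp add: m_def)
  define I where "I \<omega> g = (\<integral>x. \<omega> x * V g x \<partial>riemannian_measure A g)" for \<omega> g
  define sc :: "real \<Rightarrow> ('m, 'n) tensor2 \<Rightarrow> ('m, 'n) tensor2" where "sc s g = tensor_scale (\<lambda>_. exp (2 * s)) g" for s g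
  have CM: "g \<in> metrics A" if "g \<in> C" for g
    using conformal_class_metrics[OF g0] that C by blast
  have Csc: "sc s g \<in> C" if "g \<in> C" for s g
    unfolding sc_def C by (rule conformal_class_scale[OF that[unfolded C] smooth_function_const])
  have Isc: "I \<omega> (sc s g) = exp (m * s) * I \<omega> g" if "g \<in> C" "\<omega> \<in> smooth_functions A" for \<omega> s g
  proof -
    have "V (sc s g) x = exp (l * s) * V g x" for x
    proof -
      have "exp (2 * s) = (exp s)\<^sup>2" by (simp add: exp_double)
      then show ?thesis
        using weight CM[OF that(1)] by (simp add: sc_def has_weight_def powr_def)
    qed
    then have "I \<omega> (sc s g) = (\<integral>x. exp (l * s) * (\<omega> x * V g x) \<partial>riemannian_measure A (sc s g))"
      by (simp add: I_def mult_ac)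
    also have "\<dots> = exp (l * s) * (\<integral>x. \<omega> x * V g x \<partial>riemannian_measure A (sc s g))"
      by simp
    also have "(\<integral>x. \<omega> x * V g x \<partial>riemannian_measure A (sc s g)) = exp (real CARD('n) * s) * I \<omega> g"
      unfolding sc_def I_def
      by (rule integral_constant_scale[OF CM[OF that(1)]
            smooth_function_measurable[OF smooth_function_mult[OF that(2) V[OF CM[OF that(1)]]]]])
    finally show ?thesis by (simp add: m_def exp_add[symmetric] distrib_right mult.assoc[symmetric] add.commute)
  qed
  have var: "((\<lambda>s. S (tensor_scale (\<lambda>x. exp (2 * s * \<omega> x)) g)) has_real_derivative 2 * I \<omega> g) (at 0)"
    if "g \<in> C" "\<omega> \<in> smooth_functions A" for g \<omega>
    using S that by (simp add: has_conformal_variation_def I_def)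
  \<comment> \<open>Along \<open>s \<mapsto> exp(2s) g\<close>, both \<open>S\<close> and \<open>2 / m * exp (m * s) * \<integral> V(g) dv\<close> have the derivative
    \<open>2 * exp (m * s) * \<integral> V(g) dv\<close>.\<close>
  have key: "S (sc 1 g) - S g = 2 / m * (exp m - 1) * I (\<lambda>_. 1) g" if g: "g \<in> C" for g
  proof -
    have "((\<lambda>s. S (sc s g) - 2 / m * exp (m * s) * I (\<lambda>_. 1) g) has_real_derivative 0) (at s)" for s
    proof -
      have "((\<lambda>t. S (tensor_scale (\<lambda>x. exp (2 * t * 1)) (sc s g))) has_real_derivative 2 * I (\<lambda>_. 1) (sc s g)) (at 0)"
        by (rule var[OF Csc[OF g] smooth_function_const])
      moreover have "tensor_scale (\<lambda>x. exp (2 * t * 1)) (sc s g) = sc (t + s) g" for t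
        by (simp add: sc_def tensor_scale_def distrib_left exp_add)
      ultimately have "((\<lambda>t. S (sc (t + s) g)) has_real_derivative 2 * (exp (m * s) * I (\<lambda>_. 1) g)) (at 0)"
        by (simp add: Isc[OF g smooth_function_const])
      then have "((\<lambda>t. S (sc t g)) has_real_derivative 2 * (exp (m * s) * I (\<lambda>_. 1) g)) (at (0 + s))"
        by (subst DERIV_shift)
      then have d: "((\<lambda>t. S (sc t g)) has_real_derivative 2 * (exp (m * s) * I (\<lambda>_. 1) g)) (at s)" by simp
      have "((\<lambda>s. 2 / m * exp (m * s) * I (\<lambda>_. 1) g) has_real_derivative
          2 / m * (exp (m * s) * m) * I (\<lambda>_. 1) g) (at s)"
        by (auto intro!: derivative_eq_intros)
      from DERIV_diff[OF d this] show ?thesis using m by simp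
    qed
    from DERIV_isconst_all[OF allI[OF this], of 1 0]
    have "S (sc 1 g) - 2 / m * exp m * I (\<lambda>_. 1) g = S (sc 0 g) - 2 / m * I (\<lambda>_. 1) g" by simp
    moreover have "sc 0 g = g" by (simp add: sc_def tensor_scale_def)
    ultimately have "S (sc 1 g) - S g = 2 / m * exp m * I (\<lambda>_. 1) g - 2 / m * I (\<lambda>_. 1) g"
      by simp
    then show ?thesis by (simp only: right_diff_distrib left_diff_distrib mult_1_right)
  qed
  show ?thesis
    unfolding has_conformal_variation_def m_def[symmetric]
  proof (intro ballI)
    fix g \<omega> assume g: "g \<in> C" and \<omega>: "\<omega> \<in> smooth_functions A"
    define gs where "gs s = tensor_scale (\<lambda>x. exp (2 * s * \<omega> x)) g" for s
    have gsC: "gs s \<in> C" for s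
    proof -
      have "tensor_scale (\<lambda>x. exp (2 * (s * \<omega> x))) g \<in> C"
        unfolding C by (rule conformal_class_scale[OF g[unfolded C] smooth_function_mult[OF smooth_function_const \<omega>]])
      then show ?thesis by (simp add: gs_def mult.assoc)
    qed
    have comm: "tensor_scale (\<lambda>x. exp (2 * s * \<omega> x)) (sc 1 g) = sc 1 (gs s)" for s
      by (simp add: sc_def gs_def tensor_scale_def mult.commute)
    define q where "q = exp m - 1"
    have q: "q \<noteq> 0" using m by (simp add: q_def)
    have "((\<lambda>s. S (sc 1 (gs s)) - S (gs s)) has_real_derivative 2 * I \<omega> (sc 1 g) - 2 * I \<omega> g) (at 0)"
      using DERIV_diff[OF var[OF Csc[OF g] \<omega>, of 1] var[OF g \<omega>]] by (simp only: comm gs_def[symmetric])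
    then have "((\<lambda>s. 2 / m * q * I (\<lambda>_. 1) (gs s)) has_real_derivative 2 * q * I \<omega> g) (at 0)"
      by (simp add: key[OF gsC] Isc[OF g \<omega>] q_def algebra_simps)
    from DERIV_cmult[OF this, of "inverse q"]
    have "((\<lambda>s. 2 / m * I (\<lambda>_. 1) (gs s)) has_real_derivative 2 * I \<omega> g) (at 0)"
      using q by (simp add: field_simps)
    then show "((\<lambda>s. 2 / m * (\<integral>x. V (tensor_scale (\<lambda>x. exp (2 * s * \<omega> x)) g) x
          \<partial>riemannian_measure A (tensor_scale (\<lambda>x. exp (2 * s * \<omega> x)) g))) has_real_derivative
        2 * (\<integral>x. \<omega> x * V g x \<partial>riemannian_measure A g)) (at 0)"
      by (simp add: I_def gs_def)
  qed
qed

end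

section \<open>The equivalence\<close>

theorem corollary2p9:
  fixes A Or :: "('m::t2_space, 'n::finite) chart set"
    and g\<^sub>0 :: "('m, 'n) tensor2"
    and C :: "('m, 'n) tensor2 set"
    and V :: "('m, 'n) tensor2 \<Rightarrow> 'm \<Rightarrow> real"
    and l :: real
  assumes "closed_oriented_connected_manifold A Or"
    and "CARD('n) \<ge> 2"
    and "g\<^sub>0 \<in> metrics A"
    and "C = conformal_class A g\<^sub>0"
    and "natural_scalar_invariant A V"
    and "has_weight A V l"
    and "l \<noteq> - real CARD('n)"
  shows "conformally_variational A C V \<longleftrightarrow> naturally_conformally_variational A C V"
proof
  assume "naturally_conformally_variational A C V"
  then show "conformally_variational A C V"
    unfolding naturally_conformally_variational_def conformally_variational_def by blast
next
  assume "conformally_variational A C V"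
  then obtain S\<^sub>0 where S0: "has_conformal_variation A C S\<^sub>0 V"
    unfolding conformally_variational_def by blast
  interpret closed_manifold A
    by standard (use assms(1) in \<open>simp_all add: closed_oriented_connected_manifold_def\<close>)
  define r where "r = 2 / (real CARD('n) + l)"
  obtain P where P: "\<And>g c x. g \<in> metrics A \<Longrightarrow> c \<in> A \<Longrightarrow> x \<in> dom_of c \<Longrightarrow> V g x = eval_mpoly (jet_value g c x) P"
    using assms(5) unfolding natural_scalar_invariant_def by blast
  have nat: "V g \<circ> \<phi> = V (pullback A \<phi> g)" if "g \<in> metrics A" "diffeomorphism A \<phi>" for g \<phi>
    using assms(5) that unfolding natural_scalar_invariant_def by blast
  define W where "W g x = r * V g x" for g x
  have W: "W g x = r * eval_mpoly (jet_value g c x) P" if "g \<in> metrics A" "c \<in> A" "x \<in> dom_of c" for g c x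
    by (simp add: W_def P[OF that])
  have V: "V g x = 1 * eval_mpoly (jet_value g c x) P" if "g \<in> metrics A" "c \<in> A" "x \<in> dom_of c" for g c x
    by (simp add: P[OF that])
  define S where "S = energy W"
  have derivative: "\<exists>L B. has_functional_derivative A S g L \<and> represents g B L" if "g \<in> metrics A" for g
    unfolding S_def by (rule energy_derivative[OF _ that]) (rule W)
  have smooth: "V g \<in> smooth_functions A" if "g \<in> metrics A" for g
    by (rule invariant_smooth[OF _ that]) (rule V)
  have "has_conformal_variation A C (\<lambda>g. r * (\<integral>x. V g x \<partial>riemannian_measure A g)) V"
    unfolding r_def by (rule conformal_variation_integral[OF assms(3,4) smooth assms(6,7) S0])
  also have "(\<lambda>g. r * (\<integral>x. V g x \<partial>riemannian_measure A g)) = S"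
    by (simp add: S_def energy_def[OF W] W_def fun_eq_iff)
  finally have variation: "has_conformal_variation A C S V" .
  have natW: "W g \<circ> \<phi> = W (pullback A \<phi> g)" if "g \<in> metrics A" "diffeomorphism A \<phi>" for g \<phi>
    using nat[OF that] by (simp add: W_def fun_eq_iff)
  have "S (pullback A \<phi> g) = S g" if "g \<in> metrics A" "diffeomorphism A \<phi>" for g \<phi>
    unfolding S_def by (rule energy_invariant[OF _ that natW[OF that]]) (rule W)
  then have "riemannian_functional A S"
    unfolding riemannian_functional_def by blast
  moreover have "differentiable_functional A S"
    unfolding differentiable_functional_def using derivative by blast
  moreover have "\<exists>B. has_gradient A S g B" if "g \<in> C" for g
  proof -
    have "g \<in> metrics A" using conformal_class_metrics[OF assms(3)] that assms(4) by blast
    from derivative[OF this] show ?thesis unfolding has_gradient_def represents_def by blast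
  qed
  ultimately show "naturally_conformally_variational A C V"
    unfolding naturally_conformally_variational_def using variation by blast
qed

end
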